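(* Let $b:\mathbb{R}\to\mathbb{R}$ and $\sigma:\mathbb{R}\to(0,\infty)$ be continuous with period 1, and let $X$ solve $dX_t=b(X_t)dt+\sigma(X_t)dW_t$, $X_0=y\in\mathbb{R}$. Then the affinity of $X$ satisfies $$\gamma=2\int_0^1\frac{b(y)}{\sigma^2(y)}\,dy.$$
   Context: $W$ is a standard Brownian motion; the SDE has a weak solution unique in law. Cycle forming times: $T_0=0$, $T_n=\inf\{t\ge T_{n-1}:|X_t-X_{T_{n-1}}|=1\}$. $N_t=\inf\{n\ge0:T_{n+1}>t\}$, $N^+_t=\sum_{n=1}^{N_t}1_{\{X_{T_n}-X_{T_{n-1}}=1\}}$, $N^-_t=\sum_{n=1}^{N_t}1_{\{X_{T_n}-X_{T_{n-1}}=-1\}}$. The circulations are the almost sure limits $J^\pm=\lim_{t\to\infty}N^\pm_t/t$ (which exist and are positive constants), and the affinity is $\gamma=\log(J^+/J^-)$. *)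

theory Defs
  imports "HOL-Probability.Probability"
begin

definition is_filtration :: "'a measure \<Rightarrow> (real \<Rightarrow> 'a measure) \<Rightarrow> bool" where
  "is_filtration M F \<longleftrightarrow>
     (\<forall>t\<ge>0. subalgebra M (F t)) \<and>
     (\<forall>s t. 0 \<le> s \<longrightarrow> s \<le> t \<longrightarrow> sets (F s) \<subseteq> sets (F t))"

definition brownian_motion ::
  "'a measure \<Rightarrow> (real \<Rightarrow> 'a measure) \<Rightarrow> (real \<Rightarrow> 'a \<Rightarrow> real) \<Rightarrow> bool" where
  "brownian_motion M F W \<longleftrightarrow>
     prob_space M \<and> is_filtration M F \<and>
     (\<forall>t\<ge>0. W t \<in> borel_measurable (F t)) \<and>
     (\<forall>\<omega>\<in>space M. W 0 \<omega> = 0) \<and>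
     (\<forall>\<omega>\<in>space M. continuous_on {0..} (\<lambda>t. W t \<omega>)) \<and>
     (\<forall>s t. 0 \<le> s \<longrightarrow> s < t \<longrightarrow>
        distributed M lborel (\<lambda>\<omega>. W t \<omega> - W s \<omega>)
          (\<lambda>x. ennreal (normal_density 0 (sqrt (t - s)) x)) \<and>
        (\<forall>A\<in>sets (F s). \<forall>B\<in>sets borel.
           measure M (A \<inter> {\<omega>\<in>space M. W t \<omega> - W s \<omega> \<in> B})
             = measure M A * measure M {\<omega>\<in>space M. W t \<omega> - W s \<omega> \<in> B}))"

definition conv_in_prob :: "'a measure \<Rightarrow> (nat \<Rightarrow> 'a \<Rightarrow> real) \<Rightarrow> ('a \<Rightarrow> real) \<Rightarrow> bool" where
  "conv_in_prob M Z Y \<longleftrightarrow>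
     (\<forall>e>0. (\<lambda>n. measure M {\<omega>\<in>space M. \<bar>Z n \<omega> - Y \<omega>\<bar> > e}) \<longlonglongrightarrow> 0)"

text \<open>Ito integral of a continuous adapted integrand H against W over [0,t], given as the
  limit in probability of the left-point Riemann sums along dyadic partitions of [0,t].\<close>
definition ito_integral_is ::
  "'a measure \<Rightarrow> (real \<Rightarrow> 'a \<Rightarrow> real) \<Rightarrow> (real \<Rightarrow> 'a \<Rightarrow> real) \<Rightarrow> real \<Rightarrow> ('a \<Rightarrow> real) \<Rightarrow> bool" where
  "ito_integral_is M W H t I \<longleftrightarrow>
     I \<in> borel_measurable M \<and>
     conv_in_prob M
       (\<lambda>n \<omega>. \<Sum>k<2^n. H (t * real k / 2^n) \<omega> *
                 (W (t * real (Suc k) / 2^n) \<omega> - W (t * real k / 2^n) \<omega>)) I"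

definition sde_weak_solution ::
  "'a measure \<Rightarrow> (real \<Rightarrow> 'a measure) \<Rightarrow> (real \<Rightarrow> 'a \<Rightarrow> real) \<Rightarrow> (real \<Rightarrow> 'a \<Rightarrow> real)
   \<Rightarrow> (real \<Rightarrow> real) \<Rightarrow> (real \<Rightarrow> real) \<Rightarrow> real \<Rightarrow> bool" where
  "sde_weak_solution M F W X b \<sigma> y \<longleftrightarrow>
     brownian_motion M F W \<and>
     (\<forall>t\<ge>0. X t \<in> borel_measurable (F t)) \<and>
     (\<forall>\<omega>\<in>space M. continuous_on {0..} (\<lambda>t. X t \<omega>)) \<and>
     (\<forall>\<omega>\<in>space M. X 0 \<omega> = y) \<and>
     (\<forall>t\<ge>0. \<exists>I. ito_integral_is M W (\<lambda>s \<omega>. \<sigma> (X s \<omega>)) t I \<and>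
        (AE \<omega> in M. X t \<omega> = y + integral {0..t} (\<lambda>s. b (X s \<omega>)) + I \<omega>))"

fun cycle_time :: "(real \<Rightarrow> real) \<Rightarrow> nat \<Rightarrow> ereal" where
  "cycle_time x 0 = 0"
| "cycle_time x (Suc n) =
     Inf (ereal ` {t. cycle_time x n \<le> ereal t \<and>
                      \<bar>x t - x (real_of_ereal (cycle_time x n))\<bar> = 1})"

definition cycle_count :: "(real \<Rightarrow> real) \<Rightarrow> real \<Rightarrow> nat" where
  "cycle_count x t = (LEAST n. cycle_time x (Suc n) > ereal t)"

definition cycle_count_plus :: "(real \<Rightarrow> real) \<Rightarrow> real \<Rightarrow> nat" where
  "cycle_count_plus x t = card {n \<in> {1..cycle_count x t}.
      x (real_of_ereal (cycle_time x n)) - x (real_of_ereal (cycle_time x (n - 1))) = 1}"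

definition cycle_count_minus :: "(real \<Rightarrow> real) \<Rightarrow> real \<Rightarrow> nat" where
  "cycle_count_minus x t = card {n \<in> {1..cycle_count x t}.
      x (real_of_ereal (cycle_time x n)) - x (real_of_ereal (cycle_time x (n - 1))) = -1}"

end

theory Submission
  imports Defs
begin

text \<open>The cycles are the passages of \<open>X\<close> between neighbouring points of \<open>y + \<int>\<close>. Let \<open>L\<close> be the
  generator of \<open>X\<close>, and let \<open>V\<close> be of class \<open>C\<^sup>2\<close> with \<open>V(0) = 0\<close> and \<open>L V(\<cdot> - y) = \<kappa>\<close>. By periodicity
  the same \<open>V\<close> can be used in every cycle, so with \<open>Z\<^sub>t\<close> the starting point of the cycle running at
  time \<open>t\<close>, the process
  \<open>V(1) N\<^sup>+\<^sub>t + V(-1) N\<^sup>-\<^sub>t + V(X\<^sub>t - Z\<^sub>t) - \<kappa> t\<close>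
  is a stochastic integral with bounded integrand and has second moment \<open>O(t)\<close>; hence
  \<open>V(1) J\<^sup>+ + V(-1) J\<^sup>- = \<kappa>\<close>. The scale function (\<open>\<kappa> = 0\<close>) satisfies \<open>V(-1) = - exp(\<gamma>) V(1)\<close> with
  \<open>\<gamma> = 2 \<integral> b/\<sigma>\<^sup>2\<close>, which gives \<open>J\<^sup>+ = exp(\<gamma>) J\<^sup>-\<close>; a solution for \<open>\<kappa> = 1\<close> shows that
  \<open>J\<^sup>+\<close> and \<open>J\<^sup>-\<close> do not both vanish. No strong Markov property is needed, and Ito's formula enters
  only through convergence in probability of second-order Taylor sums along dyadic grids.\<close>

section \<open>Cycle times of a continuous path\<close>

text \<open>When a cycle closes, X - Z moves from 1 or -1 to 0, so V(X - Z) drops from V(1) or V(-1)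
  to V(0) = 0; the counting terms put these drops back. In the grid sums Z is frozen at the left end
  of each cell, so only increments of X are expanded. The obstacle is the form of the stochastic
  integral: it is given for each time separately, as a limit in probability along dyadic partitions
  of that time interval. Partitions for different end points need not nest, and the integral is not
  given as an adapted process. Estimates are therefore proved by isometry for sums on one common
  grid and carried to the limit as bounds outside an event of small probability. A second moment of
  order t bounds the functional minus \<kappa> t by \<epsilon> t outside an event of probability
  O(1/t). These probabilities are summable along square times, and the almost sure limits are
  evaluated there.\<close>

definition cycle_base :: "(real \<Rightarrow> real) \<Rightarrow> real \<Rightarrow> real" where
  "cycle_base x t = x (real_of_ereal (cycle_time x (cycle_count x t)))"

context
  fixes x :: "real \<Rightarrow> real"
  assumes cont: "continuous_on {0..} x"
begin

lemma cycle_time_mono_Suc: "cycle_time x n \<le> cycle_time x (Suc n)"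
  by (auto intro!: Inf_greatest)

lemma cycle_time_mono: "m \<le> n \<Longrightarrow> cycle_time x m \<le> cycle_time x n"
  by (rule lift_Suc_mono_le[of "cycle_time x"]) (auto simp del: cycle_time.simps intro: cycle_time_mono_Suc)

lemma cycle_time_nonneg: "0 \<le> cycle_time x n"
  using cycle_time_mono[of 0 n] by simp

text \<open>Continuity makes the set of admissible times closed, so its infimum is attained. A
  finite bound excludes the empty set, whose infimum in \<open>ereal\<close> is infinite, and
  \<open>q < r\<close> because the displacement at time \<open>q\<close> is 0.\<close>

lemma cycle_time_SucE:
  assumes "cycle_time x (Suc n) \<le> ereal t"
  obtains q r where "cycle_time x n = ereal q" "cycle_time x (Suc n) = ereal r"
    "0 \<le> q" "q < r" "r \<le> t" "\<bar>x r - x q\<bar> = 1"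
proof -
  have "cycle_time x n \<le> ereal t" using assms cycle_time_mono_Suc[of n] by (rule order_trans[rotated])
  with cycle_time_nonneg[of n] obtain q where q: "cycle_time x n = ereal q" "0 \<le> q"
    by (cases "cycle_time x n") auto
  define S where "S = {s. q \<le> s \<and> \<bar>x s - x q\<bar> = 1}"
  have eq: "cycle_time x (Suc n) = Inf (ereal ` S)" by (simp add: q S_def)
  have ne: "S \<noteq> {}" using assms unfolding eq by (auto simp: top_ereal_def)
  have bdd: "bdd_below S" unfolding S_def bdd_below_def by auto
  have "closed ({q..} \<inter> (\<lambda>s. \<bar>x s - x q\<bar>) -` {1})"
    by (rule continuous_closed_preimage)
      (auto intro!: continuous_intros continuous_on_subset[OF cont] simp: q)
  also have "{q..} \<inter> (\<lambda>s. \<bar>x s - x q\<bar>) -` {1} = S" unfolding S_def by auto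
  finally have "Inf S \<in> S" using ne bdd by (intro closed_contains_Inf)
  moreover have er: "cycle_time x (Suc n) = ereal (Inf S)"
    unfolding eq using ereal_Inf'[OF bdd ne] by simp
  moreover have "Inf S \<noteq> q" using \<open>Inf S \<in> S\<close> by (auto simp: S_def)
  ultimately show ?thesis using assms q by (intro that[of q "Inf S"]) (auto simp: S_def)
qed

text \<open>By the intermediate value theorem, a displacement of size at least 1 would have passed
  through size exactly 1, ending the cycle no later than \<open>t\<close>.\<close>

lemma dist_lt_one_of_lt_cycle_time:
  assumes "cycle_time x n = ereal q" "q \<le> t" "ereal t < cycle_time x (Suc n)"
  shows "\<bar>x t - x q\<bar> < 1"
proof (rule ccontr)
  assume "\<not> \<bar>x t - x q\<bar> < 1"
  moreover have "0 \<le> q" using cycle_time_nonneg[of n] assms by simp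
  moreover from \<open>0 \<le> q\<close> have "continuous_on {q..t} (\<lambda>s. \<bar>x s - x q\<bar>)"
    by (intro continuous_intros continuous_on_subset[OF cont]) auto
  ultimately obtain u where u: "q \<le> u" "u \<le> t" "\<bar>x u - x q\<bar> = 1"
    using IVT'[of "\<lambda>s. \<bar>x s - x q\<bar>" q 1 t] assms(2) by auto
  have "cycle_time x (Suc n) \<le> ereal u"
    using u assms(1) by (auto intro!: Inf_lower)
  also have "\<dots> \<le> ereal t" using u by simp
  finally show False using assms(3) by simp
qed

lemma uniform_modulus:
  assumes "0 < (e::real)"
  obtains \<delta> where "0 < \<delta>" "\<And>u v. u \<in> {0..t} \<Longrightarrow> v \<in> {0..t} \<Longrightarrow> \<bar>u - v\<bar> < \<delta> \<Longrightarrow> \<bar>x u - x v\<bar> < e"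
proof -
  have "uniformly_continuous_on {0..t} x"
    by (intro compact_uniformly_continuous continuous_on_subset[OF cont]) auto
  then show ?thesis using assms that unfolding uniformly_continuous_on_def dist_real_def by metis
qed

text \<open>Cycles cannot accumulate: by uniform continuity on \<open>[0, t]\<close> a displacement
  of size 1 takes at least a fixed time \<open>\<delta>\<close>. This makes the \<open>LEAST\<close>
  in \<open>cycle_count\<close> meaningful.\<close>

lemma ex_cycle_time_gt: "\<exists>n. ereal t < cycle_time x (Suc n)"
proof (rule ccontr)
  assume "\<not> ?thesis"
  then have le: "cycle_time x (Suc n) \<le> ereal t" for n by (simp add: not_less del: cycle_time.simps)
  obtain \<delta> where d: "0 < \<delta>" "\<And>u v. u \<in> {0..t} \<Longrightarrow> v \<in> {0..t} \<Longrightarrow> \<bar>u - v\<bar> < \<delta> \<Longrightarrow> \<bar>x u - x v\<bar> < 1"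
    using uniform_modulus[of 1 t] by auto
  have step: "cycle_time x n + ereal \<delta> \<le> cycle_time x (Suc n)" for n
    using le[of n]
  proof (rule cycle_time_SucE)
    fix q r assume *: "cycle_time x n = ereal q" "cycle_time x (Suc n) = ereal r"
      "0 \<le> q" "q < r" "r \<le> t" "\<bar>x r - x q\<bar> = 1"
    then have "\<not> \<bar>r - q\<bar> < \<delta>" using d(2)[of r q] by auto
    then show ?thesis using * by (simp del: cycle_time.simps)
  qed
  have "ereal (real n * \<delta>) \<le> cycle_time x n" for n
  proof (induction n)
    case (Suc n)
    have "ereal (real (Suc n) * \<delta>) = ereal (real n * \<delta>) + ereal \<delta>" by (simp add: algebra_simps)
    also have "\<dots> \<le> cycle_time x n + ereal \<delta>" using Suc by (rule add_right_mono)
    also have "\<dots> \<le> cycle_time x (Suc n)" by (rule step)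
    finally show ?case .
  qed simp
  from order_trans[OF this le] have le': "real (Suc n) * \<delta> \<le> t" for n by (metis ereal_less_eq(3))
  obtain n where n: "t < real n * \<delta>" using reals_Archimedean3[OF d(1)] by auto
  with le'[of n] d(1) show False by (simp add: algebra_simps)
qed

lemma cycle_countE:
  assumes "0 \<le> t"
  obtains q where "cycle_time x (cycle_count x t) = ereal q" "0 \<le> q" "q \<le> t"
    "ereal t < cycle_time x (Suc (cycle_count x t))" "cycle_base x t = x q"
proof -
  have 1: "ereal t < cycle_time x (Suc (cycle_count x t))"
    unfolding cycle_count_def by (rule LeastI_ex[OF ex_cycle_time_gt])
  have "cycle_time x (cycle_count x t) \<le> ereal t"
  proof (cases "cycle_count x t")
    case 0 then show ?thesis using assms by simp
  next
    case (Suc n)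
    then have "n < (LEAST n. cycle_time x (Suc n) > ereal t)"
      by (simp add: cycle_count_def del: cycle_time.simps)
    from not_less_Least[OF this] show ?thesis using Suc by (simp del: cycle_time.simps)
  qed
  then obtain q where "cycle_time x (cycle_count x t) = ereal q" "0 \<le> q" "q \<le> t"
    using cycle_time_nonneg[of "cycle_count x t"] by (cases "cycle_time x (cycle_count x t)") auto
  then show ?thesis using 1 that by (simp add: cycle_base_def del: cycle_time.simps)
qed

lemma cycle_count_mono:
  assumes "0 \<le> s" "s \<le> t"
  shows "cycle_count x s \<le> cycle_count x t"
proof -
  have "ereal s < cycle_time x (Suc (cycle_count x t))"
  proof -
    have "0 \<le> t" using assms by simp
    then have "ereal t < cycle_time x (Suc (cycle_count x t))" by (rule cycle_countE)
    then show ?thesis using assms(2) by (metis ereal_less_eq(3) le_less_trans)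
  qed
  then show ?thesis unfolding cycle_count_def[of x s] by (rule Least_le)
qed

lemma abs_diff_cycle_base_less:
  assumes "0 \<le> t"
  shows "\<bar>x t - cycle_base x t\<bar> < 1"
  using cycle_countE[OF assms] dist_lt_one_of_lt_cycle_time by metis

lemma cycle_time_value_Ints:
  assumes "cycle_time x n = ereal q"
  shows "x q - x 0 \<in> \<int>"
  using assms
proof (induction n arbitrary: q)
  case (Suc n)
  from Suc.prems have "cycle_time x (Suc n) \<le> ereal q" by (simp del: cycle_time.simps)
  then show ?case
  proof (rule cycle_time_SucE)
    fix q' r assume *: "cycle_time x n = ereal q'" "cycle_time x (Suc n) = ereal r" "\<bar>x r - x q'\<bar> = 1"
    then have "r = q" using Suc.prems by simp
    with * have "x q - x q' \<in> \<int>" by (metis abs_eq_iff Ints_1 Ints_minus abs_one)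
    from Ints_add[OF this Suc.IH[OF *(1)]] show ?thesis by simp
  qed
qed (simp add: zero_ereal_def)

lemma cycle_base_Ints: "0 \<le> t \<Longrightarrow> cycle_base x t - x 0 \<in> \<int>"
  using cycle_countE cycle_time_value_Ints by metis

text \<open>The base point of the running cycle is the last point of \<open>x 0 + \<int>\<close> visited by time \<open>t\<close>;
  unlike the cycle times themselves, this is visibly determined by the path up to time \<open>t\<close>.\<close>
lemma cycle_base_eq_iff:
  assumes "0 \<le> t"
  shows "cycle_base x t = c \<longleftrightarrow> c - x 0 \<in> \<int> \<and> (\<exists>s\<in>{0..t}. x s = c \<and> (\<forall>u\<in>{s..t}. \<bar>x u - c\<bar> < 1))"
proof -
  obtain q where q: "cycle_time x (cycle_count x t) = ereal q" "0 \<le> q" "q \<le> t"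
    "ereal t < cycle_time x (Suc (cycle_count x t))" "cycle_base x t = x q"
    using cycle_countE[OF assms] .
  have qu: "\<bar>x u - x q\<bar> < 1" if "u \<in> {q..t}" for u
    using dist_lt_one_of_lt_cycle_time[OF q(1), of u] that q(4) by (metis atLeastAtMost_iff ereal_less_eq(3) le_less_trans)
  have qI: "x q - x 0 \<in> \<int>" using cycle_time_value_Ints[OF q(1)] .
  show ?thesis
  proof
    assume "cycle_base x t = c"
    then show "c - x 0 \<in> \<int> \<and> (\<exists>s\<in>{0..t}. x s = c \<and> (\<forall>u\<in>{s..t}. \<bar>x u - c\<bar> < 1))"
      using q qu qI by (intro conjI bexI[of _ q]) auto
  next
    assume "c - x 0 \<in> \<int> \<and> (\<exists>s\<in>{0..t}. x s = c \<and> (\<forall>u\<in>{s..t}. \<bar>x u - c\<bar> < 1))"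
    then obtain s where s: "c - x 0 \<in> \<int>" "0 \<le> s" "s \<le> t" "x s = c" "\<And>u. u \<in> {s..t} \<Longrightarrow> \<bar>x u - c\<bar> < 1"
      by auto
    \<comment> \<open>The later of the visits at \<open>q\<close> and \<open>s\<close> falls into
      the stay around the earlier one, so the visited points are less than 1 apart, while their
      difference is an integer.\<close>
    have "\<bar>x q - c\<bar> < 1"
    proof (cases "s \<le> q")
      case True then show ?thesis using s(5)[of q] q by auto
    next
      case False then show ?thesis using qu[of s] s by (auto simp: abs_minus_commute)
    qed
    moreover have "x q - c \<in> \<int>" using Ints_diff[OF qI s(1)] by simp
    ultimately show "cycle_base x t = c" using q(5) Ints_nonzero_abs_less1[of "x q - c"] by auto
  qed
qed

lemma cycle_counts_eq:
  assumes "cycle_count x s = cycle_count x t"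
  shows "cycle_base x s = cycle_base x t" "cycle_count_plus x s = cycle_count_plus x t"
    "cycle_count_minus x s = cycle_count_minus x t"
  using assms by (auto simp: cycle_base_def cycle_count_plus_def cycle_count_minus_def)

text \<open>Two cycle ends after \<open>s\<close> and up to \<open>t\<close> would enclose a whole
  cycle, hence an oscillation of 1. The witness \<open>u\<close> is the single cycle end, where the
  path sits exactly on the new base point.\<close>

lemma cycle_count_step:
  assumes st: "0 \<le> s" "s \<le> t" and osc: "\<forall>u\<in>{s..t}. \<forall>v\<in>{s..t}. \<bar>x u - x v\<bar> < 1"
    and ne: "cycle_count x s \<noteq> cycle_count x t"
  obtains u where "u \<in> {s..t}" "x u = cycle_base x t" "cycle_count x t = Suc (cycle_count x s)"
    "cycle_base x t = cycle_base x s + 1" "cycle_count_plus x t = Suc (cycle_count_plus x s)"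
    "cycle_count_minus x t = cycle_count_minus x s"
  | u where "u \<in> {s..t}" "x u = cycle_base x t" "cycle_count x t = Suc (cycle_count x s)"
    "cycle_base x t = cycle_base x s - 1" "cycle_count_plus x t = cycle_count_plus x s"
    "cycle_count_minus x t = Suc (cycle_count_minus x s)"
proof -
  define n where "n = cycle_count x s"
  have lt: "n < cycle_count x t" using cycle_count_mono[OF st] ne by (simp add: n_def)
  have le: "cycle_time x k \<le> ereal t" if "k \<le> cycle_count x t" for k
    using cycle_time_mono[OF that] cycle_countE[of t] st by (metis dual_order.trans ereal_less_eq(3))
  obtain q r where qr: "cycle_time x n = ereal q" "cycle_time x (Suc n) = ereal r"
    "0 \<le> q" "q < r" "r \<le> t" "\<bar>x r - x q\<bar> = 1"
    using cycle_time_SucE[OF le[of "Suc n"]] lt by auto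
  have sr: "s < r" using cycle_countE[of s] st qr(2) unfolding n_def by (metis less_ereal.simps(1))
  have eq: "cycle_count x t = Suc n"
  proof (rule ccontr)
    assume "cycle_count x t \<noteq> Suc n"
    then have "cycle_time x (Suc (Suc n)) \<le> ereal t" using lt by (intro le) auto
    then show False
    proof (rule cycle_time_SucE)
      fix q' r' assume "cycle_time x (Suc n) = ereal q'" "q' < r'" "r' \<le> t" "\<bar>x r' - x q'\<bar> = 1"
      then show False using osc[rule_format, of r' q'] sr qr by auto
    qed
  qed
  have b: "cycle_base x t = x r" "cycle_base x s = x q"
    using qr by (auto simp: cycle_base_def eq n_def[symmetric] simp del: cycle_time.simps)
  have *: "{k \<in> {1..Suc n}. P k} = (if P (Suc n) then insert (Suc n) {k \<in> {1..n}. P k} else {k \<in> {1..n}. P k})"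
    for P by (auto simp: le_Suc_eq)
  have cp: "cycle_count_plus x t = cycle_count_plus x s + (if x r - x q = 1 then 1 else 0)"
    unfolding cycle_count_plus_def eq n_def[symmetric] * by (simp add: qr del: cycle_time.simps)
  have cm: "cycle_count_minus x t = cycle_count_minus x s + (if x r - x q = - 1 then 1 else 0)"
    unfolding cycle_count_minus_def eq n_def[symmetric] * by (simp add: qr del: cycle_time.simps)
  from qr(6) consider "x r - x q = 1" | "x r - x q = -1" by linarith
  then show ?thesis
  proof cases
    case 1
    then show ?thesis using that(1)[of r] sr qr(5) b cp cm eq n_def by auto
  next
    case 2
    then show ?thesis using that(2)[of r] sr qr(5) b cp cm eq n_def by auto
  qed
qed

text \<open>Only the cells containing a cycle time contribute to the difference of the two sides, there are at
  most \<open>cycle_count x T\<close> of them, and each contribution is small since the path is then close to a base point.\<close>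
lemma cycle_functional_limit:
  fixes V :: "real \<Rightarrow> real"
  assumes T: "0 < T" and V: "continuous_on UNIV V" "V 0 = 0"
  shows "(\<lambda>n. \<Sum>k<2^n. V (x (T * real (Suc k) / 2^n) - cycle_base x (T * real k / 2^n))
                     - V (x (T * real k / 2^n) - cycle_base x (T * real k / 2^n)))
     \<longlonglongrightarrow> V 1 * cycle_count_plus x T + V (-1) * cycle_count_minus x T + V (x T - cycle_base x T)"
    (is "?S \<longlonglongrightarrow> ?L")
proof (rule LIMSEQ_I)
  fix r :: real assume r: "0 < r"
  \<comment> \<open>The functional as a function of time; since \<open>G 0 = 0\<close>, its
    increments over the cells sum to the claimed limit.\<close>
  define G where "G t = V 1 * cycle_count_plus x t + V (-1) * cycle_count_minus x t + V (x t - cycle_base x t)" for t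
  \<comment> \<open>A cell in which a cycle ends costs at most \<open>2 * e\<close>; with
    \<open>N\<close> cycles the total is \<open>r * N / (N + 1) < r\<close>, also for
    \<open>N = 0\<close>.\<close>
  define e where "e = r / (2 * (real (cycle_count x T) + 1))"
  have e: "0 < e" using r by (simp add: e_def)
  have "\<exists>d>0. \<forall>v. \<bar>v - a\<bar> < d \<longrightarrow> \<bar>V v - V a\<bar> < e" for a
    using V(1) e unfolding continuous_on_iff dist_real_def by (metis UNIV_I)
  then obtain d where d: "\<And>a. d a > 0" "\<And>a v. \<bar>v - a\<bar> < d a \<Longrightarrow> \<bar>V v - V a\<bar> < e" by metis
  \<comment> \<open>At the right end of a cell containing a cycle end, the displacement is near 0
    from the new base point and near 1 or -1 from the old one, so \<open>V\<close> is compared with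
    its values at these three points. The entry 1 is the oscillation bound of
    \<open>cycle_count_step\<close>.\<close>
  define \<rho> where "\<rho> = min 1 (min (d 0) (min (d 1) (d (-1))))"
  have "0 < \<rho>" using d(1) by (simp add: \<rho>_def)
  then obtain \<delta> where \<delta>: "0 < \<delta>" "\<And>u v. u \<in> {0..T} \<Longrightarrow> v \<in> {0..T} \<Longrightarrow> \<bar>u - v\<bar> < \<delta> \<Longrightarrow> \<bar>x u - x v\<bar> < \<rho>"
    using uniform_modulus[of \<rho> T] by auto
  have "(\<lambda>n. T / 2^n) \<longlonglongrightarrow> 0" using LIMSEQ_divide_realpow_zero[of 2 T] by simp
  then obtain n0 where n0: "\<And>n. n \<ge> n0 \<Longrightarrow> T / 2^n < \<delta>"
    using order_tendstoD(2)[of _ 0 sequentially \<delta>] \<delta>(1) unfolding eventually_sequentially by metis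
  show "\<exists>no. \<forall>n\<ge>no. norm (?S n - ?L) < r"
  proof (intro exI allI impI)
    fix n assume n: "n0 \<le> n"
    define t where "t k = T * real k / 2^n" for k
    define c where "c k = V (x (t (Suc k)) - cycle_base x (t k)) - V (x (t k) - cycle_base x (t k))" for k
    have t0: "t 0 = 0" "t (2^n) = T" by (simp_all add: t_def)
    \<comment> \<open>Written as an increment of \<open>cycle_count\<close>, the bound is 0 on cells
      without a cycle end, where the two sides agree exactly, and it telescopes over the
      grid.\<close>
    have cell: "\<bar>c k - (G (t (Suc k)) - G (t k))\<bar> \<le> 2 * e * (real (cycle_count x (t (Suc k))) - real (cycle_count x (t k)))"
      if k: "k < 2^n" for k
    proof -
      have b: "0 \<le> t k" "t k \<le> t (Suc k)" using T by (auto simp: t_def divide_simps)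
      have "real (Suc k) \<le> 2^n" using k by (metis Suc_leI of_nat_le_iff of_nat_numeral of_nat_power)
      then have b': "t (Suc k) \<le> T" using T unfolding t_def by (simp add: divide_simps)
      have "t (Suc k) - t k = T / 2^n" by (simp add: t_def field_simps)
      with n0[OF n] have osc: "\<bar>x u - x v\<bar> < \<rho>" if "u \<in> {t k..t (Suc k)}" "v \<in> {t k..t (Suc k)}" for u v
        using that b b' by (intro \<delta>(2)) auto
      then have osc1: "\<forall>u\<in>{t k..t (Suc k)}. \<forall>v\<in>{t k..t (Suc k)}. \<bar>x u - x v\<bar> < 1"
        by (auto simp: \<rho>_def)
      show ?thesis
      proof (cases "cycle_count x (t k) = cycle_count x (t (Suc k))")
        case True
        with cycle_counts_eq[OF this] show ?thesis by (simp add: c_def G_def)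
      next
        case False
        from cycle_count_step[OF b osc1 False] show ?thesis
        proof cases
          case (1 u)
          have close: "\<bar>x (t (Suc k)) - cycle_base x (t (Suc k))\<bar> < \<rho>" using osc[OF _ 1(1), of "t (Suc k)"] b(2) 1(2) by simp
          have "\<bar>V (x (t (Suc k)) - cycle_base x (t k)) - V 1\<bar> < e"
            using close 1 by (intro d(2)) (auto simp: \<rho>_def algebra_simps)
          moreover have "\<bar>V (x (t (Suc k)) - cycle_base x (t (Suc k)))\<bar> < e"
            using close d(2)[of "x (t (Suc k)) - cycle_base x (t (Suc k))" 0] V(2) by (auto simp: \<rho>_def)
          moreover have "c k - (G (t (Suc k)) - G (t k)) =
              (V (x (t (Suc k)) - cycle_base x (t k)) - V 1) - V (x (t (Suc k)) - cycle_base x (t (Suc k)))"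
            unfolding c_def G_def 1(5,6) by (simp add: algebra_simps)
          ultimately show ?thesis using 1(3) by simp
        next
          case (2 u)
          have close: "\<bar>x (t (Suc k)) - cycle_base x (t (Suc k))\<bar> < \<rho>" using osc[OF _ 2(1), of "t (Suc k)"] b(2) 2(2) by simp
          have "\<bar>V (x (t (Suc k)) - cycle_base x (t k)) - V (-1)\<bar> < e"
            using close 2 by (intro d(2)) (auto simp: \<rho>_def algebra_simps)
          moreover have "\<bar>V (x (t (Suc k)) - cycle_base x (t (Suc k)))\<bar> < e"
            using close d(2)[of "x (t (Suc k)) - cycle_base x (t (Suc k))" 0] V(2) by (auto simp: \<rho>_def)
          moreover have "c k - (G (t (Suc k)) - G (t k)) =
              (V (x (t (Suc k)) - cycle_base x (t k)) - V (-1)) - V (x (t (Suc k)) - cycle_base x (t (Suc k)))"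
            unfolding c_def G_def 2(5,6) by (simp add: algebra_simps)
          ultimately show ?thesis using 2(3) by simp
        qed
      qed
    qed
    have cc0: "cycle_count x 0 = 0" unfolding cycle_count_def
    proof (rule Least_eq_0)
      show "ereal 0 < cycle_time x (Suc 0)"
      proof (rule ccontr)
        assume "\<not> ereal 0 < cycle_time x (Suc 0)"
        then have "cycle_time x (Suc 0) \<le> ereal 0" by (simp del: cycle_time.simps)
        then show False by (rule cycle_time_SucE) auto
      qed
    qed
    then have G0: "G 0 = 0" using V(2) by (simp add: G_def cycle_base_def cycle_count_plus_def cycle_count_minus_def)
    have "?S n = (\<Sum>k<2^n. c k)" by (simp only: c_def t_def)
    moreover have "(\<Sum>k<2^n. G (t (Suc k)) - G (t k)) = G T"
      using sum_lessThan_telescope[of "\<lambda>k. G (t k)" "2^n"] t0 G0 by simp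
    then have "?L = (\<Sum>k<2^n. G (t (Suc k)) - G (t k))" by (simp only: G_def)
    ultimately have "\<bar>?S n - ?L\<bar> = \<bar>\<Sum>k<2^n. c k - (G (t (Suc k)) - G (t k))\<bar>"
      by (simp only: sum_subtractf)
    also have "\<dots> \<le> (\<Sum>k<2^n. 2 * e * (real (cycle_count x (t (Suc k))) - real (cycle_count x (t k))))"
      by (rule order_trans[OF sum_abs sum_mono]) (rule cell, simp)
    also have "\<dots> = 2 * e * real (cycle_count x T)"
      unfolding sum_distrib_left[symmetric]
      using sum_lessThan_telescope[of "\<lambda>k. real (cycle_count x (t k))" "2^n"] t0 cc0 by simp
    also have "\<dots> < r" using r by (simp add: e_def field_simps)
    finally show "norm (?S n - ?L) < r" by simp
  qed
qed

end

section \<open>Measurability of the base point with respect to the past\<close>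

lemma countable_dense_in_interval:
  fixes t :: real
  obtains D where "countable D" "D \<subseteq> {0..t}" "0 \<le> t \<Longrightarrow> 0 \<in> D"  "0 \<le> t \<Longrightarrow> t \<in> D"
    "\<And>u v. 0 \<le> u \<Longrightarrow> u < v \<Longrightarrow> v \<le> t \<Longrightarrow> \<exists>d\<in>D. u < d \<and> d < v"
proof
  show "countable ((\<rat> \<union> {t}) \<inter> {0..t})" using countable_rat by (intro countable_Int1) simp
  show "\<exists>d\<in>(\<rat> \<union> {t}) \<inter> {0..t}. u < d \<and> d < v" if "0 \<le> u" "u < v" "v \<le> t" for u v
    using Rats_dense_in_real[OF that(2)] that by fastforce
qed auto

text \<open>The right side has only countable quantifiers, which is what measurability asks for.
  Replacing \<open>s\<close> by a nearby \<open>p\<close> in \<open>D\<close> loses the exact zero,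
  so the visit becomes the occurrence of arbitrarily small values. The stay becomes a bound
  \<open>1 - 1 / real (Suc m)\<close>, since \<open>\<bar>f u\<bar> < 1\<close> on a dense set would
  still allow the value 1 between its points.\<close>

lemma ex_visit_and_stay_iff_countable:
  fixes f :: "real \<Rightarrow> real"
  assumes f: "continuous_on {0..t} f" and t: "0 \<le> t"
    and D: "D \<subseteq> {0..t}" "0 \<in> D" "t \<in> D"
      "\<And>u v. 0 \<le> u \<Longrightarrow> u < v \<Longrightarrow> v \<le> t \<Longrightarrow> \<exists>d\<in>D. u < d \<and> d < v"
  shows "(\<exists>s\<in>{0..t}. f s = 0 \<and> (\<forall>u\<in>{s..t}. \<bar>f u\<bar> < 1)) \<longleftrightarrow>
    (\<exists>p\<in>D. (\<exists>m. \<forall>u\<in>D \<inter> {p..}. \<bar>f u\<bar> \<le> 1 - 1 / real (Suc m)) \<and> (\<forall>j. \<exists>u\<in>D \<inter> {p..}. \<bar>f u\<bar> < 1 / real (Suc j)))"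
    (is "?L = ?R")
proof
  assume ?L
  then obtain s where s: "0 \<le> s" "s \<le> t" "f s = 0" and st: "\<And>u. u \<in> {s..t} \<Longrightarrow> \<bar>f u\<bar> < 1" by auto
  have loc: "\<exists>d>0. \<forall>u\<in>{0..t}. \<bar>u - s\<bar> < d \<longrightarrow> \<bar>f u\<bar> < e" if "0 < e" for e
    using f s that unfolding continuous_on_iff dist_real_def by (metis atLeastAtMost_iff diff_zero)
  obtain d where d: "0 < d" "\<And>u. u \<in> {0..t} \<Longrightarrow> \<bar>u - s\<bar> < d \<Longrightarrow> \<bar>f u\<bar> < 1" using loc[of 1] by auto
  \<comment> \<open>A point of \<open>D\<close> before \<open>s\<close>, close enough that
    \<open>\<bar>f\<bar> < 1\<close> on all of \<open>[p, s]\<close>; for \<open>s = 0\<close> it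
    has to be \<open>s\<close> itself, whence \<open>0 \<in> D\<close>.\<close>
  obtain p where p: "p \<in> D" "p \<le> s" "s - d < p" "p < s \<or> p = 0"
  proof (cases "s = 0")
    case True then show ?thesis using that[of 0] D d by auto
  next
    case False
    then obtain p where "p \<in> D" "max 0 (s - d) < p" "p < s"
      using D(4)[of "max 0 (s - d)" s] s d(1) by auto
    then show ?thesis using that[of p] by auto
  qed
  then have p0: "0 \<le> p" "p \<le> t" using D by auto
  have "\<bar>f u\<bar> < 1" if "u \<in> {p..t}" for u
    using st[of u] d(2)[of u] that p p0 by (cases "s \<le> u") auto
  moreover obtain v where "v \<in> {p..t}" "\<And>u. u \<in> {p..t} \<Longrightarrow> \<bar>f u\<bar> \<le> \<bar>f v\<bar>"
  proof -
    have "continuous_on {p..t} (\<lambda>u. \<bar>f u\<bar>)"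
      using p0 by (intro continuous_intros continuous_on_subset[OF f]) auto
    then show ?thesis
      using continuous_attains_sup[of "{p..t}" "\<lambda>u. \<bar>f u\<bar>"] p0 that by auto
  qed
  moreover from this have "\<bar>f v\<bar> < 1" using calculation(1) by auto
  then obtain m where "inverse (real (Suc m)) < 1 - \<bar>f v\<bar>"
    using reals_Archimedean[of "1 - \<bar>f v\<bar>"] by auto
  ultimately have m: "\<forall>u\<in>D \<inter> {p..}. \<bar>f u\<bar> \<le> 1 - 1 / real (Suc m)"
    using D(1) by (fastforce simp: inverse_eq_divide)
  have "\<exists>u\<in>D \<inter> {p..}. \<bar>f u\<bar> < 1 / real (Suc j)" for j
  proof -
    obtain d where d: "0 < d" "\<And>u. u \<in> {0..t} \<Longrightarrow> \<bar>u - s\<bar> < d \<Longrightarrow> \<bar>f u\<bar> < 1 / real (Suc j)"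
      using loc[of "1 / real (Suc j)"] by auto
    have "\<exists>u\<in>D \<inter> {p..}. \<bar>u - s\<bar> < d"
    proof (cases "p < s")
      case True
      have "0 \<le> max p (s - d)" using p0 by linarith
      with True obtain u where "u \<in> D" "max p (s - d) < u" "u < s"
        using D(4)[of "max p (s - d)" s] s d(1) by auto
      then show ?thesis by (intro bexI[of _ u]) auto
    next
      case False
      then have "p = s" using p by simp
      then show ?thesis using p d(1) by (intro bexI[of _ p]) auto
    qed
    then show ?thesis using d D(1) by blast
  qed
  with m p(1) show ?R by blast
next
  assume ?R
  then obtain p m where p: "p \<in> D" and m: "\<And>u. u \<in> D \<inter> {p..} \<Longrightarrow> \<bar>f u\<bar> \<le> 1 - 1 / real (Suc m)"
    and j: "\<And>j. \<exists>u\<in>D \<inter> {p..}. \<bar>f u\<bar> < 1 / real (Suc j)" by blast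
  have p0: "0 \<le> p" "p \<le> t" using p D by auto
  have cf: "continuous_on {p..t} (\<lambda>u. \<bar>f u\<bar>)"
    using p0 by (intro continuous_intros continuous_on_subset[OF f]) auto
  obtain s where s: "s \<in> {p..t}" "\<And>u. u \<in> {p..t} \<Longrightarrow> \<bar>f s\<bar> \<le> \<bar>f u\<bar>"
    using continuous_attains_inf[OF _ _ cf] p0 by auto
  have "f s = 0"
  proof (rule ccontr)
    assume "f s \<noteq> 0"
    then obtain i where "inverse (real (Suc i)) < \<bar>f s\<bar>" using reals_Archimedean[of "\<bar>f s\<bar>"] by auto
    moreover obtain u where "u \<in> D \<inter> {p..}" "\<bar>f u\<bar> < 1 / real (Suc i)" using j[of i] by auto
    ultimately show False using s(2)[of u] D(1) by (auto simp: inverse_eq_divide)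
  qed
  moreover have "\<bar>f u\<bar> < 1" if u: "u \<in> {p..t}" for u
  proof (rule ccontr)
    assume "\<not> \<bar>f u\<bar> < 1"
    then have u1: "1 - 1 / real (Suc m) < \<bar>f u\<bar>"
      by (smt (verit) divide_pos_pos of_nat_0_less_iff zero_less_Suc)
    \<comment> \<open>Both \<open>p\<close> and \<open>t\<close> belong to \<open>D\<close>, where
      the bound holds directly. Any other \<open>u\<close> is approached from the left by points of
      \<open>D\<close>, and the bound persists by continuity.\<close>
    have "u \<noteq> p" "u \<noteq> t" using u1 m[of u] p D(3) p0 by auto
    with u have "p < u" "u < t" by auto
    obtain d where d: "0 < d" "\<And>v. v \<in> {p..t} \<Longrightarrow> \<bar>v - u\<bar> < d \<Longrightarrow> \<bar>\<bar>f v\<bar> - \<bar>f u\<bar>\<bar> < \<bar>f u\<bar> - (1 - 1 / real (Suc m))"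
      using cf[unfolded continuous_on_iff dist_real_def, rule_format, OF u, of "\<bar>f u\<bar> - (1 - 1 / real (Suc m))"] u1
      by (auto simp del: of_nat_Suc)
    have "0 \<le> max p (u - d)" using p0 by linarith
    then obtain v where v: "v \<in> D" "max p (u - d) < v" "v < u"
      using D(4)[of "max p (u - d)" u] \<open>p < u\<close> \<open>u < t\<close> p0 d(1) by auto
    then have "\<bar>\<bar>f v\<bar> - \<bar>f u\<bar>\<bar> < \<bar>f u\<bar> - (1 - 1 / real (Suc m))"
      using u by (intro d(2)) auto
    moreover have "\<bar>f v\<bar> \<le> 1 - 1 / real (Suc m)" using v by (intro m) auto
    ultimately show False by linarith
  qed
  ultimately show ?L using s(1) p0 by (intro bexI[of _ s]) auto
qed

text \<open>\<open>N\<close> stands for the \<sigma>-algebra of the past: only values of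
  \<open>X\<close> up to \<open>t\<close> enter. The base point lies in the countable set
  \<open>y + \<int>\<close>, so it is enough to treat the events \<open>?Z \<omega> = c\<close> one
  by one, each described by countably many times.\<close>

lemma cycle_base_measurable:
  fixes X :: "real \<Rightarrow> 'a \<Rightarrow> real"
  assumes t: "0 \<le> t" and meas: "\<And>s. 0 \<le> s \<Longrightarrow> s \<le> t \<Longrightarrow> X s \<in> borel_measurable N"
    and cont: "\<And>\<omega>. \<omega> \<in> space N \<Longrightarrow> continuous_on {0..} (\<lambda>s. X s \<omega>)"
    and X0: "\<And>\<omega>. \<omega> \<in> space N \<Longrightarrow> X 0 \<omega> = y"
  shows "(\<lambda>\<omega>. cycle_base (\<lambda>s. X s \<omega>) t) \<in> borel_measurable N"
proof -
  let ?Z = "\<lambda>\<omega>. cycle_base (\<lambda>s. X s \<omega>) t"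
  obtain D where D: "countable D" "D \<subseteq> {0..t}" "0 \<in> D" "t \<in> D"
    "\<And>u v. 0 \<le> u \<Longrightarrow> u < v \<Longrightarrow> v \<le> t \<Longrightarrow> \<exists>d\<in>D. u < d \<and> d < v"
    using countable_dense_in_interval[of t] t by metis
  let ?L = "range (\<lambda>k. y + real_of_int k)"
  have ZL: "?Z \<omega> \<in> ?L" if w: "\<omega> \<in> space N" for \<omega>
    using cycle_base_Ints[OF cont[OF w] t] X0[OF w] by (auto elim!: Ints_cases simp: algebra_simps image_iff)
  have ev: "{\<omega>\<in>space N. ?Z \<omega> = c} \<in> sets N" if "c \<in> ?L" for c
  proof -
    have cI: "c - y \<in> \<int>" using that by auto
    have eq: "?Z \<omega> = c \<longleftrightarrow> (\<exists>p\<in>D. (\<exists>m. \<forall>u\<in>D \<inter> {p..}. \<bar>X u \<omega> - c\<bar> \<le> 1 - 1 / real (Suc m)) \<and>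
        (\<forall>j. \<exists>u\<in>D \<inter> {p..}. \<bar>X u \<omega> - c\<bar> < 1 / real (Suc j)))" if w: "\<omega> \<in> space N" for \<omega>
      unfolding cycle_base_eq_iff[OF cont[OF w] t] X0[OF w]
      by (subst ex_visit_and_stay_iff_countable[OF _ t D(2-5), symmetric])
        (use cI in \<open>auto intro!: continuous_intros continuous_on_subset[OF cont[OF w]]\<close>)
    have m: "X u \<in> borel_measurable N" if "u \<in> D \<inter> {p..}" for u p using that D(2) by (intro meas) auto
    have cnt: "countable (D \<inter> {p..})" for p using D(1) by auto
    have 1: "{\<omega>\<in>space N. \<bar>X u \<omega> - c\<bar> \<le> 1 - 1 / real (Suc i)} \<in> sets N" if "u \<in> D \<inter> {p..}" for u p i
      using m[OF that] by measurable
    have 2: "{\<omega>\<in>space N. \<bar>X u \<omega> - c\<bar> < 1 / real (Suc i)} \<in> sets N" if "u \<in> D \<inter> {p..}" for u p i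
      using m[OF that] by measurable
    have "{\<omega>\<in>space N. \<exists>p\<in>D. (\<exists>m. \<forall>u\<in>D \<inter> {p..}. \<bar>X u \<omega> - c\<bar> \<le> 1 - 1 / real (Suc m)) \<and>
        (\<forall>j. \<exists>u\<in>D \<inter> {p..}. \<bar>X u \<omega> - c\<bar> < 1 / real (Suc j))} \<in> sets N"
      by (intro sets.sets_Collect_conj sets.sets_Collect_countable_Ex'[OF _ D(1)]
          sets.sets_Collect_countable_Ex'[OF _ cnt] sets.sets_Collect_countable_All'[OF _ cnt]
          sets.sets_Collect_countable_Ex sets.sets_Collect_countable_All 1 2)
    also have "{\<omega>\<in>space N. \<exists>p\<in>D. (\<exists>m. \<forall>u\<in>D \<inter> {p..}. \<bar>X u \<omega> - c\<bar> \<le> 1 - 1 / real (Suc m)) \<and>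
        (\<forall>j. \<exists>u\<in>D \<inter> {p..}. \<bar>X u \<omega> - c\<bar> < 1 / real (Suc j))} = {\<omega>\<in>space N. ?Z \<omega> = c}"
      using eq by blast
    finally show ?thesis .
  qed
  show ?thesis
  proof (rule measurableI)
    fix A :: "real set" assume "A \<in> sets borel"
    have "?Z -` A \<inter> space N = (\<Union>c\<in>?L \<inter> A. {\<omega>\<in>space N. ?Z \<omega> = c})" using ZL by auto
    also have "\<dots> \<in> sets N" using ev by (intro sets.countable_UN') auto
    finally show "?Z -` A \<inter> space N \<in> sets N" .
  qed simp
qed

section \<open>Smallness in probability\<close>

text \<open>Exceptional events are used instead of \<open>measure M {\<omega>. a < \<bar>Y \<omega>\<bar>}\<close>: this avoids measurability side
  conditions, and the value \<open>0\<close> of \<open>measure\<close> on non-measurable sets.\<close>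
definition small_off :: "'a measure \<Rightarrow> real \<Rightarrow> real \<Rightarrow> ('a \<Rightarrow> real) \<Rightarrow> bool" where
  "small_off M p a Y \<longleftrightarrow> (\<exists>E\<in>sets M. measure M E \<le> p \<and> (\<forall>\<omega>\<in>space M - E. \<bar>Y \<omega>\<bar> \<le> a))"

text \<open>Convergence to 0 in probability. One parameter can serve for both the probability and
  the size because \<open>small_off\<close> is monotone in each of them.\<close>

definition vanishes_in_prob :: "'a measure \<Rightarrow> (nat \<Rightarrow> 'a \<Rightarrow> real) \<Rightarrow> bool" where
  "vanishes_in_prob M Z \<longleftrightarrow> (\<forall>e>0. \<forall>\<^sub>F n in sequentially. small_off M e e (Z n))"

definition tight_in_prob :: "'a measure \<Rightarrow> (nat \<Rightarrow> 'a \<Rightarrow> real) \<Rightarrow> bool" where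
  "tight_in_prob M Z \<longleftrightarrow> (\<forall>e>0. \<exists>K. \<forall>\<^sub>F n in sequentially. small_off M e K (Z n))"

context prob_space
begin

lemma small_off_mono_AE:
  assumes "small_off M p a Y" "p \<le> q" "a \<le> b" "AE \<omega> in M. \<bar>Z \<omega>\<bar> \<le> \<bar>Y \<omega>\<bar>"
  shows "small_off M q b Z"
proof -
  obtain E where E: "E \<in> sets M" "measure M E \<le> p" "\<And>\<omega>. \<omega> \<in> space M - E \<Longrightarrow> \<bar>Y \<omega>\<bar> \<le> a"
    using assms(1) by (auto simp: small_off_def)
  obtain N where N: "{\<omega>\<in>space M. \<not> \<bar>Z \<omega>\<bar> \<le> \<bar>Y \<omega>\<bar>} \<subseteq> N" "emeasure M N = 0" "N \<in> sets M"
    using assms(4) by (rule AE_E)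
  have "measure M (E \<union> N) \<le> measure M E + measure M N" using E N by (intro measure_Un_le)
  also have "measure M N = 0" using N by (simp add: measure_def)
  finally have "measure M (E \<union> N) \<le> q" using E assms(2) by simp
  moreover have "\<bar>Z \<omega>\<bar> \<le> b" if "\<omega> \<in> space M - (E \<union> N)" for \<omega>
    using that E(3)[of \<omega>] N(1) assms(3) by force
  ultimately show ?thesis using E N unfolding small_off_def by (intro bexI[of _ "E \<union> N"]) auto
qed

lemma small_off_mono:
  "small_off M p a Y \<Longrightarrow> p \<le> q \<Longrightarrow> a \<le> b \<Longrightarrow> (\<And>\<omega>. \<omega> \<in> space M \<Longrightarrow> \<bar>Z \<omega>\<bar> \<le> \<bar>Y \<omega>\<bar>) \<Longrightarrow> small_off M q b Z"
  by (rule small_off_mono_AE) (auto intro: AE_I2)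

lemma small_off_add:
  assumes "small_off M p a Y" "small_off M q b Z"
  shows "small_off M (p + q) (a + b) (\<lambda>\<omega>. Y \<omega> + Z \<omega>)"
proof -
  obtain E where E: "E \<in> sets M" "measure M E \<le> p" "\<And>\<omega>. \<omega> \<in> space M - E \<Longrightarrow> \<bar>Y \<omega>\<bar> \<le> a"
    using assms(1) by (auto simp: small_off_def)
  obtain N where N: "N \<in> sets M" "measure M N \<le> q" "\<And>\<omega>. \<omega> \<in> space M - N \<Longrightarrow> \<bar>Z \<omega>\<bar> \<le> b"
    using assms(2) by (auto simp: small_off_def)
  have "measure M (E \<union> N) \<le> measure M E + measure M N" using E N by (intro measure_Un_le)
  then have "measure M (E \<union> N) \<le> p + q" using E N by linarith
  moreover have "\<bar>Y \<omega> + Z \<omega>\<bar> \<le> a + b" if "\<omega> \<in> space M - (E \<union> N)" for \<omega>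
    using that E(3)[of \<omega>] N(3)[of \<omega>] by (auto intro: order_trans[OF abs_triangle_ineq] add_mono)
  ultimately show ?thesis using E N unfolding small_off_def by (intro bexI[of _ "E \<union> N"]) auto
qed

lemma small_off_mult:
  assumes "small_off M p a Y" "small_off M q b Z"
  shows "small_off M (p + q) (a * b) (\<lambda>\<omega>. Y \<omega> * Z \<omega>)"
proof -
  obtain E where E: "E \<in> sets M" "measure M E \<le> p" "\<And>\<omega>. \<omega> \<in> space M - E \<Longrightarrow> \<bar>Y \<omega>\<bar> \<le> a"
    using assms(1) by (auto simp: small_off_def)
  obtain N where N: "N \<in> sets M" "measure M N \<le> q" "\<And>\<omega>. \<omega> \<in> space M - N \<Longrightarrow> \<bar>Z \<omega>\<bar> \<le> b"
    using assms(2) by (auto simp: small_off_def)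
  have "measure M (E \<union> N) \<le> measure M E + measure M N" using E N by (intro measure_Un_le)
  then have "measure M (E \<union> N) \<le> p + q" using E N by linarith
  moreover have "\<bar>Y \<omega> * Z \<omega>\<bar> \<le> a * b" if "\<omega> \<in> space M - (E \<union> N)" for \<omega>
  proof -
    have "\<bar>Y \<omega>\<bar> \<le> a" "\<bar>Z \<omega>\<bar> \<le> b" using that E(3)[of \<omega>] N(3)[of \<omega>] by auto
    then show ?thesis using mult_mono[of "\<bar>Y \<omega>\<bar>" a "\<bar>Z \<omega>\<bar>" b] by (simp add: abs_mult)
  qed
  ultimately show ?thesis using E N unfolding small_off_def by (intro bexI[of _ "E \<union> N"]) auto
qed

lemma small_off_Markov:
  assumes "integrable M Y" "\<And>\<omega>. \<omega> \<in> space M \<Longrightarrow> 0 \<le> Y \<omega>" "expectation Y \<le> c" "0 < a"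
  shows "small_off M (c / a) a Y"
proof -
  have [measurable]: "Y \<in> borel_measurable M" using assms by auto
  have "measure M {\<omega>\<in>space M. Y \<omega> \<ge> a} \<le> expectation Y / a"
    using assms by (intro integral_Markov_inequality_measure[where A="{}"]) auto
  also have "\<dots> \<le> c / a" using assms by (simp add: divide_right_mono)
  finally show ?thesis using assms(2)
    unfolding small_off_def by (intro bexI[of _ "{\<omega>\<in>space M. Y \<omega> \<ge> a}"]) auto
qed

lemma vanishes_in_prob_mono_AE:
  assumes "vanishes_in_prob M Y" "\<And>n. AE \<omega> in M. \<bar>Z n \<omega>\<bar> \<le> \<bar>Y n \<omega>\<bar>"
  shows "vanishes_in_prob M Z"
  unfolding vanishes_in_prob_def
proof (intro allI impI)
  fix e :: real assume "0 < e"
  with assms(1) have "\<forall>\<^sub>F n in sequentially. small_off M e e (Y n)" by (auto simp: vanishes_in_prob_def)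
  then show "\<forall>\<^sub>F n in sequentially. small_off M e e (Z n)"
    by eventually_elim (rule small_off_mono_AE[OF _ _ _ assms(2)], auto)
qed

lemma vanishes_in_prob_mono:
  "vanishes_in_prob M Y \<Longrightarrow> (\<And>n \<omega>. \<omega> \<in> space M \<Longrightarrow> \<bar>Z n \<omega>\<bar> \<le> \<bar>Y n \<omega>\<bar>) \<Longrightarrow> vanishes_in_prob M Z"
  by (rule vanishes_in_prob_mono_AE) (auto intro: AE_I2)

lemma vanishes_in_prob_add:
  assumes "vanishes_in_prob M Y" "vanishes_in_prob M Z"
  shows "vanishes_in_prob M (\<lambda>n \<omega>. Y n \<omega> + Z n \<omega>)"
  unfolding vanishes_in_prob_def
proof (intro allI impI)
  fix e :: real assume "0 < e"
  then have "0 < e / 2" by simp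
  with assms have "\<forall>\<^sub>F n in sequentially. small_off M (e/2) (e/2) (Y n)"
    "\<forall>\<^sub>F n in sequentially. small_off M (e/2) (e/2) (Z n)" by (auto simp only: vanishes_in_prob_def)
  then show "\<forall>\<^sub>F n in sequentially. small_off M e e (\<lambda>\<omega>. Y n \<omega> + Z n \<omega>)"
    by eventually_elim (use small_off_add[of "e/2" "e/2" _ "e/2" "e/2"] in simp)
qed

lemma vanishes_in_prob_mult_tight:
  assumes "vanishes_in_prob M Y" "tight_in_prob M Z"
  shows "vanishes_in_prob M (\<lambda>n \<omega>. Y n \<omega> * Z n \<omega>)"
  unfolding vanishes_in_prob_def
proof (intro allI impI)
  fix e :: real assume e: "0 < e"
  obtain K where K: "\<forall>\<^sub>F n in sequentially. small_off M (e/2) K (Z n)"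
    using assms(2) e unfolding tight_in_prob_def by (meson half_gt_zero)
  \<comment> \<open>The two entries of the minimum serve the exceptional probability,
    \<open>d + e/2 \<le> e\<close>, and the size, \<open>d * \<bar>K\<bar> \<le> e\<close>.\<close>
  define d where "d = min (e/2) (e / (\<bar>K\<bar> + 1))"
  have d: "0 < d" using e by (simp add: d_def)
  have "d * \<bar>K\<bar> \<le> e / (\<bar>K\<bar> + 1) * \<bar>K\<bar>" by (intro mult_right_mono) (auto simp: d_def)
  also have "\<dots> \<le> e" using e by (simp add: field_simps)
  finally have dK: "d * \<bar>K\<bar> \<le> e" .
  have "\<forall>\<^sub>F n in sequentially. small_off M d d (Y n)"
    using assms(1) d by (auto simp: vanishes_in_prob_def)
  with K show "\<forall>\<^sub>F n in sequentially. small_off M e e (\<lambda>\<omega>. Y n \<omega> * Z n \<omega>)"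
  proof eventually_elim
    case (elim n)
    have "small_off M (d + e/2) (d * \<bar>K\<bar>) (\<lambda>\<omega>. Y n \<omega> * Z n \<omega>)"
      by (rule small_off_mult[OF elim(2) small_off_mono[OF elim(1)]]) auto
    then show ?case by (rule small_off_mono) (use dK in \<open>auto simp: d_def\<close>)
  qed
qed

lemma tight_in_prob_const: "tight_in_prob M (\<lambda>n \<omega>. c)"
  unfolding tight_in_prob_def small_off_def
  by (intro allI impI exI[of _ "\<bar>c\<bar>"] always_eventually bexI[of _ "{}"]) auto

lemma vanishes_in_prob_cmult:
  "vanishes_in_prob M Y \<Longrightarrow> vanishes_in_prob M (\<lambda>n \<omega>. c * Y n \<omega>)"
  using vanishes_in_prob_mult_tight[OF _ tight_in_prob_const, of Y c] by (simp add: mult.commute)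

lemma vanishes_in_prob_sum:
  assumes "finite I" "\<And>i. i \<in> I \<Longrightarrow> vanishes_in_prob M (Y i)"
  shows "vanishes_in_prob M (\<lambda>n \<omega>. \<Sum>i\<in>I. Y i n \<omega>)"
  using assms
proof (induction I)
  case empty
  show ?case unfolding vanishes_in_prob_def small_off_def
    by (intro allI impI always_eventually bexI[of _ "{}"]) auto
next
  case (insert i I)
  then show ?case by (simp add: vanishes_in_prob_add)
qed

lemma vanishes_in_prob_sqrt:
  assumes "vanishes_in_prob M Y"
  shows "vanishes_in_prob M (\<lambda>n \<omega>. sqrt \<bar>Y n \<omega>\<bar>)"
  unfolding vanishes_in_prob_def
proof (intro allI impI)
  fix e :: real assume e: "0 < e"
  define d where "d = min e (e\<^sup>2)"
  have "0 < d" using e by (simp add: d_def)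
  with assms have "\<forall>\<^sub>F n in sequentially. small_off M d d (Y n)" by (auto simp only: vanishes_in_prob_def)
  then show "\<forall>\<^sub>F n in sequentially. small_off M e e (\<lambda>\<omega>. sqrt \<bar>Y n \<omega>\<bar>)"
  proof eventually_elim
    case (elim n)
    then obtain E where E: "E \<in> sets M" "measure M E \<le> d" "\<And>\<omega>. \<omega> \<in> space M - E \<Longrightarrow> \<bar>Y n \<omega>\<bar> \<le> d"
      by (auto simp: small_off_def)
    have "sqrt \<bar>Y n \<omega>\<bar> \<le> e" if "\<omega> \<in> space M - E" for \<omega>
      using E(3)[OF that] e by (intro real_le_lsqrt) (auto simp: d_def)
    then show ?case using E unfolding small_off_def d_def by (intro bexI[of _ E]) auto
  qed
qed

lemma tight_in_prob_add_vanishing: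
  assumes "vanishes_in_prob M Y" "\<And>n \<omega>. \<omega> \<in> space M \<Longrightarrow> \<bar>Z n \<omega>\<bar> \<le> K + \<bar>Y n \<omega>\<bar>"
  shows "tight_in_prob M Z"
  unfolding tight_in_prob_def
proof (intro allI impI exI[of _ "_"])
  fix e :: real assume "0 < e"
  with assms(1) have "\<forall>\<^sub>F n in sequentially. small_off M e e (Y n)" by (auto simp only: vanishes_in_prob_def)
  then show "\<forall>\<^sub>F n in sequentially. small_off M e (K + e) (Z n)"
  proof eventually_elim
    case (elim n)
    then obtain E where E: "E \<in> sets M" "measure M E \<le> e" "\<And>\<omega>. \<omega> \<in> space M - E \<Longrightarrow> \<bar>Y n \<omega>\<bar> \<le> e"
      by (auto simp: small_off_def)
    have "\<bar>Z n \<omega>\<bar> \<le> K + e" if "\<omega> \<in> space M - E" for \<omega>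
      using E(3)[OF that] assms(2)[of \<omega> n] that by auto
    then show ?case using E unfolding small_off_def by auto
  qed
qed

lemma tight_in_prob_sqrt:
  assumes "tight_in_prob M Y"
  shows "tight_in_prob M (\<lambda>n \<omega>. sqrt \<bar>Y n \<omega>\<bar>)"
  unfolding tight_in_prob_def
proof (intro allI impI)
  fix e :: real assume "0 < e"
  with assms obtain K where "\<forall>\<^sub>F n in sequentially. small_off M e K (Y n)" unfolding tight_in_prob_def by blast
  then have "\<forall>\<^sub>F n in sequentially. small_off M e (sqrt K) (\<lambda>\<omega>. sqrt \<bar>Y n \<omega>\<bar>)"
    by eventually_elim (fastforce simp: small_off_def)
  then show "\<exists>K. \<forall>\<^sub>F n in sequentially. small_off M e K (\<lambda>\<omega>. sqrt \<bar>Y n \<omega>\<bar>)" ..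
qed

section \<open>From pathwise statements and moment bounds to smallness in probability\<close>

lemma prob_tendsto_zero_if_eventually_not:
  assumes A: "\<And>n. A n \<in> sets M" and ev: "AE \<omega> in M. \<forall>\<^sub>F n in sequentially. \<omega> \<notin> A n"
  shows "(\<lambda>n. measure M (A n)) \<longlonglongrightarrow> 0"
proof -
  have "(\<lambda>n. \<integral>\<omega>. indicator (A n) \<omega> \<partial>M) \<longlonglongrightarrow> (\<integral>\<omega>. (0::real) \<partial>M)"
  proof (rule integral_dominated_convergence[where w="\<lambda>_. 1"])
    show "AE \<omega> in M. (\<lambda>n. indicator (A n) \<omega> :: real) \<longlonglongrightarrow> 0"
      using ev
    proof eventually_elim
      case (elim \<omega>)
      then have "\<forall>\<^sub>F n in sequentially. indicator (A n) \<omega> = (0::real)" by eventually_elim simp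
      then show ?case by (rule tendsto_eventually)
    qed
  qed (use A in \<open>auto simp: indicator_def\<close>)
  then show ?thesis using A by (simp add: sets.sets_into_space[OF A] Int_absorb2)
qed

text \<open>\<open>Z\<close> is controlled off a measurable event \<open>A e n\<close>. This suits
  bounds that hold for all cells at once from some \<open>n\<close> on, where that \<open>n\<close>
  depends on the path.\<close>

lemma vanishes_in_prob_if_eventually_le:
  assumes "\<And>e n. 0 < e \<Longrightarrow> A e n \<in> sets M"
    and "\<And>e. 0 < e \<Longrightarrow> AE \<omega> in M. \<forall>\<^sub>F n in sequentially. \<omega> \<notin> A e n"
    and "\<And>e n \<omega>. 0 < e \<Longrightarrow> \<omega> \<in> space M \<Longrightarrow> \<omega> \<notin> A e n \<Longrightarrow> \<bar>Z n \<omega>\<bar> \<le> e"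
  shows "vanishes_in_prob M Z"
  unfolding vanishes_in_prob_def
proof (intro allI impI)
  fix e :: real assume e: "0 < e"
  have "\<forall>\<^sub>F n in sequentially. measure M (A e n) < e"
    by (rule order_tendstoD(2)[OF prob_tendsto_zero_if_eventually_not]) (use assms e in auto)
  then show "\<forall>\<^sub>F n in sequentially. small_off M e e (Z n)"
  proof eventually_elim
    case (elim n)
    then show ?case unfolding small_off_def using assms(1,3) e by (intro bexI[of _ "A e n"]) auto
  qed
qed

lemma vanishes_in_prob_AE:
  assumes [measurable]: "\<And>n. Z n \<in> borel_measurable M" and lim: "AE \<omega> in M. (\<lambda>n. Z n \<omega>) \<longlonglongrightarrow> 0"
  shows "vanishes_in_prob M Z"
proof (rule vanishes_in_prob_if_eventually_le[where A="\<lambda>e n. {\<omega>\<in>space M. e < \<bar>Z n \<omega>\<bar>}"])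
  fix e :: real assume e: "0 < e"
  show "AE \<omega> in M. \<forall>\<^sub>F n in sequentially. \<omega> \<notin> {\<omega> \<in> space M. e < \<bar>Z n \<omega>\<bar>}"
    using lim
  proof eventually_elim
    case (elim \<omega>)
    then have "(\<lambda>n. \<bar>Z n \<omega>\<bar>) \<longlonglongrightarrow> 0" by (rule tendsto_rabs_zero)
    from order_tendstoD(2)[OF this e] show ?case by eventually_elim auto
  qed
qed auto

lemma vanishes_in_prob_L1:
  assumes "\<And>n. integrable M (Z n)" "\<And>n \<omega>. \<omega> \<in> space M \<Longrightarrow> 0 \<le> Z n \<omega>" "\<And>n. expectation (Z n) \<le> c n" "c \<longlonglongrightarrow> 0"
  shows "vanishes_in_prob M Z"
  unfolding vanishes_in_prob_def
proof (intro allI impI)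
  fix e :: real assume e: "0 < e"
  have "\<forall>\<^sub>F n in sequentially. c n < e * e" using e by (intro order_tendstoD(2)[OF assms(4)]) simp
  then show "\<forall>\<^sub>F n in sequentially. small_off M e e (Z n)"
  proof eventually_elim
    case (elim n)
    have "small_off M (c n / e) e (Z n)" using assms e by (intro small_off_Markov) auto
    then show ?case by (rule small_off_mono) (use elim e in \<open>auto simp: field_simps\<close>)
  qed
qed

lemma vanishes_in_prob_L2:
  assumes "\<And>n. integrable M (\<lambda>\<omega>. (Z n \<omega>)\<^sup>2)" "\<And>n. expectation (\<lambda>\<omega>. (Z n \<omega>)\<^sup>2) \<le> c n" "c \<longlonglongrightarrow> 0"
  shows "vanishes_in_prob M Z"
proof -
  have "vanishes_in_prob M (\<lambda>n \<omega>. (Z n \<omega>)\<^sup>2)" using assms by (intro vanishes_in_prob_L1) auto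
  from vanishes_in_prob_sqrt[OF this] show ?thesis by (rule vanishes_in_prob_mono) simp
qed

lemma vanishes_in_prob_conv_in_prob:
  assumes "conv_in_prob M Z Y" and [measurable]: "\<And>n. Z n \<in> borel_measurable M" "Y \<in> borel_measurable M"
  shows "vanishes_in_prob M (\<lambda>n \<omega>. Z n \<omega> - Y \<omega>)"
  unfolding vanishes_in_prob_def
proof (intro allI impI)
  fix e :: real assume e: "0 < e"
  then have "(\<lambda>n. measure M {\<omega>\<in>space M. \<bar>Z n \<omega> - Y \<omega>\<bar> > e}) \<longlonglongrightarrow> 0" using assms by (auto simp: conv_in_prob_def)
  from order_tendstoD(2)[OF this e] show "\<forall>\<^sub>F n in sequentially. small_off M e e (\<lambda>\<omega>. Z n \<omega> - Y \<omega>)"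
  proof eventually_elim
    case (elim n)
    then show ?case unfolding small_off_def by (intro bexI[of _ "{\<omega>\<in>space M. \<bar>Z n \<omega> - Y \<omega>\<bar> > e}"]) auto
  qed
qed

text \<open>In the role of Fatou's lemma: a moment bound for approximations, uniform in
  \<open>m\<close>, becomes a tail bound for the limit object \<open>Z\<close>;
  \<open>\<eta>\<close> absorbs the approximation error.\<close>

lemma small_off_Markov_limit:
  assumes "\<And>m. integrable M (Y m)" "\<And>m \<omega>. \<omega> \<in> space M \<Longrightarrow> 0 \<le> Y m \<omega>" "\<And>m. expectation (Y m) \<le> c"
    and e: "vanishes_in_prob M e" and le: "\<And>m. AE \<omega> in M. \<bar>Z \<omega>\<bar> \<le> Y m \<omega> + e m \<omega>" and pos: "0 < a" "0 < \<eta>"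
  shows "small_off M (c / a + \<eta>) (a + \<eta>) Z"
proof -
  obtain m where m: "small_off M \<eta> \<eta> (e m)"
    using e pos unfolding vanishes_in_prob_def eventually_sequentially by blast
  have "small_off M (c / a) a (Y m)" using assms by (intro small_off_Markov) auto
  from small_off_add[OF this m] show ?thesis
    by (rule small_off_mono_AE) (use le[of m] in \<open>auto elim!: eventually_mono\<close>)
qed

text \<open>A discrete Ito isometry: when the square is expanded, the mixed terms have mean zero.
  The conditional moments of \<open>\<epsilon> k\<close> given \<open>G k\<close> are expressed by
  testing against integrable \<open>G k\<close>-measurable weights \<open>Y\<close>, so that no
  conditional expectation appears.\<close>

lemma martingale_transform_second_moment:
  fixes G :: "nat \<Rightarrow> 'a measure" and \<epsilon> \<phi> :: "nat \<Rightarrow> 'a \<Rightarrow> real"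
  assumes sub: "\<And>k. subalgebra M (G k)" and mono: "\<And>k. sets (G k) \<subseteq> sets (G (Suc k))"
    and \<epsilon>: "\<And>k. \<epsilon> k \<in> borel_measurable (G (Suc k))"
    and \<phi>: "\<And>k. \<phi> k \<in> borel_measurable (G k)" "\<And>k \<omega>. \<omega> \<in> space M \<Longrightarrow> \<bar>\<phi> k \<omega>\<bar> \<le> C"
    and orth: "\<And>k Y. Y \<in> borel_measurable (G k) \<Longrightarrow> integrable M Y \<Longrightarrow>
      integrable M (\<lambda>\<omega>. Y \<omega> * \<epsilon> k \<omega>) \<and> expectation (\<lambda>\<omega>. Y \<omega> * \<epsilon> k \<omega>) = 0"
    and sq: "\<And>k Y. Y \<in> borel_measurable (G k) \<Longrightarrow> integrable M Y \<Longrightarrow>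
      integrable M (\<lambda>\<omega>. Y \<omega> * (\<epsilon> k \<omega>)\<^sup>2) \<and> expectation (\<lambda>\<omega>. Y \<omega> * (\<epsilon> k \<omega>)\<^sup>2) = expectation Y * c k"
  shows "integrable M (\<lambda>\<omega>. (\<Sum>k<m. \<phi> k \<omega> * \<epsilon> k \<omega>)\<^sup>2)"
    and "expectation (\<lambda>\<omega>. (\<Sum>k<m. \<phi> k \<omega> * \<epsilon> k \<omega>)\<^sup>2) = (\<Sum>k<m. expectation (\<lambda>\<omega>. (\<phi> k \<omega>)\<^sup>2) * c k)"
proof -
  have sp: "space (G k) = space M" for k using sub by (auto simp: subalgebra_def)
  have GM: "f \<in> borel_measurable (G k) \<Longrightarrow> f \<in> borel_measurable M" for f :: "'a \<Rightarrow> real" and k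
    by (rule measurable_from_subalg[OF sub])
  have Gle: "f \<in> borel_measurable (G j) \<Longrightarrow> f \<in> borel_measurable (G k)" if "j \<le> k" for f :: "'a \<Rightarrow> real" and j k
    using lift_Suc_mono_le[of "\<lambda>k. sets (G k)", OF mono that] sp by (auto simp: measurable_def)
  have C: "\<omega> \<in> space M \<Longrightarrow> (\<phi> k \<omega>)\<^sup>2 \<le> C\<^sup>2" for \<omega> k
    using \<phi>(2)[of \<omega> k] by (metis abs_le_square_iff abs_of_nonneg abs_ge_zero order_trans)
  have "integrable M (\<lambda>\<omega>. (\<Sum>k<m. \<phi> k \<omega> * \<epsilon> k \<omega>)\<^sup>2) \<and>
    expectation (\<lambda>\<omega>. (\<Sum>k<m. \<phi> k \<omega> * \<epsilon> k \<omega>)\<^sup>2) = (\<Sum>k<m. expectation (\<lambda>\<omega>. (\<phi> k \<omega>)\<^sup>2) * c k)"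
  proof (induction m)
    case (Suc m)
    define S where "S \<omega> = (\<Sum>k<m. \<phi> k \<omega> * \<epsilon> k \<omega>)" for \<omega>
    have SG: "S \<in> borel_measurable (G m)"
      unfolding S_def
    proof (rule borel_measurable_sum)
      fix k assume "k \<in> {..<m}"
      then have k: "k \<le> m" "Suc k \<le> m" by auto
      show "(\<lambda>\<omega>. \<phi> k \<omega> * \<epsilon> k \<omega>) \<in> borel_measurable (G m)"
        by (rule borel_measurable_times[OF Gle[OF k(1) \<phi>(1)] Gle[OF k(2) \<epsilon>]])
    qed
    have Si: "integrable M S"
      using Suc by (intro square_integrable_imp_integrable[OF GM[OF SG]]) (simp add: S_def)
    \<comment> \<open>This is the weight for \<open>orth\<close>: \<open>S\<close> is square
      integrable by induction, hence integrable, and the bounded factor \<open>\<phi> m\<close>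
      preserves that.\<close>
    have "integrable M (\<lambda>\<omega>. 2 * S \<omega> * \<phi> m \<omega>)"
    proof (rule Bochner_Integration.integrable_bound[where f="\<lambda>\<omega>. 2 * C * S \<omega>"])
      show "AE \<omega> in M. norm (2 * S \<omega> * \<phi> m \<omega>) \<le> norm (2 * C * S \<omega>)"
      proof (rule AE_I2)
        fix \<omega> assume "\<omega> \<in> space M"
        then have "\<bar>\<phi> m \<omega>\<bar> \<le> \<bar>C\<bar>" using \<phi>(2)[of \<omega> m] by simp
        from mult_left_mono[OF this, of "2 * \<bar>S \<omega>\<bar>"]
        show "norm (2 * S \<omega> * \<phi> m \<omega>) \<le> norm (2 * C * S \<omega>)" by (simp add: abs_mult mult.commute mult.assoc)
      qed
    qed (use Si GM[OF SG] GM[OF \<phi>(1)] in auto)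
    with orth[of "\<lambda>\<omega>. 2 * S \<omega> * \<phi> m \<omega>" m] SG \<phi>(1)[of m]
    have 1: "integrable M (\<lambda>\<omega>. 2 * S \<omega> * \<phi> m \<omega> * \<epsilon> m \<omega>)" "expectation (\<lambda>\<omega>. 2 * S \<omega> * \<phi> m \<omega> * \<epsilon> m \<omega>) = 0"
      by auto
    have "integrable M (\<lambda>\<omega>. (\<phi> m \<omega>)\<^sup>2)"
      by (rule integrable_const_bound[where B="C\<^sup>2"]) (use C GM[OF \<phi>(1)] in auto)
    with sq[of "\<lambda>\<omega>. (\<phi> m \<omega>)\<^sup>2" m] \<phi>(1)[of m]
    have 2: "integrable M (\<lambda>\<omega>. (\<phi> m \<omega>)\<^sup>2 * (\<epsilon> m \<omega>)\<^sup>2)"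
      "expectation (\<lambda>\<omega>. (\<phi> m \<omega>)\<^sup>2 * (\<epsilon> m \<omega>)\<^sup>2) = expectation (\<lambda>\<omega>. (\<phi> m \<omega>)\<^sup>2) * c m" by auto
    have eq: "(\<lambda>\<omega>. (\<Sum>k<Suc m. \<phi> k \<omega> * \<epsilon> k \<omega>)\<^sup>2) =
       (\<lambda>\<omega>. (S \<omega>)\<^sup>2 + 2 * S \<omega> * \<phi> m \<omega> * \<epsilon> m \<omega> + (\<phi> m \<omega>)\<^sup>2 * (\<epsilon> m \<omega>)\<^sup>2)"
      by (auto simp: S_def power2_eq_square algebra_simps)
    have 3: "integrable M (\<lambda>\<omega>. (S \<omega>)\<^sup>2)"
      "expectation (\<lambda>\<omega>. (S \<omega>)\<^sup>2) = (\<Sum>k<m. expectation (\<lambda>\<omega>. (\<phi> k \<omega>)\<^sup>2) * c k)" using Suc by (auto simp: S_def)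
    show ?case unfolding eq using 1 2 3 by simp
  qed simp
  then show "integrable M (\<lambda>\<omega>. (\<Sum>k<m. \<phi> k \<omega> * \<epsilon> k \<omega>)\<^sup>2)"
    "expectation (\<lambda>\<omega>. (\<Sum>k<m. \<phi> k \<omega> * \<epsilon> k \<omega>)\<^sup>2) = (\<Sum>k<m. expectation (\<lambda>\<omega>. (\<phi> k \<omega>)\<^sup>2) * c k)" by auto
qed

end

section \<open>Brownian increments\<close>

lemma periodic_add_int:
  fixes f :: "real \<Rightarrow> 'b"
  assumes "\<And>x. f (x + 1) = f x"
  shows "f (x + of_int n) = f x"
proof -
  have nat: "f (x + real n) = f x" for x n
  proof (induction n)
    case (Suc n)
    then show ?case using assms[of "x + real n"] by (simp add: add_ac)
  qed simp
  show ?thesis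
  proof (cases n rule: int_cases2)
    case (nonneg k) then show ?thesis using nat by simp
  next
    case (nonpos k) then show ?thesis using nat[of "x - real k" k] by simp
  qed
qed

lemma continuous_periodic_bounded:
  fixes f :: "real \<Rightarrow> real"
  assumes "continuous_on UNIV f" "\<And>x. f (x + 1) = f x"
  obtains K where "0 < K" "\<And>x. \<bar>f x\<bar> \<le> K"
proof -
  have "compact (f ` {0..1})"
    using assms(1) by (intro compact_continuous_image continuous_on_subset[OF assms(1)]) auto
  then obtain K where K: "\<And>x. x \<in> {0..1} \<Longrightarrow> \<bar>f x\<bar> \<le> K"
    using compact_imp_bounded bounded_iff by (metis imageI real_norm_def)
  show ?thesis
  proof
    show "0 < \<bar>K\<bar> + 1" by simp
    fix x :: real
    have "f x = f (frac x)" using periodic_add_int[of f "frac x" "\<lfloor>x\<rfloor>", OF assms(2)] by (simp add: frac_def)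
    moreover have "frac x \<in> {0..1}" using frac_lt_1[of x] frac_ge_0[of x] by (simp add: less_imp_le)
    ultimately show "\<bar>f x\<bar> \<le> \<bar>K\<bar> + 1" using K[of "frac x"] by simp
  qed
qed

section \<open>Moments, independence and isometries for Brownian increments\<close>

locale brownian = prob_space M for M :: "'a measure" +
  fixes F :: "real \<Rightarrow> 'a measure" and W :: "real \<Rightarrow> 'a \<Rightarrow> real"
  assumes bm: "brownian_motion M F W"
begin

lemma filtration_subalgebra: "0 \<le> t \<Longrightarrow> subalgebra M (F t)"
  using bm by (auto simp: brownian_motion_def is_filtration_def)

lemma measurable_filtration_mono:
  assumes "f \<in> borel_measurable (F s)" "0 \<le> s" "s \<le> t"
  shows "f \<in> borel_measurable (F t)"
proof -
  have "sets (F s) \<subseteq> sets (F t)" "space (F s) = space (F t)"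
    using bm assms filtration_subalgebra[of s] filtration_subalgebra[of t]
    by (auto simp: brownian_motion_def is_filtration_def subalgebra_def)
  then show ?thesis using assms(1) by (auto simp: measurable_def)
qed

lemma measurable_filtration: "f \<in> borel_measurable (F s) \<Longrightarrow> 0 \<le> s \<Longrightarrow> f \<in> borel_measurable M"
  using filtration_subalgebra by (rule measurable_from_subalg)

lemma W_adapted: "0 \<le> s \<Longrightarrow> s \<le> t \<Longrightarrow> W s \<in> borel_measurable (F t)"
  using bm by (auto simp: brownian_motion_def intro: measurable_filtration_mono)

lemma W_measurable [measurable]: "0 \<le> s \<Longrightarrow> W s \<in> borel_measurable M"
  using W_adapted[of s s] measurable_filtration by auto

lemma increment_distributed:
  "0 \<le> s \<Longrightarrow> s < t \<Longrightarrow> distributed M lborel (\<lambda>\<omega>. W t \<omega> - W s \<omega>) (normal_density 0 (sqrt (t - s)))"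
  using bm by (auto simp: brownian_motion_def)

lemma increment_moments:
  assumes "0 \<le> s" "s < t"
  shows "integrable M (\<lambda>\<omega>. (W t \<omega> - W s \<omega>) ^ k)"
    and "expectation (\<lambda>\<omega>. W t \<omega> - W s \<omega>) = 0"
    and "expectation (\<lambda>\<omega>. (W t \<omega> - W s \<omega>)\<^sup>2) = t - s"
    and "expectation (\<lambda>\<omega>. (W t \<omega> - W s \<omega>) ^ 4) = 3 * (t - s)\<^sup>2"
proof -
  note D = increment_distributed[OF assms]
  have pos: "0 < sqrt (t - s)" using assms by simp
  show "integrable M (\<lambda>\<omega>. (W t \<omega> - W s \<omega>) ^ k)"
    using distributed_integrable[OF D, of "\<lambda>x. x ^ k"] integrable_normal_moment[OF pos, of 0 k] by simp
  show "expectation (\<lambda>\<omega>. W t \<omega> - W s \<omega>) = 0"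
    using normal_distributed_expectation[OF pos D] .
  show "expectation (\<lambda>\<omega>. (W t \<omega> - W s \<omega>)\<^sup>2) = t - s"
    using distributed_integral[OF D, of "\<lambda>x. x\<^sup>2"] integral_normal_moment_even[OF pos, of 0 1] assms by simp
  show "expectation (\<lambda>\<omega>. (W t \<omega> - W s \<omega>) ^ 4) = 3 * (t - s)\<^sup>2"
    using distributed_integral[OF D, of "\<lambda>x. x ^ 4"] integral_normal_moment_even[OF pos, of 0 2] assms
    by (simp add: power2_eq_square fact_numeral field_simps)
qed

text \<open>Independence is given as a product rule for pairs of single events. The preimages form
  intersection-stable systems, so the rule extends to the \<sigma>-algebras they generate.\<close>

lemma increment_independent:
  fixes Y :: "'a \<Rightarrow> real"
  assumes st: "0 \<le> s" "s < t" and Y: "Y \<in> borel_measurable (F s)"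
  shows "indep_var borel Y borel (\<lambda>\<omega>. W t \<omega> - W s \<omega>)"
proof -
  let ?D = "\<lambda>\<omega>. W t \<omega> - W s \<omega>"
  have sub: "subalgebra M (F s)" using filtration_subalgebra st by simp
  have Ym: "Y \<in> borel_measurable M" using Y st measurable_filtration by auto
  have Dm: "?D \<in> borel_measurable M" using st by auto
  have stable: "Int_stable {f -` A \<inter> space M | A. A \<in> sets borel}" for f :: "'a \<Rightarrow> real"
  proof (rule Int_stableI)
    fix a c assume "a \<in> {f -` A \<inter> space M | A. A \<in> sets borel}" "c \<in> {f -` A \<inter> space M | A. A \<in> sets borel}"
    then obtain A B where "A \<in> sets borel" "B \<in> sets borel" "a = f -` A \<inter> space M" "c = f -` B \<inter> space M" by auto
    then show "a \<inter> c \<in> {f -` A \<inter> space M | A. A \<in> sets borel}"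
      by (intro CollectI exI[of _ "A \<inter> B"]) auto
  qed
  have "indep_set {Y -` A \<inter> space M | A. A \<in> sets borel} {?D -` A \<inter> space M | A. A \<in> sets borel}"
  proof (rule indep_setI)
    show "{Y -` A \<inter> space M | A. A \<in> sets borel} \<subseteq> events" using measurable_sets[OF Ym] by auto
    show "{?D -` A \<inter> space M | A. A \<in> sets borel} \<subseteq> events" using measurable_sets[OF Dm] by auto
    fix a c assume "a \<in> {Y -` A \<inter> space M | A. A \<in> sets borel}" "c \<in> {?D -` A \<inter> space M | A. A \<in> sets borel}"
    then obtain A B where AB: "A \<in> sets borel" "B \<in> sets borel" "a = Y -` A \<inter> space M" "c = {\<omega>\<in>space M. ?D \<omega> \<in> B}"
      by auto
    have "a \<in> sets (F s)" using measurable_sets[OF Y AB(1)] sub AB by (simp add: subalgebra_def)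
    then show "prob (a \<inter> c) = prob a * prob c"
      unfolding AB(4) using bm st AB(2) by (simp add: brownian_motion_def)
  qed
  then have "indep_set (sigma_sets (space M) {Y -` A \<inter> space M | A. A \<in> sets borel})
      (sigma_sets (space M) {?D -` A \<inter> space M | A. A \<in> sets borel})"
    by (rule indep_set_sigma_sets) (rule stable)+
  then show ?thesis unfolding indep_var_eq using Ym Dm by simp
qed

lemma increment_integral_mult:
  fixes Y :: "'a \<Rightarrow> real" and g :: "real \<Rightarrow> real"
  assumes st: "0 \<le> s" "s < t" and Y: "Y \<in> borel_measurable (F s)" "integrable M Y"
    and g: "g \<in> borel_measurable borel" "integrable M (\<lambda>\<omega>. g (W t \<omega> - W s \<omega>))"
  shows "integrable M (\<lambda>\<omega>. Y \<omega> * g (W t \<omega> - W s \<omega>)) \<and>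
    expectation (\<lambda>\<omega>. Y \<omega> * g (W t \<omega> - W s \<omega>)) = expectation Y * expectation (\<lambda>\<omega>. g (W t \<omega> - W s \<omega>))"
proof -
  have "indep_var borel (id \<circ> Y) borel (g \<circ> (\<lambda>\<omega>. W t \<omega> - W s \<omega>))"
    using g by (intro indep_var_compose[OF increment_independent[OF st Y(1)]]) auto
  then have ind: "indep_var borel Y borel (\<lambda>\<omega>. g (W t \<omega> - W s \<omega>))" by (simp add: comp_def)
  show ?thesis
    using indep_var_integrable[OF ind Y(2) g(2)] indep_var_lebesgue_integral[OF ind Y(2) g(2)] by simp
qed

text \<open>Two isometries: for \<open>dW\<close> with variance \<open>\<delta>\<close>, and for
  \<open>dW^2 - \<delta>\<close> with variance \<open>3 * \<delta>^2 - 2 * \<delta>^2 + \<delta>^2 =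
  2 * \<delta>^2\<close>. The additional factor \<open>\<delta>\<close> in the second one is what
  makes the quadratic variation converge.\<close>

lemma increment_sum_second_moment:
  fixes \<phi> :: "nat \<Rightarrow> 'a \<Rightarrow> real"
  assumes t: "\<And>k. 0 \<le> t k" "\<And>k. t (Suc k) - t k = \<delta>" "0 < \<delta>"
    and \<phi>: "\<And>k. \<phi> k \<in> borel_measurable (F (t k))" "\<And>k \<omega>. \<omega> \<in> space M \<Longrightarrow> \<bar>\<phi> k \<omega>\<bar> \<le> C"
  shows "integrable M (\<lambda>\<omega>. (\<Sum>k<m. \<phi> k \<omega> * (W (t (Suc k)) \<omega> - W (t k) \<omega>))\<^sup>2)" (is ?i1)
    and "expectation (\<lambda>\<omega>. (\<Sum>k<m. \<phi> k \<omega> * (W (t (Suc k)) \<omega> - W (t k) \<omega>))\<^sup>2)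
      = (\<Sum>k<m. expectation (\<lambda>\<omega>. (\<phi> k \<omega>)\<^sup>2) * \<delta>)" (is ?e1)
    and "integrable M (\<lambda>\<omega>. (\<Sum>k<m. \<phi> k \<omega> * ((W (t (Suc k)) \<omega> - W (t k) \<omega>)\<^sup>2 - \<delta>))\<^sup>2)" (is ?i2)
    and "expectation (\<lambda>\<omega>. (\<Sum>k<m. \<phi> k \<omega> * ((W (t (Suc k)) \<omega> - W (t k) \<omega>)\<^sup>2 - \<delta>))\<^sup>2)
      = (\<Sum>k<m. expectation (\<lambda>\<omega>. (\<phi> k \<omega>)\<^sup>2) * (2 * \<delta>\<^sup>2))" (is ?e2)
proof -
  have lt: "t k < t (Suc k)" for k using t(2)[of k] t(3) by simp
  note st = t(1) lt
  have sub: "subalgebra M (F (t k))" for k using filtration_subalgebra t(1) by auto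
  have mono: "sets (F (t k)) \<subseteq> sets (F (t (Suc k)))" for k
    using bm t(1)[of k] lt[of k] by (simp add: brownian_motion_def is_filtration_def)
  have d: "(\<lambda>\<omega>. W (t (Suc k)) \<omega> - W (t k) \<omega>) \<in> borel_measurable (F (t (Suc k)))" for k
    using t(1) lt less_imp_le by (intro borel_measurable_diff W_adapted) auto
  note mom = increment_moments[OF st]
  have m1: "integrable M (\<lambda>\<omega>. W (t (Suc k)) \<omega> - W (t k) \<omega>)" for k using mom(1)[of k 1] by simp
  have q: "((W (t (Suc k)) \<omega> - W (t k) \<omega>)\<^sup>2 - \<delta>)\<^sup>2 =
      (W (t (Suc k)) \<omega> - W (t k) \<omega>)^4 - 2 * \<delta> * (W (t (Suc k)) \<omega> - W (t k) \<omega>)\<^sup>2 + \<delta>\<^sup>2" for k \<omega>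
    by (simp add: power2_eq_square power4_eq_xxxx algebra_simps)
  have q1: "integrable M (\<lambda>\<omega>. (W (t (Suc k)) \<omega> - W (t k) \<omega>)\<^sup>2 - \<delta>)"
     "expectation (\<lambda>\<omega>. (W (t (Suc k)) \<omega> - W (t k) \<omega>)\<^sup>2 - \<delta>) = 0" for k
    using mom(1)[of k 2] mom(3)[of k] t(2)[of k] by (auto simp: prob_space)
  have q2: "integrable M (\<lambda>\<omega>. ((W (t (Suc k)) \<omega> - W (t k) \<omega>)\<^sup>2 - \<delta>)\<^sup>2)"
     "expectation (\<lambda>\<omega>. ((W (t (Suc k)) \<omega> - W (t k) \<omega>)\<^sup>2 - \<delta>)\<^sup>2) = 2 * \<delta>\<^sup>2" for k
    unfolding q using mom(1)[of k 2] mom(1)[of k 4] mom(3)[of k] mom(4)[of k] t(2)[of k]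
    by (auto simp: prob_space power2_eq_square)
  have o1: "integrable M (\<lambda>\<omega>. Y \<omega> * (W (t (Suc k)) \<omega> - W (t k) \<omega>)) \<and>
      expectation (\<lambda>\<omega>. Y \<omega> * (W (t (Suc k)) \<omega> - W (t k) \<omega>)) = 0"
    if "Y \<in> borel_measurable (F (t k))" "integrable M Y" for Y k
    using increment_integral_mult[OF st that, of "\<lambda>x. x"] m1 mom(2)[of k] by simp
  have o2: "integrable M (\<lambda>\<omega>. Y \<omega> * (W (t (Suc k)) \<omega> - W (t k) \<omega>)\<^sup>2) \<and>
      expectation (\<lambda>\<omega>. Y \<omega> * (W (t (Suc k)) \<omega> - W (t k) \<omega>)\<^sup>2) = expectation Y * \<delta>"
    if "Y \<in> borel_measurable (F (t k))" "integrable M Y" for Y k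
    using increment_integral_mult[OF st that, of "\<lambda>x. x\<^sup>2"] mom(1)[of k 2] mom(3)[of k] t(2)[of k] by simp
  have o3: "integrable M (\<lambda>\<omega>. Y \<omega> * ((W (t (Suc k)) \<omega> - W (t k) \<omega>)\<^sup>2 - \<delta>)) \<and>
      expectation (\<lambda>\<omega>. Y \<omega> * ((W (t (Suc k)) \<omega> - W (t k) \<omega>)\<^sup>2 - \<delta>)) = 0"
    if "Y \<in> borel_measurable (F (t k))" "integrable M Y" for Y k
    using increment_integral_mult[OF st that, of "\<lambda>x. x\<^sup>2 - \<delta>"] q1[of k] by simp
  have o4: "integrable M (\<lambda>\<omega>. Y \<omega> * ((W (t (Suc k)) \<omega> - W (t k) \<omega>)\<^sup>2 - \<delta>)\<^sup>2) \<and>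
      expectation (\<lambda>\<omega>. Y \<omega> * ((W (t (Suc k)) \<omega> - W (t k) \<omega>)\<^sup>2 - \<delta>)\<^sup>2) = expectation Y * (2 * \<delta>\<^sup>2)"
    if "Y \<in> borel_measurable (F (t k))" "integrable M Y" for Y k
    using increment_integral_mult[OF st that, of "\<lambda>x. (x\<^sup>2 - \<delta>)\<^sup>2"] q2[of k] by simp
  have d2: "(\<lambda>\<omega>. (W (t (Suc k)) \<omega> - W (t k) \<omega>)\<^sup>2 - \<delta>) \<in> borel_measurable (F (t (Suc k)))" for k
    using d[of k] by simp
  note mt = martingale_transform_second_moment[where G="\<lambda>k. F (t k)" and \<phi>=\<phi> and C=C, OF sub mono _ \<phi>]
  note mt1 = mt[where \<epsilon>="\<lambda>k \<omega>. W (t (Suc k)) \<omega> - W (t k) \<omega>" and c="\<lambda>_. \<delta>", OF d]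
  note mt2 = mt[where \<epsilon>="\<lambda>k \<omega>. (W (t (Suc k)) \<omega> - W (t k) \<omega>)\<^sup>2 - \<delta>" and c="\<lambda>_. 2 * \<delta>\<^sup>2", OF d2]
  show ?i1 by (rule mt1(1); (assumption | (rule o1 | rule o2); assumption))
  show ?e1 by (rule mt1(2); (assumption | (rule o1 | rule o2); assumption))
  show ?i2 by (rule mt2(1); (assumption | (rule o3 | rule o4); assumption))
  show ?e2 by (rule mt2(2); (assumption | (rule o3 | rule o4); assumption))
qed

end

section \<open>The stochastic integral on dyadic grids\<close>

locale periodic_sde = brownian M F W
  for M :: "'a measure" and F :: "real \<Rightarrow> 'a measure" and W :: "real \<Rightarrow> 'a \<Rightarrow> real" +
  fixes X :: "real \<Rightarrow> 'a \<Rightarrow> real" and b \<sigma> :: "real \<Rightarrow> real" and y :: real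
  assumes b_cont: "continuous_on UNIV b" and \<sigma>_cont: "continuous_on UNIV \<sigma>"
    and \<sigma>_pos: "\<And>x. \<sigma> x > 0"
    and b_per: "\<And>x. b (x + 1) = b x" and \<sigma>_per: "\<And>x. \<sigma> (x + 1) = \<sigma> x"
    and sol: "sde_weak_solution M F W X b \<sigma> y"
begin

lemma X_adapted: "0 \<le> s \<Longrightarrow> s \<le> t \<Longrightarrow> X s \<in> borel_measurable (F t)"
  using sol by (auto simp: sde_weak_solution_def intro: measurable_filtration_mono)

lemma X_measurable [measurable]: "0 \<le> s \<Longrightarrow> X s \<in> borel_measurable M"
  using X_adapted[of s s] measurable_filtration by auto

lemma X_cont: "\<omega> \<in> space M \<Longrightarrow> continuous_on {0..} (\<lambda>t. X t \<omega>)"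
  and X_0: "\<omega> \<in> space M \<Longrightarrow> X 0 \<omega> = y"
  using sol by (auto simp: sde_weak_solution_def)

lemma \<sigma>_measurable [measurable]: "\<sigma> \<in> borel_measurable borel"
  and b_measurable [measurable]: "b \<in> borel_measurable borel"
  using \<sigma>_cont b_cont by (auto intro: borel_measurable_continuous_onI)

definition coeff_bound :: real where
  "coeff_bound = (SOME K. 0 < K \<and> (\<forall>x. \<bar>b x\<bar> \<le> K) \<and> (\<forall>x. \<bar>\<sigma> x\<bar> \<le> K))"

lemma coeff_bound: "0 < coeff_bound" "\<bar>b x\<bar> \<le> coeff_bound" "\<bar>\<sigma> x\<bar> \<le> coeff_bound"
proof -
  obtain K1 where K1: "0 < K1" "\<And>x. \<bar>b x\<bar> \<le> K1"
    using continuous_periodic_bounded[OF b_cont b_per] by blast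
  obtain K2 where K2: "0 < K2" "\<And>x. \<bar>\<sigma> x\<bar> \<le> K2"
    using continuous_periodic_bounded[OF \<sigma>_cont \<sigma>_per] by blast
  have "0 < max K1 K2 \<and> (\<forall>x. \<bar>b x\<bar> \<le> max K1 K2) \<and> (\<forall>x. \<bar>\<sigma> x\<bar> \<le> max K1 K2)"
    using K1 K2 by (auto simp: le_max_iff_disj)
  from someI[where P="\<lambda>K. 0 < K \<and> (\<forall>x. \<bar>b x\<bar> \<le> K) \<and> (\<forall>x. \<bar>\<sigma> x\<bar> \<le> K)", OF this]
  show "0 < coeff_bound" "\<bar>b x\<bar> \<le> coeff_bound" "\<bar>\<sigma> x\<bar> \<le> coeff_bound" unfolding coeff_bound_def by auto
qed

text \<open>The integral is chosen separately for each \<open>t\<close> and comes with measurability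
  with respect to \<open>M\<close>. The isometries are therefore applied to grid sums of
  \<open>W\<close> approximating it, not to \<open>noise\<close> directly.\<close>

definition noise :: "real \<Rightarrow> 'a \<Rightarrow> real" where
  "noise t = (SOME I. ito_integral_is M W (\<lambda>s \<omega>. \<sigma> (X s \<omega>)) t I \<and>
        (AE \<omega> in M. X t \<omega> = y + integral {0..t} (\<lambda>s. b (X s \<omega>)) + I \<omega>))"

lemma
  assumes "0 \<le> t"
  shows noise_ito: "ito_integral_is M W (\<lambda>s \<omega>. \<sigma> (X s \<omega>)) t (noise t)"
    and noise_AE: "AE \<omega> in M. X t \<omega> = y + integral {0..t} (\<lambda>s. b (X s \<omega>)) + noise t \<omega>"
    and noise_measurable [measurable]: "noise t \<in> borel_measurable M"
proof -
  have "\<exists>I. ito_integral_is M W (\<lambda>s \<omega>. \<sigma> (X s \<omega>)) t I \<and>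
        (AE \<omega> in M. X t \<omega> = y + integral {0..t} (\<lambda>s. b (X s \<omega>)) + I \<omega>)"
    using sol assms by (auto simp: sde_weak_solution_def)
  from someI_ex[OF this]
  show "ito_integral_is M W (\<lambda>s \<omega>. \<sigma> (X s \<omega>)) t (noise t)"
    and "AE \<omega> in M. X t \<omega> = y + integral {0..t} (\<lambda>s. b (X s \<omega>)) + noise t \<omega>"
    unfolding noise_def by auto
  then show "noise t \<in> borel_measurable M" by (auto simp: ito_integral_is_def)
qed

lemma uniform_modulus_comp:
  assumes f: "continuous_on UNIV f" and w: "\<omega> \<in> space M" and e: "0 < (e::real)"
  obtains \<delta> where "0 < \<delta>"
    "\<And>u v. u \<in> {0..T} \<Longrightarrow> v \<in> {0..T} \<Longrightarrow> \<bar>u - v\<bar> < \<delta> \<Longrightarrow> \<bar>f (X u \<omega>) - (f (X v \<omega>) :: real)\<bar> < e"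
proof -
  have "continuous_on {0..} (f \<circ> (\<lambda>t. X t \<omega>))"
    by (intro continuous_on_compose X_cont[OF w] continuous_on_subset[OF f]) auto
  from uniform_modulus[OF this e, of T] that show ?thesis by auto
qed

text \<open>The modulus of continuity of a path depends on the path; in mean square it becomes
  deterministic. Otherwise there would be times \<open>u n\<close>, \<open>v n\<close> with distance
  tending to 0 and second moments at least \<open>e\<close>, against dominated convergence.\<close>

lemma \<sigma>_X_uniformly_L2:
  assumes e: "0 < e"
  obtains \<eta> where "0 < \<eta>" "\<And>u v. u \<in> {0..T} \<Longrightarrow> v \<in> {0..T} \<Longrightarrow> \<bar>u - v\<bar> < \<eta> \<Longrightarrow>
    expectation (\<lambda>\<omega>. (\<sigma> (X u \<omega>) - \<sigma> (X v \<omega>))\<^sup>2) < e"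
proof (rule ccontr)
  assume *: "\<not> thesis"
  define Q where "Q n u v \<longleftrightarrow> u \<in> {0..T} \<and> v \<in> {0..T} \<and> \<bar>u - v\<bar> < 1 / real (Suc n) \<and>
    e \<le> expectation (\<lambda>\<omega>. (\<sigma> (X u \<omega>) - \<sigma> (X v \<omega>))\<^sup>2)" for n u v
  have "\<forall>n. \<exists>u v. Q n u v"
  proof (rule ccontr)
    assume "\<not> (\<forall>n. \<exists>u v. Q n u v)"
    then obtain n where neg: "\<not> Q n u v" for u v by blast
    have thesis
    proof (rule that)
      show "0 < 1 / real (Suc n)" by simp
      show "expectation (\<lambda>\<omega>. (\<sigma> (X u \<omega>) - \<sigma> (X v \<omega>))\<^sup>2) < e"
        if "u \<in> {0..T}" "v \<in> {0..T}" "\<bar>u - v\<bar> < 1 / real (Suc n)" for u v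
        using neg[of u v] that by (simp add: Q_def not_le)
    qed
    with * show False ..
  qed
  then obtain u where "\<forall>n. \<exists>v. Q n (u n) v" by (rule choice[THEN exE])
  then obtain v where "\<forall>n. Q n (u n) (v n)" by (rule choice[THEN exE])
  then have uv: "\<And>n. u n \<in> {0..T}" "\<And>n. v n \<in> {0..T}" "\<And>n. \<bar>u n - v n\<bar> < 1 / real (Suc n)"
    "\<And>n. e \<le> expectation (\<lambda>\<omega>. (\<sigma> (X (u n) \<omega>) - \<sigma> (X (v n) \<omega>))\<^sup>2)" by (simp_all add: Q_def)
  have uv0: "0 \<le> u n" "0 \<le> v n" for n using uv(1,2)[of n] by auto
  have "(\<lambda>n. expectation (\<lambda>\<omega>. (\<sigma> (X (u n) \<omega>) - \<sigma> (X (v n) \<omega>))\<^sup>2)) \<longlonglongrightarrow> expectation (\<lambda>\<omega>. 0)"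
  proof (rule integral_dominated_convergence[where w="\<lambda>_. (2 * coeff_bound)\<^sup>2"])
    show "AE \<omega> in M. (\<lambda>n. (\<sigma> (X (u n) \<omega>) - \<sigma> (X (v n) \<omega>))\<^sup>2) \<longlonglongrightarrow> 0"
    proof (rule AE_I2)
      fix \<omega> assume w: "\<omega> \<in> space M"
      have "(\<lambda>n. \<sigma> (X (u n) \<omega>) - \<sigma> (X (v n) \<omega>)) \<longlonglongrightarrow> 0"
      proof (rule LIMSEQ_I)
        fix r :: real assume "0 < r"
        then obtain \<delta> where \<delta>: "0 < \<delta>"
          "\<And>u v. u \<in> {0..T} \<Longrightarrow> v \<in> {0..T} \<Longrightarrow> \<bar>u - v\<bar> < \<delta> \<Longrightarrow> \<bar>\<sigma> (X u \<omega>) - \<sigma> (X v \<omega>)\<bar> < r"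
          using uniform_modulus_comp[OF \<sigma>_cont w] by metis
        obtain n0 where n0: "inverse (real (Suc n0)) < \<delta>" using reals_Archimedean[OF \<delta>(1)] by auto
        show "\<exists>no. \<forall>n\<ge>no. norm (\<sigma> (X (u n) \<omega>) - \<sigma> (X (v n) \<omega>) - 0) < r"
        proof (intro exI allI impI)
          fix n assume "n0 \<le> n"
          then have "1 / real (Suc n) \<le> 1 / real (Suc n0)" by (intro divide_left_mono) auto
          with n0 uv(3)[of n] have "\<bar>u n - v n\<bar> < \<delta>" by (simp add: inverse_eq_divide)
          then show "norm (\<sigma> (X (u n) \<omega>) - \<sigma> (X (v n) \<omega>) - 0) < r" using \<delta>(2)[OF uv(1,2)] by simp
        qed
      qed
      from tendsto_power[OF this, of 2] show "(\<lambda>n. (\<sigma> (X (u n) \<omega>) - \<sigma> (X (v n) \<omega>))\<^sup>2) \<longlonglongrightarrow> 0" by simp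
    qed
    show "AE \<omega> in M. norm ((\<sigma> (X (u n) \<omega>) - \<sigma> (X (v n) \<omega>))\<^sup>2) \<le> (2 * coeff_bound)\<^sup>2" for n
    proof (rule AE_I2)
      fix \<omega>
      have "\<bar>\<sigma> (X (u n) \<omega>) - \<sigma> (X (v n) \<omega>)\<bar> \<le> \<bar>2 * coeff_bound\<bar>"
        using coeff_bound(3)[of "X (u n) \<omega>"] coeff_bound(3)[of "X (v n) \<omega>"] coeff_bound(1) by linarith
      then show "norm ((\<sigma> (X (u n) \<omega>) - \<sigma> (X (v n) \<omega>))\<^sup>2) \<le> (2 * coeff_bound)\<^sup>2" by (simp add: abs_le_square_iff)
    qed
  qed (use uv0 in auto)
  moreover have "e \<le> 0" if "(\<lambda>n. expectation (\<lambda>\<omega>. (\<sigma> (X (u n) \<omega>) - \<sigma> (X (v n) \<omega>))\<^sup>2)) \<longlonglongrightarrow> 0"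
    using LIMSEQ_le_const[OF that, of e] uv(4) by auto
  ultimately show False using e by simp
qed

text \<open>The mesh \<open>T / 2^(n+m)\<close> is the same for all \<open>k\<close>, so differences
  in \<open>k\<close> are sums over blocks of \<open>2^m\<close> fine cells.\<close>

definition grid_noise :: "real \<Rightarrow> nat \<Rightarrow> nat \<Rightarrow> nat \<Rightarrow> 'a \<Rightarrow> real" where
  "grid_noise T n m k \<omega> = (\<Sum>i<k * 2^m. \<sigma> (X (T * real i / 2^(n+m)) \<omega>) *
     (W (T * real (Suc i) / 2^(n+m)) \<omega> - W (T * real i / 2^(n+m)) \<omega>))"

text \<open>The stochastic integral up to \<open>T k / 2^n\<close> is defined through dyadic partitions of \<open>[0, T k / 2^n]\<close>;
  these are coarsenings by the factor \<open>k\<close> of dyadic partitions of \<open>[0, T]\<close>.\<close>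
lemma noise_minus_grid_noise_vanishes:
  assumes T: "0 < T"
  shows "vanishes_in_prob M (\<lambda>m \<omega>. noise (T * real k / 2^n) \<omega> - grid_noise T n m k \<omega>)"
proof -
  define s where "s = T * real k / 2^n"
  define t where "t m i = T * real i / 2^(n+m)" for m i :: nat
  define \<delta> where "\<delta> m = T / 2^(n+m)" for m
  have s0: "0 \<le> s" using T by (simp add: s_def)
  have t0: "0 \<le> t m i" for m i using T by (simp add: t_def)
  have tS: "t m (Suc i) - t m i = \<delta> m" for m i by (simp add: t_def \<delta>_def field_simps)
  have \<delta>0: "0 < \<delta> m" for m using T by (simp add: \<delta>_def)
  have tmono: "i \<le> j \<Longrightarrow> t m i \<le> t m j" for m i j using T by (simp add: t_def divide_right_mono)
  define S where "S m \<omega> = (\<Sum>j<2^m. \<sigma> (X (s * real j / 2^m) \<omega>) *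
     (W (s * real (Suc j) / 2^m) \<omega> - W (s * real j / 2^m) \<omega>))" for m \<omega>
  have "conv_in_prob M S (noise s)"
    using noise_ito[OF s0] unfolding ito_integral_is_def S_def by simp
  moreover have "S m \<in> borel_measurable M" for m
    unfolding S_def[abs_def] using s0
    by (intro borel_measurable_sum borel_measurable_times borel_measurable_diff
        measurable_compose[OF _ \<sigma>_measurable] X_measurable W_measurable) auto
  ultimately have 1: "vanishes_in_prob M (\<lambda>m \<omega>. S m \<omega> - noise s \<omega>)"
    using noise_measurable[OF s0] by (intro vanishes_in_prob_conv_in_prob) auto
  \<comment> \<open>\<open>k * (i div k)\<close> is the left end of the block of \<open>k\<close>
    fine cells containing \<open>i\<close>, that is, of a cell of the dyadic partition of
    \<open>[0, s]\<close>. The two sums share the increments of \<open>W\<close> and differ in the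
    point where \<open>\<sigma>\<close> is sampled.\<close>
  define \<phi> where "\<phi> m i \<omega> = \<sigma> (X (t m (k * (i div k))) \<omega>) - \<sigma> (X (t m i) \<omega>)" for m i \<omega>
  have kd: "k * (i div k) \<le> i" for i by simp
  have Seq: "S m \<omega> = (\<Sum>i<k * 2^m. \<sigma> (X (t m (k * (i div k))) \<omega>) * (W (t m (Suc i)) \<omega> - W (t m i) \<omega>))" for m \<omega>
  proof (cases "k = 0")
    case True then show ?thesis by (simp add: S_def s_def)
  next
    case False
    have "(\<Sum>i<k * 2^m. \<sigma> (X (t m (k * (i div k))) \<omega>) * (W (t m (Suc i)) \<omega> - W (t m i) \<omega>)) =
      (\<Sum>j<2^m. \<Sum>i\<in>{j*k..<j*k+k}. \<sigma> (X (t m (k * (i div k))) \<omega>) * (W (t m (Suc i)) \<omega> - W (t m i) \<omega>))"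
      by (subst sum.nat_group) (simp add: mult.commute)
    also have "\<dots> = (\<Sum>j<2^m. \<Sum>i\<in>{j*k..<j*k+k}. \<sigma> (X (t m (k * j)) \<omega>) * (W (t m (Suc i)) \<omega> - W (t m i) \<omega>))"
    proof (intro sum.cong refl)
      fix j i assume "i \<in> {j*k..<j*k+k}"
      then have "i div k = j" using False by (intro div_nat_eqI) (auto simp: mult.commute)
      then show "\<sigma> (X (t m (k * (i div k))) \<omega>) * (W (t m (Suc i)) \<omega> - W (t m i) \<omega>) =
        \<sigma> (X (t m (k * j)) \<omega>) * (W (t m (Suc i)) \<omega> - W (t m i) \<omega>)" by simp
    qed
    also have "\<dots> = (\<Sum>j<2^m. \<sigma> (X (t m (k * j)) \<omega>) * (W (t m (k * Suc j)) \<omega> - W (t m (k * j)) \<omega>))"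
      unfolding sum_distrib_left[symmetric]
      by (subst sum_Suc_diff') (auto simp: mult.commute add.commute)
    also have "\<dots> = S m \<omega>"
    proof -
      have "s * real j / 2^m = t m (k * j)" for j by (simp add: s_def t_def power_add)
      then show ?thesis unfolding S_def by (simp only:)
    qed
    finally show ?thesis by simp
  qed
  have diff: "S m \<omega> - grid_noise T n m k \<omega> = (\<Sum>i<k * 2^m. \<phi> m i \<omega> * (W (t m (Suc i)) \<omega> - W (t m i) \<omega>))" for m \<omega>
    unfolding Seq grid_noise_def t_def[symmetric] \<phi>_def
    by (simp only: sum_subtractf[symmetric] left_diff_distrib[symmetric])
  have \<phi>m: "\<phi> m i \<in> borel_measurable (F (t m i))" for m i
    unfolding \<phi>_def[abs_def]
    by (intro borel_measurable_diff measurable_compose[OF _ \<sigma>_measurable]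
        X_adapted[OF t0 tmono[OF kd]] X_adapted[OF t0 order_refl])
  have \<phi>b: "\<bar>\<phi> m i \<omega>\<bar> \<le> 2 * coeff_bound" for m i \<omega>
    using coeff_bound(3)[of "X (t m (k * (i div k))) \<omega>"] coeff_bound(3)[of "X (t m i) \<omega>"] unfolding \<phi>_def by linarith
  note iso = increment_sum_second_moment[where t="t m" and \<delta>="\<delta> m" and \<phi>="\<phi> m" and C="2 * coeff_bound" for m, OF t0 tS \<delta>0 \<phi>m \<phi>b]
  have 2: "vanishes_in_prob M (\<lambda>m \<omega>. S m \<omega> - grid_noise T n m k \<omega>)"
  proof (rule vanishes_in_prob_L2)
    show "integrable M (\<lambda>\<omega>. (S m \<omega> - grid_noise T n m k \<omega>)\<^sup>2)" for m unfolding diff by (rule iso(1))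
    show "expectation (\<lambda>\<omega>. (S m \<omega> - grid_noise T n m k \<omega>)\<^sup>2) \<le> (\<Sum>i<k * 2^m. expectation (\<lambda>\<omega>. (\<phi> m i \<omega>)\<^sup>2) * \<delta> m)" for m
      unfolding diff iso(2) by simp
    show "(\<lambda>m. \<Sum>i<k * 2^m. expectation (\<lambda>\<omega>. (\<phi> m i \<omega>)\<^sup>2) * \<delta> m) \<longlonglongrightarrow> 0"
    proof (rule LIMSEQ_I)
      fix r :: real assume r: "0 < r"
      \<comment> \<open>The sum will be at most \<open>e * s\<close>; the 1 in the denominator
        covers \<open>s = 0\<close>.\<close>
      define e where "e = r / (s + 1)"
      have e: "0 < e" using r s0 by (simp add: e_def)
      obtain \<eta> where \<eta>: "0 < \<eta>" "\<And>u v. u \<in> {0..s} \<Longrightarrow> v \<in> {0..s} \<Longrightarrow> \<bar>u - v\<bar> < \<eta> \<Longrightarrow>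
          expectation (\<lambda>\<omega>. (\<sigma> (X u \<omega>) - \<sigma> (X v \<omega>))\<^sup>2) < e"
        using \<sigma>_X_uniformly_L2[OF e] by blast
      have "(\<lambda>m. real k * (T / 2^n) / 2^m) \<longlonglongrightarrow> 0" by (rule LIMSEQ_divide_realpow_zero) simp
      then obtain m0 where m0: "\<And>m. m \<ge> m0 \<Longrightarrow> real k * (T / 2^n) / 2^m < \<eta>"
        using order_tendstoD(2)[of _ 0 sequentially \<eta>] \<eta>(1) unfolding eventually_sequentially by metis
      show "\<exists>no. \<forall>m\<ge>no. norm ((\<Sum>i<k * 2^m. expectation (\<lambda>\<omega>. (\<phi> m i \<omega>)\<^sup>2) * \<delta> m) - 0) < r"
      proof (intro exI allI impI)
        fix m assume m: "m0 \<le> m"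
        have bound: "expectation (\<lambda>\<omega>. (\<phi> m i \<omega>)\<^sup>2) * \<delta> m \<le> e * \<delta> m" if i: "i < k * 2^m" for i
        proof (rule mult_right_mono)
          have "t m i \<le> t m (k * 2^m)" using i by (intro tmono) simp
          also have "\<dots> = s" using T by (simp add: t_def s_def power_add)
          finally have "t m i \<in> {0..s}" "t m (k * (i div k)) \<in> {0..s}"
            using t0 tmono[OF kd, of m i] by (auto intro: order_trans)
          moreover have "\<bar>t m (k * (i div k)) - t m i\<bar> < \<eta>"
          proof -
            have "k > 0" using i by (cases k) auto
            then have "i < k * (i div k) + k" by (metis add_strict_left_mono mod_less_divisor mult_div_mod_eq)
            then have "t m i \<le> t m (k * (i div k) + k)" by (intro tmono) simp
            also have "\<dots> = t m (k * (i div k)) + real k * (T / 2^n) / 2^m"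
              by (simp add: t_def power_add field_simps)
            also have "\<dots> < t m (k * (i div k)) + \<eta>" using m0[OF m] by simp
            finally show ?thesis using tmono[OF kd, of m i] by simp
          qed
          ultimately show "expectation (\<lambda>\<omega>. (\<phi> m i \<omega>)\<^sup>2) \<le> e" unfolding \<phi>_def by (intro less_imp_le[OF \<eta>(2)])
        qed (use \<delta>0[of m] in simp)
        have "(\<Sum>i<k * 2^m. expectation (\<lambda>\<omega>. (\<phi> m i \<omega>)\<^sup>2) * \<delta> m) \<le> (\<Sum>i<k * 2^m. e * \<delta> m)"
          by (intro sum_mono bound) simp
        also have "\<dots> = e * s" by (simp add: \<delta>_def s_def power_add field_simps)
        also have "\<dots> < r" using r s0 by (simp add: e_def field_simps)
        finally have "(\<Sum>i<k * 2^m. expectation (\<lambda>\<omega>. (\<phi> m i \<omega>)\<^sup>2) * \<delta> m) < r" .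
        moreover have "0 \<le> (\<Sum>i<k * 2^m. expectation (\<lambda>\<omega>. (\<phi> m i \<omega>)\<^sup>2) * \<delta> m)"
          using \<delta>0[of m] by (intro sum_nonneg mult_nonneg_nonneg integral_nonneg_AE) auto
        ultimately show "norm ((\<Sum>i<k * 2^m. expectation (\<lambda>\<omega>. (\<phi> m i \<omega>)\<^sup>2) * \<delta> m) - 0) < r" by simp
      qed
    qed
  qed
  have "vanishes_in_prob M (\<lambda>m \<omega>. (S m \<omega> - grid_noise T n m k \<omega>) + (- 1) * (S m \<omega> - noise s \<omega>))"
    by (intro vanishes_in_prob_add 2 vanishes_in_prob_cmult 1)
  then show ?thesis unfolding s_def[symmetric] by simp
qed

end

section \<open>Quadratic variation\<close>

lemma (in prob_space) vanishes_in_prob_power2: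
  assumes "vanishes_in_prob M Y"
  shows "vanishes_in_prob M (\<lambda>n \<omega>. (Y n \<omega>)\<^sup>2)"
proof -
  have "tight_in_prob M Y" by (rule tight_in_prob_add_vanishing[OF assms, of _ 0]) simp
  from vanishes_in_prob_mult_tight[OF assms this] show ?thesis by (simp add: power2_eq_square)
qed

lemma grid_tendsto_zero: "(\<lambda>n. (T::real) / 2^n) \<longlonglongrightarrow> 0"
  using LIMSEQ_divide_realpow_zero[of 2 T] by simp

lemma sum_power2_add_le: "(\<Sum>k\<in>A. (f k + g k)\<^sup>2) \<le> 2 * (\<Sum>k\<in>A. (f k)\<^sup>2) + 2 * (\<Sum>k\<in>A. ((g k)::real)\<^sup>2)"
proof -
  have "(a + b)\<^sup>2 \<le> 2 * a\<^sup>2 + 2 * b\<^sup>2" for a b :: real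
    using zero_le_power2[of "a - b"] by (simp add: power2_eq_square algebra_simps)
  then have "(\<Sum>k\<in>A. (f k + g k)\<^sup>2) \<le> (\<Sum>k\<in>A. 2 * (f k)\<^sup>2 + 2 * (g k)\<^sup>2)" by (intro sum_mono)
  then show ?thesis by (simp add: sum.distrib sum_distrib_left)
qed

context periodic_sde
begin

context
  fixes T :: real
  assumes T: "0 < T"
begin

section \<open>Increments on the dyadic grid of \<open>[0, T]\<close> and their drift part\<close>

definition grid_time :: "nat \<Rightarrow> nat \<Rightarrow> real" where "grid_time n k = T * real k / 2^n"
definition dX :: "nat \<Rightarrow> nat \<Rightarrow> 'a \<Rightarrow> real" where "dX n k \<omega> = X (grid_time n (Suc k)) \<omega> - X (grid_time n k) \<omega>"
definition dW :: "nat \<Rightarrow> nat \<Rightarrow> 'a \<Rightarrow> real" where "dW n k \<omega> = W (grid_time n (Suc k)) \<omega> - W (grid_time n k) \<omega>"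
definition dI :: "nat \<Rightarrow> nat \<Rightarrow> 'a \<Rightarrow> real" where "dI n k \<omega> = noise (grid_time n (Suc k)) \<omega> - noise (grid_time n k) \<omega>"
text \<open>The drift increment, taken as a difference so that the decomposition of
  \<open>dX\<close> holds everywhere; that it equals the integral of \<open>b\<close> over the cell
  is only an almost sure statement.\<close>

definition dB :: "nat \<Rightarrow> nat \<Rightarrow> 'a \<Rightarrow> real" where "dB n k \<omega> = dX n k \<omega> - dI n k \<omega>"
definition vol :: "nat \<Rightarrow> nat \<Rightarrow> 'a \<Rightarrow> real" where "vol n k \<omega> = \<sigma> (X (grid_time n k) \<omega>)"

lemma grid_time_nonneg: "0 \<le> grid_time n k"
  and grid_time_mono: "i \<le> j \<Longrightarrow> grid_time n i \<le> grid_time n j"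
  and grid_time_Suc: "grid_time n (Suc k) - grid_time n k = T / 2^n"
  and grid_time_end: "grid_time n (2^n) = T"
  and grid_time_refine: "grid_time n k = grid_time (n + m) (k * 2^m)"
proof -
  show "0 \<le> grid_time n k" "grid_time n (2^n) = T" using T by (simp_all add: grid_time_def)
  show "i \<le> j \<Longrightarrow> grid_time n i \<le> grid_time n j" using T by (simp add: grid_time_def divide_right_mono)
  show "grid_time n (Suc k) - grid_time n k = T / 2^n" unfolding grid_time_def by (simp add: diff_divide_distrib[symmetric] algebra_simps)
  show "grid_time n k = grid_time (n + m) (k * 2^m)" by (simp add: grid_time_def power_add)
qed

lemma grid_time_le: "k \<le> 2^n \<Longrightarrow> grid_time n k \<le> T"
  using grid_time_mono[of k "2^n" n] grid_time_end by simp

lemma grid_measurable [measurable]: "X (grid_time n k) \<in> borel_measurable M" "W (grid_time n k) \<in> borel_measurable M"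
    "noise (grid_time n k) \<in> borel_measurable M"
  using grid_time_nonneg by simp_all

lemma increments_measurable [measurable]:
  "dX n k \<in> borel_measurable M" "dW n k \<in> borel_measurable M" "dI n k \<in> borel_measurable M"
  "dB n k \<in> borel_measurable M" "vol n k \<in> borel_measurable M"
  unfolding dB_def[abs_def] dX_def[abs_def] dW_def[abs_def] dI_def[abs_def] vol_def[abs_def] by measurable

lemma vol_adapted: "vol n k \<in> borel_measurable (F (grid_time n k))"
  unfolding vol_def[abs_def] using X_adapted[OF grid_time_nonneg order_refl] by measurable

lemma vol_bounds: "\<bar>vol n k \<omega>\<bar> \<le> coeff_bound" "(vol n k \<omega>)\<^sup>2 \<le> coeff_bound\<^sup>2"
  using coeff_bound(3)[of "X (grid_time n k) \<omega>"] coeff_bound(1) by (auto simp: vol_def abs_le_square_iff[symmetric])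

lemma b_X_integrable: "\<omega> \<in> space M \<Longrightarrow> 0 \<le> u \<Longrightarrow> (\<lambda>s. b (X s \<omega>)) integrable_on {u..v}"
  by (intro integrable_continuous_real continuous_on_compose2[OF b_cont]
      continuous_on_subset[OF X_cont]) auto

lemma dB_AE: "AE \<omega> in M. \<forall>n k. dB n k \<omega> = integral {grid_time n k..grid_time n (Suc k)} (\<lambda>s. b (X s \<omega>))"
proof -
  have "AE \<omega> in M. dB n k \<omega> = integral {grid_time n k..grid_time n (Suc k)} (\<lambda>s. b (X s \<omega>))" for n k
    using noise_AE[OF grid_time_nonneg[of n k]] noise_AE[OF grid_time_nonneg[of n "Suc k"]] AE_space
  proof eventually_elim
    case (elim \<omega>)
    have "integral {0..grid_time n k} (\<lambda>s. b (X s \<omega>)) + integral {grid_time n k..grid_time n (Suc k)} (\<lambda>s. b (X s \<omega>))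
        = integral {0..grid_time n (Suc k)} (\<lambda>s. b (X s \<omega>))"
      by (rule Henstock_Kurzweil_Integration.integral_combine[OF grid_time_nonneg grid_time_mono b_X_integrable[OF elim(3)]]) auto
    then show ?case using elim by (simp add: dB_def dX_def dI_def)
  qed
  then show ?thesis by (simp add: AE_all_countable)
qed

lemma dB_bound: "AE \<omega> in M. \<forall>n k. \<bar>dB n k \<omega>\<bar> \<le> coeff_bound * (T / 2^n)"
  using dB_AE AE_space
proof eventually_elim
  case (elim \<omega>)
  show ?case
  proof (intro allI)
    fix n k
    have "norm (integral {grid_time n k..grid_time n (Suc k)} (\<lambda>s. b (X s \<omega>))) \<le> coeff_bound * (grid_time n (Suc k) - grid_time n k)"
      using coeff_bound(2) grid_time_nonneg[of n k]
      by (intro integral_bound grid_time_mono continuous_on_compose2[OF b_cont] continuous_on_subset[OF X_cont] elim(2)) auto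
    then show "\<bar>dB n k \<omega>\<bar> \<le> coeff_bound * (T / 2^n)" using elim by (simp add: grid_time_Suc)
  qed
qed

text \<open>The error is uniform in \<open>k\<close> and proportional to the cell length, so the sum
  over all \<open>2^n\<close> cells is still at most \<open>e * T\<close>.\<close>

lemma dB_approx:
  "AE \<omega> in M. \<forall>e>0. \<forall>\<^sub>F n in sequentially. \<forall>k<2^n. \<bar>dB n k \<omega> - b (X (grid_time n k) \<omega>) * (T / 2^n)\<bar> \<le> e * (T / 2^n)"
  using dB_AE AE_space
proof eventually_elim
  case (elim \<omega>)
  show ?case
  proof (intro allI impI)
    fix e :: real assume e: "0 < e"
    obtain \<delta> where \<delta>: "0 < \<delta>"
      "\<And>u v. u \<in> {0..T} \<Longrightarrow> v \<in> {0..T} \<Longrightarrow> \<bar>u - v\<bar> < \<delta> \<Longrightarrow> \<bar>b (X u \<omega>) - b (X v \<omega>)\<bar> < e"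
      using uniform_modulus_comp[OF b_cont elim(2) e] by metis
    have "\<forall>\<^sub>F n in sequentially. T / 2^n < \<delta>" using order_tendstoD(2)[OF grid_tendsto_zero \<delta>(1)] .
    then show "\<forall>\<^sub>F n in sequentially. \<forall>k<2^n. \<bar>dB n k \<omega> - b (X (grid_time n k) \<omega>) * (T / 2^n)\<bar> \<le> e * (T / 2^n)"
    proof eventually_elim
      case n: (elim n)
      show ?case
      proof (intro allI impI)
        fix k :: nat assume k: "k < 2^n"
        then have le: "grid_time n (Suc k) \<le> T" by (intro grid_time_le) simp
        have "norm (integral {grid_time n k..grid_time n (Suc k)} (\<lambda>s. b (X s \<omega>) - b (X (grid_time n k) \<omega>))) \<le> e * (grid_time n (Suc k) - grid_time n k)"
        proof (rule integral_bound)
          show "continuous_on {grid_time n k..grid_time n (Suc k)} (\<lambda>s. b (X s \<omega>) - b (X (grid_time n k) \<omega>))"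
            using grid_time_nonneg[of n k]
            by (intro continuous_intros continuous_on_compose2[OF b_cont] continuous_on_subset[OF X_cont] elim(2)) auto
          fix s assume s: "s \<in> {grid_time n k..grid_time n (Suc k)}"
          then have "s \<in> {0..T}" "grid_time n k \<in> {0..T}" using grid_time_nonneg[of n k] le by auto
          moreover have "\<bar>s - grid_time n k\<bar> < \<delta>" using s grid_time_Suc[of n k] n by auto
          ultimately show "norm (b (X s \<omega>) - b (X (grid_time n k) \<omega>)) \<le> e" using \<delta>(2)[of s "grid_time n k"] by simp
        qed (auto intro: grid_time_mono)
        moreover have "integral {grid_time n k..grid_time n (Suc k)} (\<lambda>s. b (X s \<omega>) - b (X (grid_time n k) \<omega>))
            = dB n k \<omega> - b (X (grid_time n k) \<omega>) * (T / 2^n)"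
          using b_X_integrable[OF elim(2) grid_time_nonneg] elim(1) grid_time_mono[of k "Suc k" n] grid_time_Suc[of n k]
          by (subst Henstock_Kurzweil_Integration.integral_diff) (auto simp: mult.commute)
        ultimately show "\<bar>dB n k \<omega> - b (X (grid_time n k) \<omega>) * (T / 2^n)\<bar> \<le> e * (T / 2^n)" by (simp add: grid_time_Suc)
      qed
    qed
  qed
qed

text \<open>Both end points of the coarse cell are approximated on the same fine mesh, so everything
  before the cell cancels and its own block of \<open>2^m\<close> fine cells remains.\<close>

lemma dI_approx:
  "vanishes_in_prob M (\<lambda>m \<omega>. dI n k \<omega> - (\<Sum>i\<in>{k * 2^m..<k * 2^m + 2^m}. vol (n+m) i \<omega> * dW (n+m) i \<omega>))"
proof -
  have g: "grid_noise T n m (Suc k) \<omega> - grid_noise T n m k \<omega> = (\<Sum>i\<in>{k * 2^m..<k * 2^m + 2^m}. vol (n+m) i \<omega> * dW (n+m) i \<omega>)"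
    for m \<omega>
  proof -
    have "(\<Sum>i<Suc k * 2^m. f i) = (\<Sum>i<k * 2^m. f i) + (\<Sum>i\<in>{k * 2^m..<k * 2^m + 2^m}. f i)" for f :: "nat \<Rightarrow> real"
      using sum.atLeastLessThan_concat[of 0 "k * 2^m" "k * 2^m + 2^m" f]
      by (simp only: lessThan_atLeast0 mult_Suc add.commute[of "2^m"])
    then have "grid_noise T n m (Suc k) \<omega> = grid_noise T n m k \<omega> + (\<Sum>i\<in>{k * 2^m..<k * 2^m + 2^m}. vol (n+m) i \<omega> * dW (n+m) i \<omega>)"
      unfolding grid_noise_def vol_def dW_def grid_time_def by (simp only:)
    then show ?thesis by simp
  qed
  have "vanishes_in_prob M (\<lambda>m \<omega>. (noise (T * real (Suc k) / 2^n) \<omega> - grid_noise T n m (Suc k) \<omega>)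
      + (- 1) * (noise (T * real k / 2^n) \<omega> - grid_noise T n m k \<omega>))"
    by (intro vanishes_in_prob_add vanishes_in_prob_cmult noise_minus_grid_noise_vanishes T)
  then show ?thesis by (rule vanishes_in_prob_mono) (simp add: g[symmetric] dI_def grid_time_def)
qed

lemma grid_sum_second_moment:
  assumes "\<And>i. \<phi> i \<in> borel_measurable (F (grid_time n i))" "\<And>i \<omega>. \<omega> \<in> space M \<Longrightarrow> \<bar>\<phi> i \<omega>\<bar> \<le> C"
  shows "integrable M (\<lambda>\<omega>. (\<Sum>i<m. \<phi> i \<omega> * dW n i \<omega>)\<^sup>2)"
    and "expectation (\<lambda>\<omega>. (\<Sum>i<m. \<phi> i \<omega> * dW n i \<omega>)\<^sup>2) = (\<Sum>i<m. expectation (\<lambda>\<omega>. (\<phi> i \<omega>)\<^sup>2) * (T / 2^n))"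
    and "integrable M (\<lambda>\<omega>. (\<Sum>i<m. \<phi> i \<omega> * ((dW n i \<omega>)\<^sup>2 - T / 2^n))\<^sup>2)"
    and "expectation (\<lambda>\<omega>. (\<Sum>i<m. \<phi> i \<omega> * ((dW n i \<omega>)\<^sup>2 - T / 2^n))\<^sup>2)
      = (\<Sum>i<m. expectation (\<lambda>\<omega>. (\<phi> i \<omega>)\<^sup>2) * (2 * (T / 2^n)\<^sup>2))"
proof -
  have "0 < T / 2^n" using T by simp
  note iso = increment_sum_second_moment[where t="grid_time n" and \<delta>="T / 2^n" and \<phi>=\<phi> and C=C, OF grid_time_nonneg grid_time_Suc this assms]
  show "integrable M (\<lambda>\<omega>. (\<Sum>i<m. \<phi> i \<omega> * dW n i \<omega>)\<^sup>2)"
    "expectation (\<lambda>\<omega>. (\<Sum>i<m. \<phi> i \<omega> * dW n i \<omega>)\<^sup>2) = (\<Sum>i<m. expectation (\<lambda>\<omega>. (\<phi> i \<omega>)\<^sup>2) * (T / 2^n))"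
    "integrable M (\<lambda>\<omega>. (\<Sum>i<m. \<phi> i \<omega> * ((dW n i \<omega>)\<^sup>2 - T / 2^n))\<^sup>2)"
    "expectation (\<lambda>\<omega>. (\<Sum>i<m. \<phi> i \<omega> * ((dW n i \<omega>)\<^sup>2 - T / 2^n))\<^sup>2)
      = (\<Sum>i<m. expectation (\<lambda>\<omega>. (\<phi> i \<omega>)\<^sup>2) * (2 * (T / 2^n)\<^sup>2))"
    unfolding dW_def by (rule iso, assumption)+
qed

lemma expectation_power2_le:
  fixes \<phi> :: "'a \<Rightarrow> real"
  assumes "\<phi> \<in> borel_measurable M" "\<And>\<omega>. \<omega> \<in> space M \<Longrightarrow> \<bar>\<phi> \<omega>\<bar> \<le> C"
  shows "expectation (\<lambda>\<omega>. (\<phi> \<omega>)\<^sup>2) \<le> C\<^sup>2"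
proof -
  have le: "(\<phi> \<omega>)\<^sup>2 \<le> C\<^sup>2" if "\<omega> \<in> space M" for \<omega>
    using power_mono[OF assms(2)[OF that], of 2] by simp
  have "expectation (\<lambda>\<omega>. (\<phi> \<omega>)\<^sup>2) \<le> expectation (\<lambda>\<omega>. C\<^sup>2)"
    using le assms(1) by (intro integral_mono integrable_const_bound[where B="C\<^sup>2"]) auto
  then show ?thesis by (simp add: prob_space)
qed

text \<open>The second moment of order \<open>T\<close> for the stochastic integral, uniformly in
  \<open>n\<close>. The isometry bounds the fine sums \<open>S\<close> by
  \<open>C^2 * coeff_bound^2 * T\<close>; the factor 2 comes from separating the square of the
  approximation error \<open>E\<close>.\<close>

lemma weighted_noise_small_off:
  assumes p: "\<And>k. p k \<in> borel_measurable (F (grid_time n k))" "\<And>k \<omega>. \<omega> \<in> space M \<Longrightarrow> \<bar>p k \<omega>\<bar> \<le> C"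
    and pos: "0 < a" "0 < \<eta>"
  shows "small_off M (2 * C\<^sup>2 * coeff_bound\<^sup>2 * T / a + \<eta>) (a + \<eta>) (\<lambda>\<omega>. (\<Sum>k<2^n. p k \<omega> * dI n k \<omega>)\<^sup>2)"
proof -
  \<comment> \<open>The weight is kept constant on the \<open>2^m\<close> fine cells of a coarse
    cell. Being sampled no later than the fine cell starts, it stays adapted, and the isometry
    applies on the fine grid.\<close>
  define \<phi> where "\<phi> m i \<omega> = p (i div 2^m) \<omega> * vol (n+m) i \<omega>" for m i \<omega>
  define S where "S m \<omega> = (\<Sum>i<2^n * 2^m. \<phi> m i \<omega> * dW (n+m) i \<omega>)" for m \<omega>
  define E where "E m \<omega> = (\<Sum>k<2^n. p k \<omega> * (dI n k \<omega> - (\<Sum>i\<in>{k * 2^m..<k * 2^m + 2^m}. vol (n+m) i \<omega> * dW (n+m) i \<omega>)))" for m \<omega>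
  have \<phi>m: "\<phi> m i \<in> borel_measurable (F (grid_time (n+m) i))" for m i
  proof -
    have "grid_time n (i div 2^m) \<le> grid_time (n+m) i" by (subst grid_time_refine[of n _ m]) (intro grid_time_mono, simp)
    from measurable_filtration_mono[OF p(1) grid_time_nonneg this] show ?thesis
      unfolding \<phi>_def[abs_def] by (intro borel_measurable_times vol_adapted)
  qed
  have \<phi>b: "\<bar>\<phi> m i \<omega>\<bar> \<le> C * coeff_bound" if "\<omega> \<in> space M" for m i \<omega>
    unfolding \<phi>_def abs_mult using p(2)[OF that, of "i div 2^m"] vol_bounds(1)[of "n+m" i \<omega>]
    by (intro mult_mono) auto
  have iso: "integrable M (\<lambda>\<omega>. (S m \<omega>)\<^sup>2)"
    "expectation (\<lambda>\<omega>. (S m \<omega>)\<^sup>2) = (\<Sum>i<2^n * 2^m. expectation (\<lambda>\<omega>. (\<phi> m i \<omega>)\<^sup>2) * (T / 2^(n+m)))" for m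
    unfolding S_def by (rule grid_sum_second_moment[where \<phi>="\<phi> m" and C="C * coeff_bound", OF \<phi>m \<phi>b], assumption)+
  obtain \<omega>0 where "\<omega>0 \<in> space M" using not_empty by auto
  with p(2)[of \<omega>0 0] have C0: "0 \<le> C" by linarith
  have Ssum: "S m \<omega> = (\<Sum>k<2^n. p k \<omega> * (\<Sum>i\<in>{k * 2^m..<k * 2^m + 2^m}. vol (n+m) i \<omega> * dW (n+m) i \<omega>))" for m \<omega>
    unfolding S_def sum.nat_group[symmetric] sum_distrib_left
  proof (intro sum.cong refl)
    fix k i assume "i \<in> {k * 2^m..<k * 2^m + 2^m::nat}"
    then have "i div 2^m = k" by (intro div_nat_eqI) (auto simp: mult.commute)
    then show "\<phi> m i \<omega> * dW (n+m) i \<omega> = p k \<omega> * (vol (n+m) i \<omega> * dW (n+m) i \<omega>)"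
      by (simp add: \<phi>_def)
  qed
  have split: "(\<Sum>k<2^n. p k \<omega> * dI n k \<omega>) = S m \<omega> + E m \<omega>" for m \<omega>
    unfolding Ssum E_def by (simp only: sum.distrib[symmetric] distrib_left[symmetric]) simp
  have "vanishes_in_prob M (\<lambda>m \<omega>. \<Sum>k<2^n. p k \<omega> * (dI n k \<omega> - (\<Sum>i\<in>{k * 2^m..<k * 2^m + 2^m}. vol (n+m) i \<omega> * dW (n+m) i \<omega>)))"
  proof (rule vanishes_in_prob_sum)
    fix k
    from vanishes_in_prob_cmult[OF dI_approx[of n k], of C]
    show "vanishes_in_prob M (\<lambda>m \<omega>. p k \<omega> * (dI n k \<omega> - (\<Sum>i\<in>{k * 2^m..<k * 2^m + 2^m}. vol (n+m) i \<omega> * dW (n+m) i \<omega>)))"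
      by (rule vanishes_in_prob_mono) (use p(2) C0 in \<open>auto simp: abs_mult intro!: mult_right_mono\<close>)
  qed simp
  then have Ev: "vanishes_in_prob M (\<lambda>m \<omega>. 2 * (E m \<omega>)\<^sup>2)"
    unfolding E_def by (intro vanishes_in_prob_cmult vanishes_in_prob_power2)
  show ?thesis
  proof (rule small_off_Markov_limit[OF _ _ _ Ev _ pos])
    show "integrable M (\<lambda>\<omega>. 2 * (S m \<omega>)\<^sup>2)" for m using iso(1) by simp
    show "expectation (\<lambda>\<omega>. 2 * (S m \<omega>)\<^sup>2) \<le> 2 * C\<^sup>2 * coeff_bound\<^sup>2 * T" for m
    proof -
      have "expectation (\<lambda>\<omega>. (S m \<omega>)\<^sup>2) \<le> (\<Sum>i<2^n * 2^m::nat. (C * coeff_bound)\<^sup>2 * (T / 2^(n+m)))"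
        unfolding iso(2) using T
        by (intro sum_mono mult_right_mono expectation_power2_le \<phi>b measurable_filtration[OF \<phi>m grid_time_nonneg]) auto
      also have "\<dots> = (C * coeff_bound)\<^sup>2 * T" by (simp add: power_add)
      finally show ?thesis by (simp add: power_mult_distrib)
    qed
    show "AE \<omega> in M. \<bar>(\<Sum>k<2^n. p k \<omega> * dI n k \<omega>)\<^sup>2\<bar> \<le> 2 * (S m \<omega>)\<^sup>2 + 2 * (E m \<omega>)\<^sup>2" for m
    proof (rule AE_I2)
      fix \<omega>
      show "\<bar>(\<Sum>k<2^n. p k \<omega> * dI n k \<omega>)\<^sup>2\<bar> \<le> 2 * (S m \<omega>)\<^sup>2 + 2 * (E m \<omega>)\<^sup>2"
        unfolding split[of \<omega> m] using sum_power2_add_le[of "\<lambda>_. S m \<omega>" "\<lambda>_. E m \<omega>" "{0::nat}"] by simp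
    qed
  qed simp
qed

text \<open>The error made by freezing the volatility at the left end of the cell.\<close>

definition ito_rem :: "nat \<Rightarrow> nat \<Rightarrow> 'a \<Rightarrow> real" where "ito_rem n k \<omega> = dI n k \<omega> - vol n k \<omega> * dW n k \<omega>"

text \<open>On a single cell the integrand is the oscillation of \<open>\<sigma> (X _)\<close> since
  the left end, with second moment below \<open>e\<close>. By isometry the cell contributes at most
  \<open>e * (T / 2^n)\<close>, and the \<open>2^n\<close> cells together at most
  \<open>e * T\<close>.\<close>

lemma ito_rem_square_sum_small_off:
  assumes e: "\<And>u v. u \<in> {0..T} \<Longrightarrow> v \<in> {0..T} \<Longrightarrow> \<bar>u - v\<bar> < \<eta>' \<Longrightarrow>
      expectation (\<lambda>\<omega>. (\<sigma> (X u \<omega>) - \<sigma> (X v \<omega>))\<^sup>2) < e"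
    and n: "T / 2^n < \<eta>'" and pos: "0 < a" "0 < \<eta>"
  shows "small_off M (2 * e * T / a + \<eta>) (a + \<eta>) (\<lambda>\<omega>. \<Sum>k<2^n. (ito_rem n k \<omega>)\<^sup>2)"
proof -
  define B where "B m k = {k * 2^m..<k * 2^m + 2^m::nat}" for m k
  define S where "S m k \<omega> = (\<Sum>i\<in>B m k. (vol (n+m) i \<omega> - vol n k \<omega>) * dW (n+m) i \<omega>)" for m k \<omega>
  define E where "E m k \<omega> = dI n k \<omega> - (\<Sum>i\<in>B m k. vol (n+m) i \<omega> * dW (n+m) i \<omega>)" for m k \<omega>
  have tele: "(\<Sum>i\<in>B m k. dW (n+m) i \<omega>) = dW n k \<omega>" for m k \<omega>
    unfolding B_def dW_def
    by (subst sum_Suc_diff') (auto simp: grid_time_refine[of n k m] grid_time_refine[of n "Suc k" m] add.commute)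
  have split: "ito_rem n k \<omega> = S m k \<omega> + E m k \<omega>" for m k \<omega>
  proof -
    have "(\<Sum>i\<in>B m k. vol n k \<omega> * dW (n+m) i \<omega>) = vol n k \<omega> * dW n k \<omega>"
      unfolding sum_distrib_left[symmetric] tele ..
    then show ?thesis unfolding S_def E_def ito_rem_def by (simp add: left_diff_distrib sum_subtractf)
  qed
  have iso: "integrable M (\<lambda>\<omega>. (S m k \<omega>)\<^sup>2) \<and> expectation (\<lambda>\<omega>. (S m k \<omega>)\<^sup>2) \<le> e * (T / 2^n)"
    if k: "k < 2^n" for m k
  proof -
    define t where "t j = grid_time (n+m) (k * 2^m + j)" for j
    define \<phi> where "\<phi> j \<omega> = \<sigma> (X (t j) \<omega>) - \<sigma> (X (grid_time n k) \<omega>)" for j \<omega>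
    have t0: "0 \<le> t j" and tS: "t (Suc j) - t j = T / 2^(n+m)" for j
      unfolding t_def using grid_time_nonneg grid_time_Suc[of "n+m" "k * 2^m + j"] by simp_all
    have tk: "grid_time n k \<le> t j" for j unfolding t_def grid_time_refine[of n k m] by (rule grid_time_mono) simp
    have \<phi>m: "\<phi> j \<in> borel_measurable (F (t j))" for j
      unfolding \<phi>_def[abs_def]
      by (intro borel_measurable_diff measurable_compose[OF _ \<sigma>_measurable]
        X_adapted[OF t0 order_refl] X_adapted[OF grid_time_nonneg tk])
    have \<phi>b: "\<bar>\<phi> j \<omega>\<bar> \<le> 2 * coeff_bound" for j \<omega>
      unfolding \<phi>_def using coeff_bound(3)[of "X (t j) \<omega>"] coeff_bound(3)[of "X (grid_time n k) \<omega>"] by linarith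
    have Seq: "S m k \<omega> = (\<Sum>j<2^m. \<phi> j \<omega> * (W (t (Suc j)) \<omega> - W (t j) \<omega>))" for \<omega>
      unfolding S_def B_def using sum.shift_bounds_nat_ivl[of "\<lambda>i. (vol (n+m) i \<omega> - vol n k \<omega>) * dW (n+m) i \<omega>" 0 "k * 2^m" "2^m"]
      by (simp add: lessThan_atLeast0 \<phi>_def t_def vol_def dW_def add.commute)
    have "0 < T / 2^(n+m)" using T by simp
    note iso = increment_sum_second_moment[where t=t and \<delta>="T / 2^(n+m)" and \<phi>=\<phi> and C="2 * coeff_bound", OF t0 tS this \<phi>m \<phi>b]
    have le: "expectation (\<lambda>\<omega>. (\<phi> j \<omega>)\<^sup>2) \<le> e" if j: "j < 2^m" for j
    proof -
      have "t j < t (2^m)"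
        unfolding t_def grid_time_def using j T by (intro divide_strict_right_mono mult_strict_left_mono) auto
      moreover have "t (2^m) = grid_time n (Suc k)" unfolding t_def grid_time_refine[of n "Suc k" m] by (simp add: add.commute)
      moreover have "grid_time n (Suc k) \<le> T" using k by (intro grid_time_le) simp
      ultimately have "t j \<in> {0..T}" "grid_time n k \<in> {0..T}" "\<bar>t j - grid_time n k\<bar> < \<eta>'"
        using t0[of j] tk[of j] grid_time_nonneg[of n k] grid_time_Suc[of n k] n by auto
      from e[OF this] show ?thesis unfolding \<phi>_def by simp
    qed
    have "expectation (\<lambda>\<omega>. (S m k \<omega>)\<^sup>2) \<le> (\<Sum>j<2^m::nat. e * (T / 2^(n+m)))"
      unfolding Seq iso(2) using le T by (intro sum_mono mult_right_mono) auto
    also have "\<dots> = e * (T / 2^n)" by (simp add: power_add)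
    finally show ?thesis using iso(1)[of "2^m"] unfolding Seq by simp
  qed
  have "vanishes_in_prob M (\<lambda>m \<omega>. 2 * (\<Sum>k<2^n. (E m k \<omega>)\<^sup>2))"
    unfolding E_def B_def
    by (intro vanishes_in_prob_cmult vanishes_in_prob_sum vanishes_in_prob_power2 dI_approx) simp
  then show ?thesis
  proof (rule small_off_Markov_limit[where Y="\<lambda>m \<omega>. 2 * (\<Sum>k<2^n. (S m k \<omega>)\<^sup>2)", rotated 3])
    show "AE \<omega> in M. \<bar>\<Sum>k<2^n. (ito_rem n k \<omega>)\<^sup>2\<bar> \<le> 2 * (\<Sum>k<2^n. (S m k \<omega>)\<^sup>2) + 2 * (\<Sum>k<2^n. (E m k \<omega>)\<^sup>2)" for m
      unfolding split[of _ _ m] using sum_power2_add_le[of "\<lambda>k. S m k _" "\<lambda>k. E m k _" "{..<2^n}"]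
      by (intro AE_I2) (simp add: sum_nonneg)
    show "integrable M (\<lambda>\<omega>. 2 * (\<Sum>k<2^n. (S m k \<omega>)\<^sup>2))" for m
      using iso by (intro Bochner_Integration.integrable_mult_right Bochner_Integration.integrable_sum) auto
    have "expectation (\<lambda>\<omega>. \<Sum>k<2^n. (S m k \<omega>)\<^sup>2) \<le> (\<Sum>k<2^n::nat. e * (T / 2^n))" for m
    proof -
      have "expectation (\<lambda>\<omega>. \<Sum>k<2^n. (S m k \<omega>)\<^sup>2) = (\<Sum>k<2^n. expectation (\<lambda>\<omega>. (S m k \<omega>)\<^sup>2))"
        using iso by (intro Bochner_Integration.integral_sum) auto
      also have "\<dots> \<le> (\<Sum>k<2^n::nat. e * (T / 2^n))"
        by (rule sum_mono) (use iso in blast)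
      finally show ?thesis .
    qed
    then show "expectation (\<lambda>\<omega>. 2 * (\<Sum>k<2^n. (S m k \<omega>)\<^sup>2)) \<le> 2 * e * T" for m by simp
  qed (use pos in \<open>auto simp: sum_nonneg\<close>)
qed

lemma ito_rem_square_sum_vanishes: "vanishes_in_prob M (\<lambda>n \<omega>. \<Sum>k<2^n. (ito_rem n k \<omega>)\<^sup>2)"
  unfolding vanishes_in_prob_def
proof (intro allI impI)
  fix r :: real assume r: "0 < r"
  \<comment> \<open>Chosen so that \<open>2 * e * T / (r/2) = r/2\<close>.\<close>
  define e where "e = r\<^sup>2 / (8 * T)"
  have e0: "0 < e" using r T by (simp add: e_def)
  obtain \<eta>' where \<eta>': "0 < \<eta>'" "\<And>u v. u \<in> {0..T} \<Longrightarrow> v \<in> {0..T} \<Longrightarrow> \<bar>u - v\<bar> < \<eta>' \<Longrightarrow>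
      expectation (\<lambda>\<omega>. (\<sigma> (X u \<omega>) - \<sigma> (X v \<omega>))\<^sup>2) < e"
    using \<sigma>_X_uniformly_L2[OF e0] by blast
  have "\<forall>\<^sub>F n in sequentially. T / 2^n < \<eta>'" using order_tendstoD(2)[OF grid_tendsto_zero \<eta>'(1)] .
  then show "\<forall>\<^sub>F n in sequentially. small_off M r r (\<lambda>\<omega>. \<Sum>k<2^n. (ito_rem n k \<omega>)\<^sup>2)"
  proof eventually_elim
    case (elim n)
    have "small_off M (2 * e * T / (r/2) + r/2) (r/2 + r/2) (\<lambda>\<omega>. \<Sum>k<2^n. (ito_rem n k \<omega>)\<^sup>2)"
      using r by (intro ito_rem_square_sum_small_off[of \<eta>'] \<eta>'(2) elim) auto
    moreover have "2 * e * T / (r/2) + r/2 = r" using r T by (simp add: e_def power2_eq_square field_simps)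
    ultimately show ?case by simp
  qed
qed

context
  fixes g :: "nat \<Rightarrow> nat \<Rightarrow> 'a \<Rightarrow> real" and C :: real
  assumes g: "\<And>n k. g n k \<in> borel_measurable (F (grid_time n k))"
    and gC: "\<And>n k \<omega>. \<omega> \<in> space M \<Longrightarrow> \<bar>g n k \<omega>\<bar> \<le> C"
begin

text \<open>Each of the \<open>2^n\<close> uncorrelated terms has second moment of order
  \<open>(T / 2^n)^2\<close>, so the sum has second moment of order
  \<open>T * (T / 2^n)\<close>.\<close>

lemma weighted_W_square_sum_vanishes:
  "vanishes_in_prob M (\<lambda>n \<omega>. \<Sum>k<2^n. g n k \<omega> * (vol n k \<omega>)\<^sup>2 * ((dW n k \<omega>)\<^sup>2 - T / 2^n))"
proof (rule vanishes_in_prob_L2)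
  have m: "(\<lambda>\<omega>. g n k \<omega> * (vol n k \<omega>)\<^sup>2) \<in> borel_measurable (F (grid_time n k))" for n k
    by (intro borel_measurable_times borel_measurable_power g vol_adapted)
  have c: "\<bar>g n k \<omega> * (vol n k \<omega>)\<^sup>2\<bar> \<le> C * coeff_bound\<^sup>2" if "\<omega> \<in> space M" for n k \<omega>
    unfolding abs_mult using gC[OF that, of n k] vol_bounds(2)[of n k \<omega>] by (intro mult_mono) auto
  show "integrable M (\<lambda>\<omega>. (\<Sum>k<2^n. g n k \<omega> * (vol n k \<omega>)\<^sup>2 * ((dW n k \<omega>)\<^sup>2 - T / 2^n))\<^sup>2)" for n
    by (rule grid_sum_second_moment(3)[where \<phi>="\<lambda>k \<omega>. g n k \<omega> * (vol n k \<omega>)\<^sup>2", OF m c])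
  have "expectation (\<lambda>\<omega>. (\<Sum>k<2^n. g n k \<omega> * (vol n k \<omega>)\<^sup>2 * ((dW n k \<omega>)\<^sup>2 - T / 2^n))\<^sup>2) =
    (\<Sum>k<2^n. expectation (\<lambda>\<omega>. (g n k \<omega> * (vol n k \<omega>)\<^sup>2)\<^sup>2) * (2 * (T / 2^n)\<^sup>2))" for n
    by (rule grid_sum_second_moment(4)[where \<phi>="\<lambda>k \<omega>. g n k \<omega> * (vol n k \<omega>)\<^sup>2", OF m c])
  moreover have "(\<Sum>k<2^n. expectation (\<lambda>\<omega>. (g n k \<omega> * (vol n k \<omega>)\<^sup>2)\<^sup>2) * (2 * (T / 2^n)\<^sup>2)) \<le>
    (\<Sum>k<2^n::nat. (C * coeff_bound\<^sup>2)\<^sup>2 * (2 * (T / 2^n)\<^sup>2))" for n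
    by (intro sum_mono mult_right_mono expectation_power2_le c measurable_filtration[OF m grid_time_nonneg]) auto
  moreover have "(\<Sum>k<2^n::nat. (C * coeff_bound\<^sup>2)\<^sup>2 * (2 * (T / 2^n)\<^sup>2)) = (C * coeff_bound\<^sup>2)\<^sup>2 * 2 * T * (T / 2^n)" for n
    by (simp add: power2_eq_square)
  ultimately show "expectation (\<lambda>\<omega>. (\<Sum>k<2^n. g n k \<omega> * (vol n k \<omega>)\<^sup>2 * ((dW n k \<omega>)\<^sup>2 - T / 2^n))\<^sup>2)
    \<le> (C * coeff_bound\<^sup>2)\<^sup>2 * 2 * T * (T / 2^n)" for n by simp
  show "(\<lambda>n. (C * coeff_bound\<^sup>2)\<^sup>2 * 2 * T * (T / 2^n)) \<longlonglongrightarrow> 0"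
    using tendsto_mult_right_zero[OF grid_tendsto_zero] by blast
qed

end

lemma W_square_sum_tight: "tight_in_prob M (\<lambda>n \<omega>. \<Sum>k<2^n. (vol n k \<omega> * dW n k \<omega>)\<^sup>2)"
proof (rule tight_in_prob_add_vanishing[where K="coeff_bound\<^sup>2 * T"])
  show "vanishes_in_prob M (\<lambda>n \<omega>. \<Sum>k<2^n. 1 * (vol n k \<omega>)\<^sup>2 * ((dW n k \<omega>)\<^sup>2 - T / 2^n))"
    by (rule weighted_W_square_sum_vanishes[where g="\<lambda>n k \<omega>. 1" and C=1]) auto
  fix n \<omega>
  have "(\<Sum>k<2^n. (vol n k \<omega> * dW n k \<omega>)\<^sup>2) =
    (\<Sum>k<2^n. 1 * (vol n k \<omega>)\<^sup>2 * ((dW n k \<omega>)\<^sup>2 - T / 2^n)) + (\<Sum>k<2^n. (vol n k \<omega>)\<^sup>2 * (T / 2^n))"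
    by (simp add: power_mult_distrib right_diff_distrib sum_subtractf)
  moreover have "(\<Sum>k<2^n. (vol n k \<omega>)\<^sup>2 * (T / 2^n)) \<le> (\<Sum>k<2^n::nat. coeff_bound\<^sup>2 * (T / 2^n))"
    using T by (intro sum_mono mult_right_mono vol_bounds) auto
  moreover have "0 \<le> (\<Sum>k<2^n. (vol n k \<omega> * dW n k \<omega>)\<^sup>2)" by (simp add: sum_nonneg)
  ultimately show "\<bar>\<Sum>k<2^n. (vol n k \<omega> * dW n k \<omega>)\<^sup>2\<bar> \<le>
    coeff_bound\<^sup>2 * T + \<bar>\<Sum>k<2^n. 1 * (vol n k \<omega>)\<^sup>2 * ((dW n k \<omega>)\<^sup>2 - T / 2^n)\<bar>" by simp
qed

text \<open>The drift over a cell is of the order of the cell length, so its square sum is of order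
  \<open>2^(-n)\<close>; the other part is the square sum of \<open>ito_rem\<close>.\<close>

lemma drift_rem_square_sum_vanishes: "vanishes_in_prob M (\<lambda>n \<omega>. \<Sum>k<2^n. (dB n k \<omega> + ito_rem n k \<omega>)\<^sup>2)"
proof (rule vanishes_in_prob_mono_AE)
  have "(\<lambda>n. 2 * coeff_bound\<^sup>2 * T * (T / 2^n)) \<longlonglongrightarrow> 0"
    using tendsto_mult_right_zero[OF grid_tendsto_zero] by blast
  then have "vanishes_in_prob M (\<lambda>n \<omega>. 2 * coeff_bound\<^sup>2 * T * (T / 2^n))" by (intro vanishes_in_prob_AE) auto
  then show "vanishes_in_prob M (\<lambda>n \<omega>. 2 * coeff_bound\<^sup>2 * T * (T / 2^n) + 2 * (\<Sum>k<2^n. (ito_rem n k \<omega>)\<^sup>2))"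
    by (rule vanishes_in_prob_add[OF _ vanishes_in_prob_cmult[OF ito_rem_square_sum_vanishes]])
  show "AE \<omega> in M. \<bar>\<Sum>k<2^n. (dB n k \<omega> + ito_rem n k \<omega>)\<^sup>2\<bar> \<le> \<bar>2 * coeff_bound\<^sup>2 * T * (T / 2^n) + 2 * (\<Sum>k<2^n. (ito_rem n k \<omega>)\<^sup>2)\<bar>" for n
    using dB_bound
  proof eventually_elim
    case (elim \<omega>)
    have "(dB n k \<omega>)\<^sup>2 \<le> (coeff_bound * (T / 2^n))\<^sup>2" for k
      using power_mono[OF elim[rule_format, of n k] abs_ge_zero, of 2] by simp
    then have "(\<Sum>k<2^n. (dB n k \<omega>)\<^sup>2) \<le> (\<Sum>k<2^n::nat. (coeff_bound * (T / 2^n))\<^sup>2)" by (intro sum_mono)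
    also have "\<dots> = coeff_bound\<^sup>2 * T * (T / 2^n)" by (simp add: power2_eq_square)
    finally have "(\<Sum>k<2^n. (dB n k \<omega> + ito_rem n k \<omega>)\<^sup>2) \<le> 2 * coeff_bound\<^sup>2 * T * (T / 2^n) + 2 * (\<Sum>k<2^n. (ito_rem n k \<omega>)\<^sup>2)"
      using sum_power2_add_le[of "\<lambda>k. dB n k \<omega>" "\<lambda>k. ito_rem n k \<omega>" "{..<2^n}"] by simp
    moreover have "0 \<le> (\<Sum>k<2^n. (dB n k \<omega> + ito_rem n k \<omega>)\<^sup>2)" by (simp add: sum_nonneg)
    ultimately show ?case by linarith
  qed
qed

lemma dX_decomp: "dX n k \<omega> = vol n k \<omega> * dW n k \<omega> + (dB n k \<omega> + ito_rem n k \<omega>)"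
  by (simp add: dB_def ito_rem_def)

text \<open>\<open>dX\<close> is \<open>vol * dW\<close>, with tight square sum, plus a remainder
  with vanishing square sum. By Cauchy-Schwarz the mixed terms vanish as well, and the square of
  \<open>vol * dW\<close> is compensated by \<open>vol^2 * (T / 2^n)\<close>.\<close>

lemma weighted_quadratic_variation:
  assumes g: "\<And>n k. g n k \<in> borel_measurable (F (grid_time n k))"
    and gC: "\<And>n k \<omega>. \<omega> \<in> space M \<Longrightarrow> \<bar>g n k \<omega>\<bar> \<le> C"
  shows "vanishes_in_prob M (\<lambda>n \<omega>. \<Sum>k<2^n. g n k \<omega> * ((dX n k \<omega>)\<^sup>2 - (vol n k \<omega>)\<^sup>2 * (T / 2^n)))"
proof -
  obtain \<omega>0 where "\<omega>0 \<in> space M" using not_empty by auto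
  with gC[of \<omega>0 0 0] have C0: "0 \<le> C" by linarith
  define G Q where "G n \<omega> = (\<Sum>k<2^n. (vol n k \<omega> * dW n k \<omega>)\<^sup>2)"
    and "Q n \<omega> = (\<Sum>k<2^n. (dB n k \<omega> + ito_rem n k \<omega>)\<^sup>2)" for n \<omega>
  define Y where "Y n \<omega> = (\<Sum>k<2^n. g n k \<omega> * (vol n k \<omega>)\<^sup>2 * ((dW n k \<omega>)\<^sup>2 - T / 2^n))" for n \<omega>
  have nn: "0 \<le> G n \<omega>" "0 \<le> Q n \<omega>" for n \<omega> by (auto simp: G_def Q_def sum_nonneg)
  have "vanishes_in_prob M (\<lambda>n \<omega>. sqrt \<bar>Q n \<omega>\<bar> * sqrt \<bar>G n \<omega>\<bar>)"
    unfolding G_def Q_def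
    by (intro vanishes_in_prob_mult_tight vanishes_in_prob_sqrt tight_in_prob_sqrt
        drift_rem_square_sum_vanishes W_square_sum_tight)
  then have "vanishes_in_prob M (\<lambda>n \<omega>. 2 * C * (sqrt \<bar>Q n \<omega>\<bar> * sqrt \<bar>G n \<omega>\<bar>) + C * Q n \<omega>)"
    unfolding Q_def by (intro vanishes_in_prob_add vanishes_in_prob_cmult drift_rem_square_sum_vanishes)
  then have "vanishes_in_prob M (\<lambda>n \<omega>. \<Sum>k<2^n. g n k \<omega> * (2 * (vol n k \<omega> * dW n k \<omega>) * (dB n k \<omega> + ito_rem n k \<omega>)
       + (dB n k \<omega> + ito_rem n k \<omega>)\<^sup>2))"
  proof (rule vanishes_in_prob_mono)
    fix n \<omega> assume w: "\<omega> \<in> space M"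
    let ?G = "\<lambda>k. vol n k \<omega> * dW n k \<omega>" and ?Q = "\<lambda>k. dB n k \<omega> + ito_rem n k \<omega>"
    have "(\<Sum>k<2^n. \<bar>?G k\<bar> * \<bar>?Q k\<bar>)\<^sup>2 \<le> (\<Sum>k<2^n. \<bar>?G k\<bar>\<^sup>2) * (\<Sum>k<2^n. \<bar>?Q k\<bar>\<^sup>2)"
      by (rule Cauchy_Schwarz_ineq_sum)
    then have "(\<Sum>k<2^n. \<bar>?G k\<bar> * \<bar>?Q k\<bar>)\<^sup>2 \<le> Q n \<omega> * G n \<omega>" by (simp add: G_def Q_def mult.commute)
    then have cs: "(\<Sum>k<2^n. \<bar>?G k\<bar> * \<bar>?Q k\<bar>) \<le> sqrt (Q n \<omega>) * sqrt (G n \<omega>)"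
      unfolding real_sqrt_mult[symmetric] by (rule real_le_rsqrt)
    have "\<bar>\<Sum>k<2^n. g n k \<omega> * (2 * ?G k * ?Q k + (?Q k)\<^sup>2)\<bar> \<le> (\<Sum>k<2^n. C * (2 * (\<bar>?G k\<bar> * \<bar>?Q k\<bar>) + (?Q k)\<^sup>2))"
    proof (rule order_trans[OF sum_abs sum_mono])
      fix k
      have "\<bar>2 * ?G k * ?Q k + (?Q k)\<^sup>2\<bar> \<le> \<bar>2 * ?G k * ?Q k\<bar> + \<bar>(?Q k)\<^sup>2\<bar>" by (rule abs_triangle_ineq)
      also have "\<dots> = 2 * (\<bar>?G k\<bar> * \<bar>?Q k\<bar>) + (?Q k)\<^sup>2" by (simp add: abs_mult)
      finally show "\<bar>g n k \<omega> * (2 * ?G k * ?Q k + (?Q k)\<^sup>2)\<bar> \<le> C * (2 * (\<bar>?G k\<bar> * \<bar>?Q k\<bar>) + (?Q k)\<^sup>2)"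
        unfolding abs_mult[of "g n k \<omega>"] by (intro mult_mono gC w C0) auto
    qed
    also have "\<dots> = 2 * C * (\<Sum>k<2^n. \<bar>?G k\<bar> * \<bar>?Q k\<bar>) + C * Q n \<omega>"
      unfolding Q_def by (simp only: sum_distrib_left distrib_left sum.distrib mult.assoc mult.left_commute[of C 2])
    also have "\<dots> \<le> 2 * C * (sqrt (Q n \<omega>) * sqrt (G n \<omega>)) + C * Q n \<omega>"
      using cs C0 by (intro add_right_mono mult_left_mono) auto
    finally show "\<bar>\<Sum>k<2^n. g n k \<omega> * (2 * ?G k * ?Q k + (?Q k)\<^sup>2)\<bar> \<le>
       \<bar>2 * C * (sqrt \<bar>Q n \<omega>\<bar> * sqrt \<bar>G n \<omega>\<bar>) + C * Q n \<omega>\<bar>" using nn[of n \<omega>] by simp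
  qed
  from vanishes_in_prob_add[OF weighted_W_square_sum_vanishes[of g C, OF g gC] this]
  have "vanishes_in_prob M (\<lambda>n \<omega>. Y n \<omega> + (\<Sum>k<2^n. g n k \<omega> * (2 * (vol n k \<omega> * dW n k \<omega>) * (dB n k \<omega> + ito_rem n k \<omega>)
       + (dB n k \<omega> + ito_rem n k \<omega>)\<^sup>2)))" unfolding Y_def by simp
  moreover have "Y n \<omega> + (\<Sum>k<2^n. g n k \<omega> * (2 * (vol n k \<omega> * dW n k \<omega>) * (dB n k \<omega> + ito_rem n k \<omega>)
       + (dB n k \<omega> + ito_rem n k \<omega>)\<^sup>2)) = (\<Sum>k<2^n. g n k \<omega> * ((dX n k \<omega>)\<^sup>2 - (vol n k \<omega>)\<^sup>2 * (T / 2^n)))" for n \<omega>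
    unfolding Y_def sum.distrib[symmetric] dX_decomp
    by (intro sum.cong refl) (simp add: power2_eq_square algebra_simps)
  ultimately show ?thesis by simp
qed

lemma quadratic_variation_tight: "tight_in_prob M (\<lambda>n \<omega>. \<Sum>k<2^n. (dX n k \<omega>)\<^sup>2)"
proof (rule tight_in_prob_add_vanishing[where K="coeff_bound\<^sup>2 * T"])
  show "vanishes_in_prob M (\<lambda>n \<omega>. \<Sum>k<2^n. 1 * ((dX n k \<omega>)\<^sup>2 - (vol n k \<omega>)\<^sup>2 * (T / 2^n)))"
    by (rule weighted_quadratic_variation[where C=1]) auto
  fix n \<omega>
  have "(\<Sum>k<2^n. (dX n k \<omega>)\<^sup>2) =
    (\<Sum>k<2^n. 1 * ((dX n k \<omega>)\<^sup>2 - (vol n k \<omega>)\<^sup>2 * (T / 2^n))) + (\<Sum>k<2^n. (vol n k \<omega>)\<^sup>2 * (T / 2^n))"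
    by (simp add: sum_subtractf)
  moreover have "(\<Sum>k<2^n. (vol n k \<omega>)\<^sup>2 * (T / 2^n)) \<le> (\<Sum>k<2^n::nat. coeff_bound\<^sup>2 * (T / 2^n))"
    using T by (intro sum_mono mult_right_mono vol_bounds) auto
  moreover have "0 \<le> (\<Sum>k<2^n. (dX n k \<omega>)\<^sup>2)" by (simp add: sum_nonneg)
  ultimately show "\<bar>\<Sum>k<2^n. (dX n k \<omega>)\<^sup>2\<bar> \<le>
    coeff_bound\<^sup>2 * T + \<bar>\<Sum>k<2^n. 1 * ((dX n k \<omega>)\<^sup>2 - (vol n k \<omega>)\<^sup>2 * (T / 2^n))\<bar>" by simp
qed

end

end

section \<open>Second-order expansion of cycle functionals\<close>

text \<open>For terms that are small relative to \<open>S\<close>, where \<open>S\<close> is bounded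
  in probability only: the quotient vanishes in probability and is multiplied back by
  \<open>S\<close>. Where \<open>S\<close> is 0 the quotient is 0 by convention, and
  \<open>zero\<close> keeps the product equal to \<open>Z\<close>.\<close>

lemma (in prob_space) vanishes_in_prob_relative_tight:
  assumes S: "tight_in_prob M S"
    and A: "\<And>e n. 0 < e \<Longrightarrow> A e n \<in> sets M"
    and ev: "\<And>e. 0 < e \<Longrightarrow> AE \<omega> in M. \<forall>\<^sub>F n in sequentially. \<omega> \<notin> A e n"
    and le: "\<And>e n \<omega>. 0 < e \<Longrightarrow> \<omega> \<in> space M \<Longrightarrow> \<omega> \<notin> A e n \<Longrightarrow> \<bar>Z n \<omega>\<bar> \<le> e * \<bar>S n \<omega>\<bar>"
    and zero: "\<And>n \<omega>. \<omega> \<in> space M \<Longrightarrow> S n \<omega> = 0 \<Longrightarrow> Z n \<omega> = 0"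
  shows "vanishes_in_prob M Z"
proof -
  have "vanishes_in_prob M (\<lambda>n \<omega>. Z n \<omega> / S n \<omega>)"
  proof (rule vanishes_in_prob_if_eventually_le[OF A ev])
    fix e :: real and n \<omega> assume "0 < e" "\<omega> \<in> space M" "\<omega> \<notin> A e n"
    from le[OF this] \<open>0 < e\<close> show "\<bar>Z n \<omega> / S n \<omega>\<bar> \<le> e" by (cases "S n \<omega> = 0") (auto simp: divide_simps)
  qed
  from vanishes_in_prob_mult_tight[OF this S] show ?thesis
    by (rule vanishes_in_prob_mono) (use zero in auto)
qed

lemma second_order_Taylor:
  fixes V V1 V2 :: "real \<Rightarrow> real"
  assumes "\<And>d. (V has_real_derivative V1 d) (at d)" "\<And>d. (V1 has_real_derivative V2 d) (at d)"
  obtains \<xi> where "\<bar>\<xi> - d\<bar> \<le> \<bar>x\<bar>" "V (d + x) = V d + V1 d * x + V2 \<xi> / 2 * x\<^sup>2"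
proof (cases "x = 0")
  case True then show ?thesis using that[of d] by simp
next
  case False
  define D where "D m = (if m = 0 then V else if m = 1 then V1 else V2)" for m :: nat
  have "\<exists>t. (if d + x < d then d + x < t \<and> t < d else d < t \<and> t < d + x) \<and>
    V (d + x) = (\<Sum>m<2. D m d / fact m * (d + x - d) ^ m) + D 2 t / fact 2 * (d + x - d)\<^sup>2"
    by (rule Taylor[of 2 D V "d - \<bar>x\<bar>" "d + \<bar>x\<bar>"])
      (use False assms in \<open>auto simp: D_def less_2_cases_iff\<close>)
  then obtain t where t: "if d + x < d then d + x < t \<and> t < d else d < t \<and> t < d + x"
    "V (d + x) = V d + V1 d * x + V2 t / 2 * x\<^sup>2"
    by (auto simp: D_def numeral_2_eq_2)
  then show ?thesis by (intro that[of t]) (auto split: if_splits)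
qed

text \<open>The argument \<open>d\<close> is a displacement from the base point, so the coefficients
  of the generator are shifted by \<open>y\<close>. The bounds refer to \<open>[-1, 1]\<close>,
  where displacements stay; on the whole line the derivatives of a scale function are in general
  unbounded.\<close>

locale cycle_test_function = periodic_sde M F W X b \<sigma> y
  for M :: "'a measure" and F :: "real \<Rightarrow> 'a measure" and W X :: "real \<Rightarrow> 'a \<Rightarrow> real"
    and b \<sigma> :: "real \<Rightarrow> real" and y :: real +
  fixes V V1 V2 :: "real \<Rightarrow> real" and \<kappa> C T :: real
  assumes dV: "\<And>d. (V has_real_derivative V1 d) (at d)"
    and dV1: "\<And>d. (V1 has_real_derivative V2 d) (at d)"
    and V2_cont: "continuous_on UNIV V2" and V_0: "V 0 = 0"
    and generator: "\<And>d. b (y + d) * V1 d + (\<sigma> (y + d))\<^sup>2 / 2 * V2 d = \<kappa>"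
    and V_bnd: "\<And>d. \<bar>d\<bar> \<le> 1 \<Longrightarrow> \<bar>V1 d\<bar> \<le> C \<and> \<bar>V2 d\<bar> \<le> C"
    and T: "0 < T"
begin

definition base :: "nat \<Rightarrow> nat \<Rightarrow> 'a \<Rightarrow> real" where
  "base n k \<omega> = cycle_base (\<lambda>s. X s \<omega>) (grid_time T n k)"

definition disp :: "nat \<Rightarrow> nat \<Rightarrow> 'a \<Rightarrow> real" where
  "disp n k \<omega> = X (grid_time T n k) \<omega> - base n k \<omega>"

definition total :: "'a \<Rightarrow> real" where
  "total \<omega> = V 1 * cycle_count_plus (\<lambda>s. X s \<omega>) T + V (-1) * cycle_count_minus (\<lambda>s. X s \<omega>) T
     + V (X T \<omega> - cycle_base (\<lambda>s. X s \<omega>) T)"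

definition taylor_rem :: "nat \<Rightarrow> nat \<Rightarrow> 'a \<Rightarrow> real" where
  "taylor_rem n k \<omega> = V (disp n k \<omega> + dX T n k \<omega>) - V (disp n k \<omega>)
     - V1 (disp n k \<omega>) * dX T n k \<omega> - V2 (disp n k \<omega>) / 2 * (dX T n k \<omega>)\<^sup>2"

lemma V_cont: "continuous_on UNIV V" and V1_cont: "continuous_on UNIV V1"
  by (rule DERIV_continuous_on, rule dV) (rule DERIV_continuous_on, rule dV1)

lemma V_measurable [measurable]: "V \<in> borel_measurable borel" "V1 \<in> borel_measurable borel"
    "V2 \<in> borel_measurable borel"
  using V_cont V1_cont V2_cont by (auto intro: borel_measurable_continuous_onI)

text \<open>The derivatives of \<open>V\<close> at \<open>disp\<close> are the weights in the
  isometries, so they must be known at the left end of the cell;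
  \<open>cycle_base_measurable\<close> is therefore applied to the filtration at that time.\<close>

lemma disp_adapted: "disp n k \<in> borel_measurable (F (grid_time T n k))"
proof -
  have sp: "space (F (grid_time T n k)) = space M"
    using filtration_subalgebra[OF grid_time_nonneg[OF T]] by (simp add: subalgebra_def)
  have "(\<lambda>\<omega>. cycle_base (\<lambda>s. X s \<omega>) (grid_time T n k)) \<in> borel_measurable (F (grid_time T n k))"
    by (rule cycle_base_measurable[OF grid_time_nonneg[OF T] X_adapted X_cont X_0]) (simp_all add: sp)
  then show ?thesis unfolding disp_def[abs_def] base_def
    by (intro borel_measurable_diff X_adapted grid_time_nonneg[OF T] order_refl)
qed

lemma disp_measurable [measurable]: "disp n k \<in> borel_measurable M"
  by (rule measurable_filtration[OF disp_adapted grid_time_nonneg[OF T]])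

lemma dX_measurable [measurable]: "dX T n k \<in> borel_measurable M" "dB T n k \<in> borel_measurable M"
    "X (grid_time T n k) \<in> borel_measurable M"
  using increments_measurable[OF T] grid_measurable[OF T] by auto

lemma disp_bound: "\<omega> \<in> space M \<Longrightarrow> \<bar>disp n k \<omega>\<bar> \<le> 1"
  unfolding disp_def base_def using abs_diff_cycle_base_less[OF X_cont grid_time_nonneg[OF T]] less_imp_le by blast

text \<open>\<open>X\<close> and \<open>y + disp\<close> differ by an integer, which the periodic
  coefficients do not see. This is where one \<open>V\<close> serves all cycles.\<close>

lemma disp_generator:
  assumes "\<omega> \<in> space M"
  shows "b (X (grid_time T n k) \<omega>) * V1 (disp n k \<omega>) + (vol T n k \<omega>)\<^sup>2 / 2 * V2 (disp n k \<omega>) = \<kappa>"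
proof -
  have "base n k \<omega> - y \<in> \<int>"
    using cycle_base_Ints[OF X_cont[OF assms] grid_time_nonneg[OF T]] X_0[OF assms] by (simp add: base_def)
  then obtain z where z: "base n k \<omega> - y = of_int z" by (auto elim: Ints_cases)
  have "X (grid_time T n k) \<omega> = (y + disp n k \<omega>) + of_int z" using z by (simp add: disp_def)
  then show ?thesis
    using generator[of "disp n k \<omega>"] periodic_add_int[of b, OF b_per] periodic_add_int[of \<sigma>, OF \<sigma>_per]
    by (simp add: vol_def[OF T])
qed

lemma total_minus_sum_vanishes:
  "vanishes_in_prob M (\<lambda>n \<omega>. total \<omega> - (\<Sum>k<2^n. V (disp n k \<omega> + dX T n k \<omega>) - V (disp n k \<omega>)))"
proof -
  let ?S = "\<lambda>n \<omega>. \<Sum>k<2^n. V (disp n k \<omega> + dX T n k \<omega>) - V (disp n k \<omega>)"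
  have lim: "(\<lambda>n. ?S n \<omega>) \<longlonglongrightarrow> total \<omega>" if "\<omega> \<in> space M" for \<omega>
  proof -
    have "disp n k \<omega> + dX T n k \<omega> = X (T * real (Suc k) / 2^n) \<omega> - cycle_base (\<lambda>s. X s \<omega>) (T * real k / 2^n)"
      "disp n k \<omega> = X (T * real k / 2^n) \<omega> - cycle_base (\<lambda>s. X s \<omega>) (T * real k / 2^n)" for n k
      by (simp_all add: disp_def base_def dX_def[OF T] grid_time_def[OF T])
    then show ?thesis
      using cycle_functional_limit[OF X_cont[OF that] T V_cont V_0] unfolding total_def by (simp only:)
  qed
  have Sm: "?S n \<in> borel_measurable M" for n by measurable
  \<comment> \<open>Measurability of the functional, counts included, comes from its being the
    pointwise limit of measurable grid sums.\<close>
  have "total \<in> borel_measurable M" by (rule borel_measurable_LIMSEQ_real[OF lim Sm])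
  moreover have "(\<lambda>n. total \<omega> - ?S n \<omega>) \<longlonglongrightarrow> 0" if "\<omega> \<in> space M" for \<omega>
    using tendsto_diff[OF tendsto_const lim[OF that], of "total \<omega>"] by simp
  ultimately show ?thesis using Sm by (intro vanishes_in_prob_AE AE_I2 borel_measurable_diff)
qed

lemma taylor_rem_small:
  assumes w: "\<omega> \<in> space M" and e: "0 < e"
  shows "\<forall>\<^sub>F n in sequentially. \<forall>k<2^n. \<bar>taylor_rem n k \<omega>\<bar> \<le> e * (dX T n k \<omega>)\<^sup>2"
proof -
  \<comment> \<open>Displacements are at most 1 in size and increments will be below 1, so the
    intermediate point of Taylor's formula stays in \<open>[-2, 2]\<close>.\<close>
  have "uniformly_continuous_on {-2..2} V2"
    by (intro compact_uniformly_continuous continuous_on_subset[OF V2_cont]) auto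
  then obtain \<rho> where \<rho>: "0 < \<rho>" "\<And>u v. u \<in> {-2..2} \<Longrightarrow> v \<in> {-2..2} \<Longrightarrow> \<bar>v - u\<bar> < \<rho> \<Longrightarrow> \<bar>V2 v - V2 u\<bar> < e"
    using e unfolding uniformly_continuous_on_def dist_real_def by metis
  obtain \<delta> where \<delta>: "0 < \<delta>" "\<And>u v. u \<in> {0..T} \<Longrightarrow> v \<in> {0..T} \<Longrightarrow> \<bar>u - v\<bar> < \<delta> \<Longrightarrow> \<bar>X u \<omega> - X v \<omega>\<bar> < min \<rho> 1"
    using uniform_modulus[OF X_cont[OF w], of "min \<rho> 1" T] \<rho>(1) by auto
  have "\<forall>\<^sub>F n in sequentially. T / 2^n < \<delta>" using order_tendstoD(2)[OF grid_tendsto_zero \<delta>(1)] .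
  then show ?thesis
  proof eventually_elim
    case (elim n)
    show ?case
    proof (intro allI impI)
      fix k :: nat assume "k < 2^n"
      then have "grid_time T n k \<in> {0..T}" "grid_time T n (Suc k) \<in> {0..T}"
        using grid_time_nonneg[OF T] grid_time_le[OF T] by auto
      moreover have "\<bar>grid_time T n (Suc k) - grid_time T n k\<bar> < \<delta>" using grid_time_Suc[OF T, of n k] elim T by simp
      ultimately have x: "\<bar>dX T n k \<omega>\<bar> < min \<rho> 1" unfolding dX_def[OF T] by (intro \<delta>(2))
      obtain \<xi> where \<xi>: "\<bar>\<xi> - disp n k \<omega>\<bar> \<le> \<bar>dX T n k \<omega>\<bar>"
        "V (disp n k \<omega> + dX T n k \<omega>) = V (disp n k \<omega>) + V1 (disp n k \<omega>) * dX T n k \<omega> + V2 \<xi> / 2 * (dX T n k \<omega>)\<^sup>2"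
        using second_order_Taylor[OF dV dV1] by blast
      have "\<bar>V2 \<xi> - V2 (disp n k \<omega>)\<bar> < e"
        using \<xi>(1) x disp_bound[OF w, of n k] by (intro \<rho>(2)) auto
      moreover have "taylor_rem n k \<omega> = (V2 \<xi> - V2 (disp n k \<omega>)) / 2 * (dX T n k \<omega>)\<^sup>2"
        unfolding taylor_rem_def \<xi>(2) by (simp add: algebra_simps diff_divide_distrib)
      then have "\<bar>taylor_rem n k \<omega>\<bar> = \<bar>V2 \<xi> - V2 (disp n k \<omega>)\<bar> / 2 * (dX T n k \<omega>)\<^sup>2"
        by (simp only: abs_mult abs_divide abs_numeral abs_power2)
      moreover have "\<dots> \<le> e * (dX T n k \<omega>)\<^sup>2" using calculation(1) e by (intro mult_right_mono) auto
      ultimately show "\<bar>taylor_rem n k \<omega>\<bar> \<le> e * (dX T n k \<omega>)\<^sup>2" by simp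
    qed
  qed
qed

text \<open>Path by path the remainder is eventually at most \<open>e\<close> times the quadratic
  variation on the grid, and the latter is tight.\<close>

lemma taylor_rem_sum_vanishes: "vanishes_in_prob M (\<lambda>n \<omega>. \<Sum>k<2^n. taylor_rem n k \<omega>)"
proof (rule vanishes_in_prob_relative_tight[OF quadratic_variation_tight[OF T]])
  let ?A = "\<lambda>e n. {\<omega>\<in>space M. \<exists>k<2^n. e * (dX T n k \<omega>)\<^sup>2 < \<bar>taylor_rem n k \<omega>\<bar>}"
  have [measurable]: "taylor_rem n k \<in> borel_measurable M" for n k
    unfolding taylor_rem_def[abs_def] by measurable
  show "?A e n \<in> sets M" for e n by measurable
  show "AE \<omega> in M. \<forall>\<^sub>F n in sequentially. \<omega> \<notin> ?A e n" if "0 < e" for e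
  proof (rule AE_I2)
    fix \<omega> assume "\<omega> \<in> space M"
    from taylor_rem_small[OF this that] show "\<forall>\<^sub>F n in sequentially. \<omega> \<notin> ?A e n"
      by eventually_elim (auto simp: not_less)
  qed
  show "\<bar>\<Sum>k<2^n. taylor_rem n k \<omega>\<bar> \<le> e * \<bar>\<Sum>k<2^n. (dX T n k \<omega>)\<^sup>2\<bar>"
    if "0 < e" "\<omega> \<in> space M" "\<omega> \<notin> ?A e n" for e n \<omega>
  proof -
    have "\<bar>\<Sum>k<2^n. taylor_rem n k \<omega>\<bar> \<le> (\<Sum>k<2^n. e * (dX T n k \<omega>)\<^sup>2)"
    proof (rule order_trans[OF sum_abs sum_mono])
      fix k assume "k \<in> {..<2^n::nat}"
      then show "\<bar>taylor_rem n k \<omega>\<bar> \<le> e * (dX T n k \<omega>)\<^sup>2" using that by (intro leI) auto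
    qed
    then show ?thesis by (simp add: sum_distrib_left[symmetric] sum_nonneg)
  qed
  show "(\<Sum>k<2^n. taylor_rem n k \<omega>) = 0" if "(\<Sum>k<2^n. (dX T n k \<omega>)\<^sup>2) = 0" for n \<omega>
  proof (rule sum.neutral, rule ballI)
    fix k assume "k \<in> {..<2^n::nat}"
    then have "dX T n k \<omega> = 0" using that by (subst (asm) sum_nonneg_eq_0_iff) auto
    then show "taylor_rem n k \<omega> = 0" by (simp add: taylor_rem_def)
  qed
qed

lemma drift_sum_vanishes:
  "vanishes_in_prob M (\<lambda>n \<omega>. \<Sum>k<2^n. V1 (disp n k \<omega>) * (dB T n k \<omega> - b (X (grid_time T n k) \<omega>) * (T / 2^n)))"
proof (rule vanishes_in_prob_AE)
  show "AE \<omega> in M. (\<lambda>n. \<Sum>k<2^n. V1 (disp n k \<omega>) * (dB T n k \<omega> - b (X (grid_time T n k) \<omega>) * (T / 2^n))) \<longlonglongrightarrow> 0"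
    using dB_approx[OF T] AE_space
  proof eventually_elim
    case (elim \<omega>)
    show ?case
    proof (rule LIMSEQ_I)
      fix r :: real assume r: "0 < r"
      have "\<bar>V1 0\<bar> \<le> C" using V_bnd[of 0] by simp
      then have C0: "0 \<le> C" by linarith
      \<comment> \<open>This gives \<open>C * e * T \<le> r / 2\<close>; \<open>C + 1\<close>
        replaces \<open>C\<close> because \<open>C\<close> may be 0.\<close>
      define e where "e = r / 2 / T / (C + 1)"
      have e: "0 < e" using r T C0 by (simp add: e_def)
      have "C * e * T \<le> (C + 1) * e * T" using e T by (intro mult_right_mono) auto
      also have "\<dots> = r / 2 / T * ((C + 1) / (C + 1)) * T" by (simp add: e_def)
      also have "\<dots> = r / 2" using T C0 by simp
      finally have eT: "C * e * T < r" using r by simp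
      from elim(1) e obtain n0 where n0: "\<And>n k. n \<ge> n0 \<Longrightarrow> k < 2^n \<Longrightarrow>
          \<bar>dB T n k \<omega> - b (X (grid_time T n k) \<omega>) * (T / 2^n)\<bar> \<le> e * (T / 2^n)"
        unfolding eventually_sequentially by metis
      show "\<exists>no. \<forall>n\<ge>no. norm ((\<Sum>k<2^n. V1 (disp n k \<omega>) * (dB T n k \<omega> - b (X (grid_time T n k) \<omega>) * (T / 2^n))) - 0) < r"
      proof (intro exI allI impI)
        fix n assume n: "n0 \<le> n"
        have "\<bar>\<Sum>k<2^n. V1 (disp n k \<omega>) * (dB T n k \<omega> - b (X (grid_time T n k) \<omega>) * (T / 2^n))\<bar> \<le> (\<Sum>k<2^n::nat. C * (e * (T / 2^n)))"
          unfolding abs_mult[symmetric]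
        proof (rule order_trans[OF sum_abs sum_mono])
          fix k assume "k \<in> {..<2^n::nat}"
          then show "\<bar>V1 (disp n k \<omega>) * (dB T n k \<omega> - b (X (grid_time T n k) \<omega>) * (T / 2^n))\<bar> \<le> C * (e * (T / 2^n))"
            unfolding abs_mult using n0[OF n, of k] V_bnd[OF disp_bound[OF elim(2)], of n k] C0
            by (intro mult_mono) auto
        qed
        also have "\<dots> = C * e * T" by simp
        finally show "norm ((\<Sum>k<2^n. V1 (disp n k \<omega>) * (dB T n k \<omega> - b (X (grid_time T n k) \<omega>) * (T / 2^n))) - 0) < r"
          using eT by simp
      qed
    qed
  qed
qed measurable

text \<open>Chebyshev's inequality: a second moment of order \<open>T\<close> against the level
  \<open>(\<epsilon> * T)^2\<close> leaves a probability of order \<open>1 / T\<close>. The factor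
  16 is the 2 of \<open>weighted_noise_small_off\<close> times the 8 in the choice of
  \<open>a\<close>; the summand 1 pays for the two errors \<open>\<eta>\<close>.\<close>

lemma total_concentrates:
  assumes \<epsilon>: "0 < \<epsilon>"
  shows "small_off M ((16 * C\<^sup>2 * coeff_bound\<^sup>2 / \<epsilon>\<^sup>2 + 1) / T) (\<epsilon> * T) (\<lambda>\<omega>. total \<omega> - \<kappa> * T)"
proof -
  define Y where "Y n \<omega> = (total \<omega> - (\<Sum>k<2^n. V (disp n k \<omega> + dX T n k \<omega>) - V (disp n k \<omega>)))
     + ((\<Sum>k<2^n. taylor_rem n k \<omega>)
     + ((\<Sum>k<2^n. V1 (disp n k \<omega>) * (dB T n k \<omega> - b (X (grid_time T n k) \<omega>) * (T / 2^n)))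
     + 1/2 * (\<Sum>k<2^n. V2 (disp n k \<omega>) * ((dX T n k \<omega>)\<^sup>2 - (vol T n k \<omega>)\<^sup>2 * (T / 2^n)))))" for n \<omega>
  define Z where "Z n \<omega> = (\<Sum>k<2^n. V1 (disp n k \<omega>) * dI T n k \<omega>)" for n \<omega>
  have ad: "(\<lambda>\<omega>. V1 (disp n k \<omega>)) \<in> borel_measurable (F (grid_time T n k))"
    "(\<lambda>\<omega>. V2 (disp n k \<omega>)) \<in> borel_measurable (F (grid_time T n k))" for n k
    using disp_adapted by measurable
  have bd: "\<bar>V1 (disp n k \<omega>)\<bar> \<le> C" "\<bar>V2 (disp n k \<omega>)\<bar> \<le> C" if "\<omega> \<in> space M" for n k \<omega>
    using V_bnd[OF disp_bound[OF that]] by auto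
  have "vanishes_in_prob M (\<lambda>n \<omega>. \<Sum>k<2^n. V2 (disp n k \<omega>) * ((dX T n k \<omega>)\<^sup>2 - (vol T n k \<omega>)\<^sup>2 * (T / 2^n)))"
    by (rule weighted_quadratic_variation[OF T ad(2) bd(2)])
  then have Y: "vanishes_in_prob M Y" unfolding Y_def
    by (intro vanishes_in_prob_add[OF total_minus_sum_vanishes vanishes_in_prob_add[OF taylor_rem_sum_vanishes
        vanishes_in_prob_add[OF drift_sum_vanishes vanishes_in_prob_cmult]]])
  \<comment> \<open>An exact identity for every \<open>n\<close>: \<open>disp_generator\<close>
    turns the compensators of drift and quadratic variation into \<open>\<kappa> * (T / 2^n)\<close>
    per cell. The left side does not depend on \<open>n\<close>, so one sufficiently large
    \<open>n\<close> can be fixed later.\<close>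
  have eq: "total \<omega> - \<kappa> * T = Y n \<omega> + Z n \<omega>" if w: "\<omega> \<in> space M" for n \<omega>
  proof -
    have "(\<Sum>k<2^n. V (disp n k \<omega> + dX T n k \<omega>) - V (disp n k \<omega>)) =
      (\<Sum>k<2^n. taylor_rem n k \<omega> + (V1 (disp n k \<omega>) * (dB T n k \<omega> - b (X (grid_time T n k) \<omega>) * (T / 2^n))
       + (1/2 * (V2 (disp n k \<omega>) * ((dX T n k \<omega>)\<^sup>2 - (vol T n k \<omega>)\<^sup>2 * (T / 2^n)))
       + (V1 (disp n k \<omega>) * dI T n k \<omega> + \<kappa> * (T / 2^n)))))"
    proof (intro sum.cong refl)
      fix k
      have "dX T n k \<omega> = dB T n k \<omega> + dI T n k \<omega>" by (simp add: dB_def[OF T])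
      then have "V1 (disp n k \<omega>) * dX T n k \<omega> = V1 (disp n k \<omega>) * dB T n k \<omega> + V1 (disp n k \<omega>) * dI T n k \<omega>"
        by (simp only: distrib_left)
      then show "V (disp n k \<omega> + dX T n k \<omega>) - V (disp n k \<omega>) =
        taylor_rem n k \<omega> + (V1 (disp n k \<omega>) * (dB T n k \<omega> - b (X (grid_time T n k) \<omega>) * (T / 2^n))
       + (1/2 * (V2 (disp n k \<omega>) * ((dX T n k \<omega>)\<^sup>2 - (vol T n k \<omega>)\<^sup>2 * (T / 2^n)))
       + (V1 (disp n k \<omega>) * dI T n k \<omega> + \<kappa> * (T / 2^n))))"
        unfolding taylor_rem_def disp_generator[OF w, of n k, symmetric] by (simp add: algebra_simps)
    qed
    also have "\<dots> = (\<Sum>k<2^n. taylor_rem n k \<omega>)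
     + ((\<Sum>k<2^n. V1 (disp n k \<omega>) * (dB T n k \<omega> - b (X (grid_time T n k) \<omega>) * (T / 2^n)))
     + (1/2 * (\<Sum>k<2^n. V2 (disp n k \<omega>) * ((dX T n k \<omega>)\<^sup>2 - (vol T n k \<omega>)\<^sup>2 * (T / 2^n)))
     + (Z n \<omega> + \<kappa> * T)))"
      unfolding Z_def sum.distrib sum_distrib_left by simp
    finally show ?thesis unfolding Y_def by simp
  qed
  \<comment> \<open>The first entry gives \<open>2 * \<eta> \<le> 1 / T\<close> for the probability,
    the second \<open>\<eta> + \<epsilon> * T / 2 \<le> \<epsilon> * T\<close> for the size. The
    third gives \<open>a + \<eta> \<le> (\<epsilon> * T / 2)^2\<close>, so that the bound on the
    square of \<open>Z n\<close> yields
    \<open>\<bar>Z n \<omega>\<bar> \<le> \<epsilon> * T / 2\<close>.\<close>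
  define \<eta> where "\<eta> = min (1 / (2 * T)) (min (\<epsilon> * T / 4) ((\<epsilon> * T)\<^sup>2 / 8))"
  have "\<eta> \<le> 1 / (2 * T)" by (simp add: \<eta>_def)
  then have \<eta>: "0 < \<eta>" "2 * \<eta> \<le> 1 / T" "\<eta> \<le> \<epsilon> * T / 4" "\<eta> \<le> (\<epsilon> * T)\<^sup>2 / 8"
    using \<epsilon> T by (simp_all add: \<eta>_def min_le_iff_disj)
  define a where "a = (\<epsilon> * T)\<^sup>2 / 8"
  have a: "0 < a" using \<epsilon> T by (simp add: a_def)
  obtain n where n: "small_off M \<eta> \<eta> (Y n)"
    using Y \<eta>(1) unfolding vanishes_in_prob_def eventually_sequentially by blast
  have "small_off M (2 * C\<^sup>2 * coeff_bound\<^sup>2 * T / a + \<eta>) (a + \<eta>) (\<lambda>\<omega>. (Z n \<omega>)\<^sup>2)"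
    unfolding Z_def by (rule weighted_noise_small_off[OF T ad(1) bd(1) a \<eta>(1)])
  then obtain E where E: "E \<in> sets M" "measure M E \<le> 2 * C\<^sup>2 * coeff_bound\<^sup>2 * T / a + \<eta>"
    "\<And>\<omega>. \<omega> \<in> space M - E \<Longrightarrow> (Z n \<omega>)\<^sup>2 \<le> a + \<eta>" unfolding small_off_def by auto
  have "small_off M (2 * C\<^sup>2 * coeff_bound\<^sup>2 * T / a + \<eta>) (\<epsilon> * T / 2) (Z n)"
    unfolding small_off_def
  proof (intro bexI[OF _ E(1)] conjI E(2) ballI)
    fix \<omega> assume "\<omega> \<in> space M - E"
    from E(3)[OF this] have "(Z n \<omega>)\<^sup>2 \<le> (\<epsilon> * T / 2)\<^sup>2" using \<eta>(4) by (simp add: a_def power_divide)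
    then show "\<bar>Z n \<omega>\<bar> \<le> \<epsilon> * T / 2" using \<epsilon> T by (simp add: abs_le_square_iff[symmetric])
  qed
  from small_off_add[OF n this]
  show ?thesis
  proof (rule small_off_mono)
    have "2 * C\<^sup>2 * coeff_bound\<^sup>2 * T / a = 16 * C\<^sup>2 * coeff_bound\<^sup>2 / \<epsilon>\<^sup>2 / T"
      using \<epsilon> T by (simp add: a_def power2_eq_square field_simps)
    then show "\<eta> + (2 * C\<^sup>2 * coeff_bound\<^sup>2 * T / a + \<eta>) \<le> (16 * C\<^sup>2 * coeff_bound\<^sup>2 / \<epsilon>\<^sup>2 + 1) / T"
      using \<eta>(2) by (simp add: add_divide_distrib)
    have "0 < \<epsilon> * T" using \<epsilon> T by simp
    then show "\<eta> + \<epsilon> * T / 2 \<le> \<epsilon> * T" using \<eta>(3) by linarith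
    show "\<bar>total \<omega> - \<kappa> * T\<bar> \<le> \<bar>Y n \<omega> + Z n \<omega>\<bar>" if "\<omega> \<in> space M" for \<omega> using eq[OF that] by simp
  qed
qed

end

section \<open>The affinity\<close>

lemma ex_antiderivative:
  fixes f :: "real \<Rightarrow> real"
  assumes "continuous_on UNIV f"
  obtains G where "G 0 = 0" "\<And>x. (G has_real_derivative f x) (at x)"
proof -
  have "\<exists>G. \<forall>x::real. - \<infinity> < ereal x \<longrightarrow> ereal x < \<infinity> \<longrightarrow> (G has_vector_derivative f x) (at x)"
    using assms by (intro einterval_antiderivative) (auto simp: continuous_on_eq_continuous_at)
  then obtain G where "\<And>x. (G has_real_derivative f x) (at x)"
    by (auto simp: has_real_derivative_iff_has_vector_derivative)
  then have "((\<lambda>x. G x - G 0) has_real_derivative f x) (at x)" for x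
    by (auto intro!: derivative_eq_intros)
  then show ?thesis by (intro that[of "\<lambda>x. G x - G 0"]) auto
qed

context periodic_sde
begin

text \<open>Divided by \<open>t\<close>, the functional tends to the left side, since its boundary
  term is bounded. The concentration bound with a constant independent of \<open>t\<close> and the
  Borel-Cantelli lemma place this limit near \<kappa>.\<close>

lemma circulation_relation:
  assumes dV: "\<And>d. (V has_real_derivative V1 d) (at d)"
    and dV1: "\<And>d. (V1 has_real_derivative V2 d) (at d)"
    and V2_cont: "continuous_on UNIV V2" and V_0: "V 0 = 0"
    and generator: "\<And>d. b (y + d) * V1 d + (\<sigma> (y + d))\<^sup>2 / 2 * V2 d = \<kappa>"
    and Jp: "AE \<omega> in M. ((\<lambda>t. real (cycle_count_plus (\<lambda>s. X s \<omega>) t) / t) \<longlongrightarrow> Jp) at_top"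
    and Jm: "AE \<omega> in M. ((\<lambda>t. real (cycle_count_minus (\<lambda>s. X s \<omega>) t) / t) \<longlongrightarrow> Jm) at_top"
  shows "V 1 * Jp + V (-1) * Jm = \<kappa>"
proof (rule ccontr)
  define c where "c = V 1 * Jp + V (-1) * Jm"
  assume "V 1 * Jp + V (-1) * Jm \<noteq> \<kappa>"
  then have ne: "c \<noteq> \<kappa>" by (simp add: c_def)
  have bounded: "\<exists>K. \<forall>d. \<bar>d\<bar> \<le> 1 \<longrightarrow> \<bar>f d\<bar> \<le> K" if "continuous_on UNIV f" for f :: "real \<Rightarrow> real"
  proof -
    have "compact (f ` {-1..1})"
      by (intro compact_continuous_image continuous_on_subset[OF that]) auto
    then obtain K where "\<And>x. x \<in> {-1..1} \<Longrightarrow> \<bar>f x\<bar> \<le> K"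
      using compact_imp_bounded bounded_iff by (metis imageI real_norm_def)
    then show ?thesis by (intro exI[of _ K]) (auto simp: abs_le_iff)
  qed
  have Vc: "continuous_on UNIV V" "continuous_on UNIV V1"
    by (rule DERIV_continuous_on, rule dV) (rule DERIV_continuous_on, rule dV1)
  obtain C0 where C0: "\<And>d. \<bar>d\<bar> \<le> 1 \<Longrightarrow> \<bar>V d\<bar> \<le> C0" using bounded[OF Vc(1)] by blast
  obtain C1 where C1: "\<And>d. \<bar>d\<bar> \<le> 1 \<Longrightarrow> \<bar>V1 d\<bar> \<le> C1" using bounded[OF Vc(2)] by blast
  obtain C2 where C2: "\<And>d. \<bar>d\<bar> \<le> 1 \<Longrightarrow> \<bar>V2 d\<bar> \<le> C2" using bounded[OF V2_cont] by blast
  define C where "C = max C1 C2"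
  have C: "\<bar>V1 d\<bar> \<le> C \<and> \<bar>V2 d\<bar> \<le> C" if "\<bar>d\<bar> \<le> 1" for d
    using C1[OF that] C2[OF that] by (auto simp: C_def le_max_iff_disj)
  define A where "A t \<omega> = V 1 * cycle_count_plus (\<lambda>s. X s \<omega>) t + V (-1) * cycle_count_minus (\<lambda>s. X s \<omega>) t
     + V (X t \<omega> - cycle_base (\<lambda>s. X s \<omega>) t)" for t \<omega>
  \<comment> \<open>Half the gap: the normalised error tends to
    \<open>\<bar>c - \<kappa>\<bar>\<close>, yet would eventually be at most half of it.\<close>
  define \<epsilon> where "\<epsilon> = \<bar>c - \<kappa>\<bar> / 2"
  have \<epsilon>: "0 < \<epsilon>" using ne by (simp add: \<epsilon>_def)
  define K where "K = 16 * C\<^sup>2 * coeff_bound\<^sup>2 / \<epsilon>\<^sup>2 + 1"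
  \<comment> \<open>Along squares the exceptional probabilities \<open>K / t j\<close> are
    summable.\<close>
  define t where "t j = (real (Suc j))\<^sup>2" for j
  have t0: "0 < t j" for j by (simp add: t_def)
  have "\<exists>E\<in>sets M. measure M E \<le> K / t j \<and> (\<forall>\<omega>\<in>space M - E. \<bar>A (t j) \<omega> - \<kappa> * t j\<bar> \<le> \<epsilon> * t j)" for j
  proof -
    interpret tf: cycle_test_function M F W X b \<sigma> y V V1 V2 \<kappa> C "t j"
      by unfold_locales (use dV dV1 V2_cont V_0 generator C t0 in auto)
    show ?thesis using tf.total_concentrates[OF \<epsilon>]
      unfolding small_off_def tf.total_def A_def K_def .
  qed
  then have "\<forall>j. \<exists>E. E \<in> sets M \<and> measure M E \<le> K / t j \<and> (\<forall>\<omega>\<in>space M - E. \<bar>A (t j) \<omega> - \<kappa> * t j\<bar> \<le> \<epsilon> * t j)"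
    by blast
  then obtain E where E: "\<forall>j. E j \<in> sets M \<and> measure M (E j) \<le> K / t j \<and>
      (\<forall>\<omega>\<in>space M - E j. \<bar>A (t j) \<omega> - \<kappa> * t j\<bar> \<le> \<epsilon> * t j)" by (rule choice[THEN exE])
  have "summable (\<lambda>j. inverse (real j ^ 2))" by (rule inverse_power_summable) simp
  then have "summable (\<lambda>j. K * inverse (real (Suc j) ^ 2))"
    by (intro summable_mult) (subst summable_Suc_iff[where f="\<lambda>j. inverse (real j ^ 2)"], simp)
  then have "summable (\<lambda>j. measure M (E j))"
    by (rule summable_comparison_test_ev[rotated]) (use E in \<open>auto simp: t_def divide_inverse\<close>)
  then have "AE \<omega> in M. \<forall>\<^sub>F j in sequentially. \<omega> \<in> space M - E j"
    using E by (intro borel_cantelli_AE1) (auto simp: emeasure_eq_measure)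
  then have "AE \<omega> in M. False"
    using Jp Jm AE_space
  proof eventually_elim
    case (elim \<omega>)
    have tt: "filterlim t at_top sequentially"
      unfolding t_def by (intro filterlim_at_top_mono[OF filterlim_real_sequentially] always_eventually allI)
        (auto simp: power2_eq_square algebra_simps)
    have "(\<lambda>j. V (X (t j) \<omega> - cycle_base (\<lambda>s. X s \<omega>) (t j)) / t j) \<longlonglongrightarrow> 0"
    proof (rule Lim_null_comparison)
      have "(\<lambda>j. 1 / t j) \<longlonglongrightarrow> 0"
        using tendsto_inverse_0_at_top[OF tt] by (simp add: inverse_eq_divide)
      from tendsto_mult_right_zero[OF this, of C0]
      show "(\<lambda>j. C0 * (1 / t j)) \<longlonglongrightarrow> 0" .
      show "\<forall>\<^sub>F j in sequentially. norm (V (X (t j) \<omega> - cycle_base (\<lambda>s. X s \<omega>) (t j)) / t j) \<le> C0 * (1 / t j)"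
      proof (intro always_eventually allI)
        fix j
        have "\<bar>V (X (t j) \<omega> - cycle_base (\<lambda>s. X s \<omega>) (t j))\<bar> \<le> C0"
          using abs_diff_cycle_base_less[OF X_cont[OF elim(4)] less_imp_le[OF t0]] by (intro C0 less_imp_le)
        then show "norm (V (X (t j) \<omega> - cycle_base (\<lambda>s. X s \<omega>) (t j)) / t j) \<le> C0 * (1 / t j)"
          using t0[of j] by (simp add: divide_right_mono)
      qed
    qed
    from tendsto_add[OF tendsto_add[OF
        tendsto_mult_left[OF filterlim_compose[OF elim(2) tt], of "V 1"]
        tendsto_mult_left[OF filterlim_compose[OF elim(3) tt], of "V (-1)"]] this]
    have "(\<lambda>j. A (t j) \<omega> / t j) \<longlonglongrightarrow> c" by (simp add: A_def c_def add_divide_distrib)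
    then have lim: "(\<lambda>j. \<bar>A (t j) \<omega> / t j - \<kappa>\<bar>) \<longlonglongrightarrow> \<bar>c - \<kappa>\<bar>" by (intro tendsto_intros)
    have "\<forall>\<^sub>F j in sequentially. \<bar>A (t j) \<omega> / t j - \<kappa>\<bar> \<le> \<epsilon>"
      using elim(1)
    proof eventually_elim
      case (elim j)
      then have "\<bar>A (t j) \<omega> - \<kappa> * t j\<bar> \<le> \<epsilon> * t j" using E by blast
      moreover have "A (t j) \<omega> / t j - \<kappa> = (A (t j) \<omega> - \<kappa> * t j) / t j" using t0[of j] by (simp add: field_simps)
      ultimately show ?case using t0[of j] by (simp add: pos_divide_le_eq)
    qed
    then have "\<bar>c - \<kappa>\<bar> \<le> \<epsilon>" by (intro tendsto_upperbound[OF lim]) auto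
    then show False using ne by (simp add: \<epsilon>_def)
  qed
  then show False by simp
qed

lemma affinity:
  assumes Jp: "AE \<omega> in M. ((\<lambda>t. real (cycle_count_plus (\<lambda>s. X s \<omega>) t) / t) \<longlongrightarrow> Jp) at_top"
    and Jm: "AE \<omega> in M. ((\<lambda>t. real (cycle_count_minus (\<lambda>s. X s \<omega>) t) / t) \<longlongrightarrow> Jm) at_top"
  shows "ln (Jp / Jm) = 2 * integral {0..1} (\<lambda>x. b x / (\<sigma> x)\<^sup>2)"
proof -
  define a where "a x = 2 * (b x / (\<sigma> x)\<^sup>2)" for x
  have \<sigma>0: "\<sigma> x \<noteq> 0" for x using \<sigma>_pos[of x] by simp
  have a_cont: "continuous_on UNIV a"
    unfolding a_def using \<sigma>0 by (intro continuous_intros b_cont \<sigma>_cont) auto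
  \<comment> \<open>\<open>Q 1\<close> will be the affinity, and \<open>exp (- Q _)\<close> the
    density of the scale function.\<close>
  obtain Q where Q: "Q 0 = 0" "\<And>x. (Q has_real_derivative a x) (at x)" using ex_antiderivative[OF a_cont] by blast
  have "(a has_integral Q 1 - Q 0) {0..1}"
    by (rule fundamental_theorem_of_calculus)
      (auto intro: has_field_derivative_at_within Q(2) simp: has_real_derivative_iff_has_vector_derivative[symmetric])
  then have "integral {0..1} a = Q 1" using Q(1) by (simp add: has_integral_iff)
  then have Q1: "Q 1 = 2 * integral {0..1} (\<lambda>x. b x / (\<sigma> x)\<^sup>2)"
    unfolding a_def[abs_def] by (simp only: Henstock_Kurzweil_Integration.integral_mult_right)
  have a_per: "a (x + 1) = a x" for x by (simp add: a_def b_per \<sigma>_per)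
  have Qs: "((\<lambda>x. Q (x + c)) has_real_derivative a (x + c)) (at x)" for x c
    using Q(2)[of "x + c"] by (simp add: DERIV_shift)
  have "((\<lambda>x. Q (x + 1) - Q x) has_real_derivative 0) (at x)" for x
    using DERIV_diff[OF Qs[of 1 x] Q(2)[of x]] by (simp add: a_per)
  then have Q_shift: "Q (x + 1) = Q x + Q 1" for x
    using DERIV_isconst_all[of "\<lambda>x. Q (x + 1) - Q x" x 0] Q(1) by auto
  \<comment> \<open>The scale density seen from \<open>y\<close>: its logarithmic derivative
    \<open>- 2 * b / \<sigma>^2\<close> makes the generator vanish on the antiderivative
    \<open>S\<close>.\<close>
  define s1 where "s1 d = exp (- Q (d + y))" for d
  define s2 where "s2 d = - a (d + y) * s1 d" for d
  have s1: "(s1 has_real_derivative s2 d) (at d)" for d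
    unfolding s1_def[abs_def] s2_def using Qs by (auto intro!: derivative_eq_intros)
  have s1_cont: "continuous_on UNIV s1" by (rule DERIV_continuous_on, rule s1)
  have ay_cont: "continuous_on UNIV (\<lambda>d. a (d + y))"
    by (intro continuous_on_compose2[OF a_cont] continuous_intros) auto
  have s2_cont: "continuous_on UNIV s2"
    unfolding s2_def[abs_def] by (intro continuous_intros ay_cont s1_cont)
  obtain S where S: "S 0 = 0" "\<And>x. (S has_real_derivative s1 x) (at x)" using ex_antiderivative[OF s1_cont] by blast
  have gen: "b (y + d) * s1 d + (\<sigma> (y + d))\<^sup>2 / 2 * s2 d = 0" for d
    using \<sigma>0[of "y + d"] by (simp add: s2_def a_def add.commute)
  have rel1: "S 1 * Jp + S (-1) * Jm = 0"
    by (rule circulation_relation[OF S(2) s1 s2_cont S(1) gen Jp Jm])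
  \<comment> \<open>A shift by one period multiplies the scale density by
    \<open>exp (- Q 1)\<close>, so this combination is constant; its values at -1 and 0 relate
    \<open>S 1\<close> to \<open>S (-1)\<close>.\<close>
  have "((\<lambda>x. S (x + 1) - exp (- Q 1) * S x) has_real_derivative 0) (at x)" for x
  proof -
    have "((\<lambda>x. S (x + 1)) has_real_derivative s1 (x + 1)) (at x)" using S(2)[of "x + 1"] by (simp add: DERIV_shift)
    moreover have "s1 (x + 1) = exp (- Q 1) * s1 x"
      using Q_shift[of "x + y"] by (simp add: s1_def exp_add[symmetric] add_ac)
    ultimately show ?thesis using S(2)[of x] by (auto intro!: derivative_eq_intros)
  qed
  then have "S (- 1 + 1) - exp (- Q 1) * S (- 1) = S (0 + 1) - exp (- Q 1) * S 0"
    by (rule DERIV_isconst_all[OF allI])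
  then have Sm: "S 1 = - exp (- Q 1) * S (- 1)" using S(1) by simp
  have S1: "S (-1) \<noteq> 0"
  proof -
    have "S (-1) < S 0" by (rule DERIV_pos_imp_increasing[where f=S]) (auto simp: s1_def intro!: exI[of _ "s1 _"] S(2))
    then show ?thesis using S(1) by simp
  qed
  have "S (-1) * (Jm - exp (- Q 1) * Jp) = 0" using rel1 Sm by (simp add: algebra_simps)
  then have Jm_eq: "Jm = exp (- Q 1) * Jp" using S1 by simp
  \<comment> \<open>The density of the speed measure. By variation of constants,
    \<open>u = s1 * m\<close> with \<open>m' = 2 / (\<sigma>^2 * s1)\<close> solves
    \<open>b * u + \<sigma>^2 / 2 * u' = 1\<close>, the equation for the derivative of a test
    function with \<kappa> = 1.\<close>
  define m1 where "m1 d = 2 / ((\<sigma> (d + y))\<^sup>2 * s1 d)" for d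
  have \<sigma>y: "continuous_on UNIV (\<lambda>d. \<sigma> (d + y))"
    by (intro continuous_on_compose2[OF \<sigma>_cont] continuous_intros) auto
  have m1_cont: "continuous_on UNIV m1"
    unfolding m1_def[abs_def] using \<sigma>0 by (intro continuous_intros \<sigma>y s1_cont) (auto simp: s1_def)
  obtain m where m: "m 0 = 0" "\<And>x. (m has_real_derivative m1 x) (at x)" using ex_antiderivative[OF m1_cont] by blast
  have m_cont: "continuous_on UNIV m" by (rule DERIV_continuous_on, rule m(2))
  define u2 where "u2 d = s2 d * m d + m1 d * s1 d" for d
  have u1: "((\<lambda>d. s1 d * m d) has_real_derivative u2 d) (at d)" for d
    unfolding u2_def by (rule DERIV_mult[OF s1 m(2)])
  have u1_cont: "continuous_on UNIV (\<lambda>d. s1 d * m d)" by (intro continuous_intros s1_cont m_cont)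
  have u2_cont: "continuous_on UNIV u2"
    unfolding u2_def[abs_def] by (intro continuous_intros s1_cont s2_cont m_cont m1_cont)
  obtain U where U: "U 0 = 0" "\<And>x. (U has_real_derivative s1 x * m x) (at x)" using ex_antiderivative[OF u1_cont] by blast
  have "b (y + d) * (s1 d * m d) + (\<sigma> (y + d))\<^sup>2 / 2 * u2 d = 1" for d
  proof -
    have "b (y + d) * (s1 d * m d) + (\<sigma> (y + d))\<^sup>2 / 2 * u2 d =
      (b (y + d) * s1 d + (\<sigma> (y + d))\<^sup>2 / 2 * s2 d) * m d + (\<sigma> (y + d))\<^sup>2 / 2 * (m1 d * s1 d)"
      by (simp add: u2_def algebra_simps)
    also have "\<dots> = 1" unfolding gen using \<sigma>0[of "y + d"] by (simp add: m1_def s1_def add.commute)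
    finally show ?thesis .
  qed
  then have rel2: "U 1 * Jp + U (-1) * Jm = 1"
    by (rule circulation_relation[OF U(2) u1 u2_cont U(1) _ Jp Jm])
  \<comment> \<open>\<open>Jp = 0\<close> would force \<open>Jm = 0\<close> and contradict
    \<open>rel2\<close>. Then \<open>Jm = exp (- Q 1) * Jp\<close> is nonzero too, so the quotient
    is a genuine one.\<close>
  have "Jp \<noteq> 0" using rel2 Jm_eq by auto
  then have "Jp / Jm = exp (Q 1)" unfolding Jm_eq by (simp add: exp_minus field_simps)
  then show ?thesis using Q1 by simp
qed

end

theorem theorem4p1:
  fixes b \<sigma> :: "real \<Rightarrow> real" and y :: real
    and M :: "'a measure" and F :: "real \<Rightarrow> 'a measure"
    and W X :: "real \<Rightarrow> 'a \<Rightarrow> real" and Jp Jm :: real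
  assumes "continuous_on UNIV b" and "continuous_on UNIV \<sigma>"
    and "\<And>x. \<sigma> x > 0"
    and "\<And>x. b (x + 1) = b x" and "\<And>x. \<sigma> (x + 1) = \<sigma> x"
    and "sde_weak_solution M F W X b \<sigma> y"
    and "AE \<omega> in M. ((\<lambda>t. real (cycle_count_plus (\<lambda>s. X s \<omega>) t) / t) \<longlongrightarrow> Jp) at_top"
    and "AE \<omega> in M. ((\<lambda>t. real (cycle_count_minus (\<lambda>s. X s \<omega>) t) / t) \<longlongrightarrow> Jm) at_top"
  shows "ln (Jp / Jm) = 2 * integral {0..1} (\<lambda>x. b x / (\<sigma> x)\<^sup>2)"
proof -
  have bm: "brownian_motion M F W" using assms(6) by (simp add: sde_weak_solution_def)
  then interpret prob_space M by (simp add: brownian_motion_def)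
  interpret periodic_sde M F W X b \<sigma> y by unfold_locales (use assms bm in auto)
  show ?thesis by (rule affinity[OF assms(7,8)])
qed

end
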